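(* Let $m \in \mathbb{R}$ with $m \neq 0$, let $\lambda \in \mathbb{R}$, let $(M,g)$ be a closed (i.e. compact and without boundary) smooth Riemannian manifold, and let $X$ be a smooth vector field on $M$ such that $$\mathrm{Ric} + \frac{1}{2}\mathcal{L}_X g - \frac{1}{m} X^* \otimes X^* = \lambda g$$ on $M$. Suppose that $\mathrm{div}\, X = 0$. Then $X$ is a Killing field.
   Context: Here $\mathrm{Ric}$ is the Ricci tensor of $g$, $\mathcal{L}_X g$ is the Lie derivative of the metric along $X$, $X^* = g(X,\cdot)$ is the 1-form dual to $X$, and $\mathrm{div}$ is the Riemannian divergence. The vector field $X$ is Killing if $\mathcal{L}_X g = 0$; in particular the zero vector field counts as Killing. *)

theory Defs
  imports "HOL-Analysis.Analysis"
begin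

section \<open>Smooth maps between open sets of Euclidean spaces\<close>

text \<open>The order \<open>k\<close> clause asks for Frechet differentiability and for all directional derivatives
  to be of class \<open>C\<close> of order \<open>k\<close>. The derivatives are taken in the full space, so these notions are
  only used on open sets.\<close>

primrec Ck_on ::
  "nat \<Rightarrow> ('v::real_normed_vector \<Rightarrow> 'w::real_normed_vector) \<Rightarrow> 'v set \<Rightarrow> bool" where
  "Ck_on 0 f S \<longleftrightarrow> continuous_on S f"
| "Ck_on (Suc k) f S \<longleftrightarrow>
     (\<forall>x\<in>S. f differentiable (at x)) \<and> (\<forall>v. Ck_on k (\<lambda>x. frechet_derivative f (at x) v) S)"

definition smooth_on :: "('v::real_normed_vector \<Rightarrow> 'w::real_normed_vector) \<Rightarrow> 'v set \<Rightarrow> bool" where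
  "smooth_on f S \<longleftrightarrow> (\<forall>k. Ck_on k f S)"

definition partial :: "'n::finite \<Rightarrow> (real^'n \<Rightarrow> real) \<Rightarrow> real^'n \<Rightarrow> real" where
  "partial i f x = frechet_derivative f (at x) (axis i 1)"

section \<open>Smooth manifolds\<close>

text \<open>A chart is a pair of its domain and its coordinate map; the values of the map outside
  the domain are irrelevant.\<close>

type_synonym ('a, 'n) chart = "'a set \<times> ('a \<Rightarrow> real^'n)"

definition chart_image :: "('a, 'n::finite) chart \<Rightarrow> (real^'n) set" where
  "chart_image c = snd c ` fst c"

definition transition ::
  "('a, 'n::finite) chart \<Rightarrow> ('a, 'n) chart \<Rightarrow> real^'n \<Rightarrow> real^'n" where
  "transition c d = snd d \<circ> inv_into (fst c) (snd c)"

text \<open>An \<open>'n\<close>-dimensional manifold without boundary: chart images are open in the whole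
  Euclidean space. The atlas need not be maximal; it determines the smooth structure.\<close>

locale smooth_manifold =
  fixes M :: "'a topology" and A :: "('a, 'n::finite) chart set"
  assumes Hausdorff: "Hausdorff_space M"
    and second_countable: "second_countable M"
    and chart_open: "c \<in> A \<Longrightarrow> openin M (fst c)"
    and chart_image_open: "c \<in> A \<Longrightarrow> open (chart_image c)"
    and chart_homeo: "c \<in> A \<Longrightarrow>
      homeomorphic_map (subtopology M (fst c)) (top_of_set (chart_image c)) (snd c)"
    and cover: "(\<Union>c\<in>A. fst c) = topspace M"
    and transition_smooth: "c \<in> A \<Longrightarrow> d \<in> A \<Longrightarrow>
      smooth_on (transition c d) (snd c ` (fst c \<inter> fst d))"

section \<open>Vector fields and covariant 2-tensor fields\<close>

text \<open>A tensor field assigns to every chart of the atlas its components, as functions of the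
  coordinates \<open>x\<close> in the image of that chart, subject to the tensor transformation law.
  The component \<open>(i, j)\<close> of a covariant 2-tensor is the entry \<open>$ i $ j\<close> of a matrix.
  Values at charts outside the atlas, or at points outside a chart image, are irrelevant.\<close>

type_synonym ('a, 'n) vector_field = "('a, 'n) chart \<Rightarrow> real^'n \<Rightarrow> real^'n"
type_synonym ('a, 'n) tensor2_field = "('a, 'n) chart \<Rightarrow> real^'n \<Rightarrow> real^'n^'n"

definition smooth_vector_field ::
  "('a, 'n::finite) chart set \<Rightarrow> ('a, 'n) vector_field \<Rightarrow> bool" where
  "smooth_vector_field A X \<longleftrightarrow>
     (\<forall>c\<in>A. smooth_on (X c) (chart_image c)) \<and>
     (\<forall>c\<in>A. \<forall>d\<in>A. \<forall>p \<in> fst c \<inter> fst d.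
        X d (snd d p) = jacobian (transition c d) (at (snd c p)) *v X c (snd c p))"

definition smooth_tensor2_field ::
  "('a, 'n::finite) chart set \<Rightarrow> ('a, 'n) tensor2_field \<Rightarrow> bool" where
  "smooth_tensor2_field A T \<longleftrightarrow>
     (\<forall>c\<in>A. smooth_on (T c) (chart_image c)) \<and>
     (\<forall>c\<in>A. \<forall>d\<in>A. \<forall>p \<in> fst c \<inter> fst d.
        let J = jacobian (transition c d) (at (snd c p))
        in T c (snd c p) = transpose J ** T d (snd d p) ** J)"

section \<open>Riemannian manifolds\<close>

locale riemannian_manifold = smooth_manifold M A
  for M :: "'a topology" and A :: "('a, 'n::finite) chart set" +
  fixes g :: "('a, 'n) tensor2_field"
  assumes metric_tensor: "smooth_tensor2_field A g"
    and metric_sym: "c \<in> A \<Longrightarrow> x \<in> chart_image c \<Longrightarrow> transpose (g c x) = g c x"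
    and metric_pos: "c \<in> A \<Longrightarrow> x \<in> chart_image c \<Longrightarrow> v \<noteq> 0 \<Longrightarrow> 0 < v \<bullet> (g c x *v v)"

locale closed_riemannian_manifold = riemannian_manifold M A g
  for M :: "'a topology" and A :: "('a, 'n::finite) chart set" and g :: "('a, 'n) tensor2_field" +
  assumes compact: "compact_space M"

subsection \<open>Tensor calculus in local coordinates\<close>

text \<open>Below, \<open>G\<close> and \<open>X\<close> are the components of a metric and of a vector field in one chart.\<close>

text \<open>\<open>christoffel G x k i j\<close> is \<open>\<Gamma>\<^sup>k\<^sub>i\<^sub>j\<close>, the \<open>k\<close>-th component of \<open>\<nabla>\<^sub>i \<partial>\<^sub>j\<close> for the Levi-Civita
  connection.\<close>

definition christoffel ::
  "(real^'n \<Rightarrow> real^'n^'n) \<Rightarrow> real^'n \<Rightarrow> 'n::finite \<Rightarrow> 'n \<Rightarrow> 'n \<Rightarrow> real" where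
  "christoffel G x k i j =
     (1/2) * (\<Sum>l\<in>UNIV. matrix_inv (G x) $ k $ l *
       (partial i (\<lambda>y. G y $ j $ l) x + partial j (\<lambda>y. G y $ i $ l) x
         - partial l (\<lambda>y. G y $ i $ j) x))"

text \<open>\<open>riemann G x l i j k\<close> is the \<open>l\<close>-th component of
  \<open>R(\<partial>\<^sub>i, \<partial>\<^sub>j) \<partial>\<^sub>k = \<nabla>\<^sub>i \<nabla>\<^sub>j \<partial>\<^sub>k - \<nabla>\<^sub>j \<nabla>\<^sub>i \<partial>\<^sub>k\<close>.\<close>

definition riemann ::
  "(real^'n \<Rightarrow> real^'n^'n) \<Rightarrow> real^'n \<Rightarrow> 'n::finite \<Rightarrow> 'n \<Rightarrow> 'n \<Rightarrow> 'n \<Rightarrow> real" where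
  "riemann G x l i j k =
     partial i (\<lambda>y. christoffel G y l j k) x - partial j (\<lambda>y. christoffel G y l i k) x
     + (\<Sum>m\<in>UNIV. christoffel G x l i m * christoffel G x m j k
                  - christoffel G x l j m * christoffel G x m i k)"

text \<open>\<open>Ric(Y, Z)\<close> is the trace of \<open>V \<mapsto> R(V, Y) Z\<close>; round spheres have positive Ricci tensor.\<close>

definition ricci :: "(real^'n \<Rightarrow> real^'n^'n) \<Rightarrow> real^'n \<Rightarrow> real^'n::finite^'n" where
  "ricci G x = (\<chi> j k. \<Sum>i\<in>UNIV. riemann G x i i j k)"

text \<open>The coordinate form of
  \<open>(L\<^sub>X g)(Y, Z) = X(g(Y, Z)) - g([X, Y], Z) - g(Y, [X, Z])\<close>.\<close>

definition lie_metric ::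
  "(real^'n \<Rightarrow> real^'n) \<Rightarrow> (real^'n \<Rightarrow> real^'n^'n) \<Rightarrow> real^'n \<Rightarrow> real^'n::finite^'n" where
  "lie_metric X G x = (\<chi> i j. \<Sum>k\<in>UNIV.
     X x $ k * partial k (\<lambda>y. G y $ i $ j) x
     + G x $ k $ j * partial i (\<lambda>y. X y $ k) x
     + G x $ i $ k * partial j (\<lambda>y. X y $ k) x)"

text \<open>The entry \<open>$ k $ i\<close> is the \<open>k\<close>-th component of \<open>\<nabla>\<^sub>i X\<close>; the divergence is the trace
  of the endomorphism \<open>\<nabla> X\<close>.\<close>

definition covariant_derivative ::
  "(real^'n \<Rightarrow> real^'n^'n) \<Rightarrow> (real^'n \<Rightarrow> real^'n) \<Rightarrow> real^'n \<Rightarrow> real^'n::finite^'n" where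
  "covariant_derivative G X x =
     (\<chi> k i. partial i (\<lambda>y. X y $ k) x + (\<Sum>j\<in>UNIV. christoffel G x k i j * X x $ j))"

definition divergence ::
  "(real^'n \<Rightarrow> real^'n^'n) \<Rightarrow> (real^'n \<Rightarrow> real^'n) \<Rightarrow> real^'n::finite \<Rightarrow> real" where
  "divergence G X x = trace (covariant_derivative G X x)"

definition dual_form ::
  "(real^'n \<Rightarrow> real^'n^'n) \<Rightarrow> (real^'n \<Rightarrow> real^'n) \<Rightarrow> real^'n \<Rightarrow> real^'n::finite" where
  "dual_form G X x = (\<chi> i. \<Sum>j\<in>UNIV. G x $ i $ j * X x $ j)"

definition tensor_product :: "real^'n::finite \<Rightarrow> real^'n \<Rightarrow> real^'n^'n" where
  "tensor_product a b = (\<chi> i j. a $ i * b $ j)"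

subsection \<open>Killing fields\<close>

definition killing_field ::
  "('a, 'n::finite) chart set \<Rightarrow> ('a, 'n) tensor2_field \<Rightarrow> ('a, 'n) vector_field \<Rightarrow> bool" where
  "killing_field A g X \<longleftrightarrow>
     smooth_vector_field A X \<and> (\<forall>c\<in>A. \<forall>x\<in>chart_image c. lie_metric (X c) (g c) x = 0)"

end

theory Submission
  imports Defs
begin

text \<open>
  Put \<open>L = \<L>\<^sub>X g\<close> and let \<open>V\<close> be the vector field dual to \<open>L(X, \<cdot>)\<close>. As \<open>div X = 0\<close>, the
  trace of the equation is \<open>R = n \<lambda> + \<bar>X\<bar>\<^sup>2 / m\<close>. Solving the equation for \<open>L\<close> gives
  \<open>V = 2 \<lambda> X + (2 / m) \<bar>X\<bar>\<^sup>2 X - 2 Ric(X)\<close>, and the contracted second Bianchi identity gives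
  \<open>div (Ric(X)) = X(R) / 2 + \<langle>Ric, L\<rangle> / 2\<close>. Substituting, all terms except one cancel and
  \<open>div V = \<bar>L\<bar>\<^sup>2 / 2\<close>. A divergence integrates to zero over a closed manifold, so \<open>L = 0\<close>.
  Integrals are taken chart by chart against the density \<open>\<surd>\<bar>det g\<bar>\<close>, so no orientation is needed.
\<close>

section \<open>Calculus of \<open>C\<^sup>k\<close> maps\<close>

text \<open>The field V is chosen because div V = (div L)(X) + <L, \<nabla>X>, and the symmetry of L
  makes the last term |L|^2 / 2. The equation turns (div L)(X) into derivatives of |X|^2 alone,
  which the contracted Bianchi identity balances against the scalar curvature. The work splits in
  two. In one chart (locale \<open>local_metric\<close>) connection and curvature are matrices, so
  that metric compatibility and both curvature identities become matrix algebra plus symmetry of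
  second derivatives. Across charts, the divergence is always evaluated in the chart that carries
  its cutoff function; what moves between charts is the density, the cutoffs and the derivatives
  V(\<phi>), for which the chain rule suffices. Only first derivatives of the cutoffs occur, so a
  piecewise polynomial bump of class C^1 is smooth enough.\<close>

lemma Ck_on_Suc_imp: "Ck_on (Suc k) f S \<Longrightarrow> Ck_on k f S"
proof (induction k arbitrary: f)
  case 0
  then show ?case
    by (auto intro!: continuous_at_imp_continuous_on differentiable_imp_continuous_within)
next
  case (Suc k)
  then show ?case by (metis Ck_on.simps(2))
qed

lemma Ck_on_mono: "Ck_on k f S \<Longrightarrow> j \<le> k \<Longrightarrow> Ck_on j f S"
  by (induction k) (auto simp: le_Suc_eq dest: Ck_on_Suc_imp simp del: Ck_on.simps)

lemma Ck_on_subset: "Ck_on k f S \<Longrightarrow> T \<subseteq> S \<Longrightarrow> Ck_on k f T"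
  by (induction k arbitrary: f) (auto intro: continuous_on_subset)

text \<open>Openness turns agreement on \<open>S\<close> into agreement near each point, so the
  derivatives agree as well and the induction can pass to them.\<close>

lemma Ck_on_cong:
  assumes "open S" "\<And>x. x \<in> S \<Longrightarrow> f x = g x" "Ck_on k f S"
  shows "Ck_on k g S"
  using assms(2,3)
proof (induction k arbitrary: f g)
  case 0
  then show ?case by (auto cong: continuous_on_cong)
next
  case (Suc k)
  have d: "f differentiable (at x)" if "x \<in> S" for x
    using Suc.prems that by auto
  have "g differentiable (at x)" if "x \<in> S" for x
    using has_derivative_transform_within_open[OF _ assms(1) that Suc.prems(1)] d[OF that]
    by (meson differentiable_def)
  moreover have "Ck_on k (\<lambda>x. frechet_derivative g (at x) v) S" for v
  proof (rule Suc.IH)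
    show "Ck_on k (\<lambda>x. frechet_derivative f (at x) v) S" using Suc.prems by auto
    show "frechet_derivative f (at x) v = frechet_derivative g (at x) v" if "x \<in> S" for x
      using frechet_derivative_transform_within_open[OF d[OF that] assms(1) that Suc.prems(1)]
      by simp
  qed
  ultimately show ?case by simp
qed

text \<open>Used to glue functions that are given by different formulas on different open sets:
  extensions by zero and bump functions.\<close>

lemma Ck_on_local:
  assumes "\<And>x. x \<in> S \<Longrightarrow> \<exists>T. open T \<and> x \<in> T \<and> Ck_on k f T"
  shows "Ck_on k f S"
  using assms
proof (induction k arbitrary: f)
  case 0
  then show ?case
    by (metis Ck_on.simps(1) continuous_at_imp_continuous_on continuous_on_eq_continuous_at)
next
  case (Suc k)
  then show ?case by (metis Ck_on.simps(2))
qed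

text \<open>Lets an explicit derivative formula stand in for \<open>frechet_derivative\<close>; each
  closure lemma below feeds its differentiation rule into this one.\<close>

lemma Ck_on_SucI:
  assumes "open S" "\<And>x. x \<in> S \<Longrightarrow> (f has_derivative f' x) (at x)" "\<And>v. Ck_on k (\<lambda>x. f' x v) S"
  shows "Ck_on (Suc k) f S"
proof -
  have "frechet_derivative f (at x) = f' x" if "x \<in> S" for x
    using assms(2)[OF that] frechet_derivative_at by metis
  then have "Ck_on k (\<lambda>x. frechet_derivative f (at x) v) S" for v
    by (intro Ck_on_cong[OF assms(1) _ assms(3)[of v]]) simp
  then show ?thesis
    using assms(2) by (auto simp: differentiable_def)
qed

lemma Ck_on_SucD:
  assumes "Ck_on (Suc k) f S"
  shows "x \<in> S \<Longrightarrow> (f has_derivative frechet_derivative f (at x)) (at x)"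
    and "Ck_on k (\<lambda>x. frechet_derivative f (at x) v) S"
  using assms frechet_derivative_works by auto

lemma Ck_on_const: "open S \<Longrightarrow> Ck_on k (\<lambda>x. c) S"
  by (induction k arbitrary: c) (auto simp: frechet_derivative_const)

lemma Ck_on_bounded_linear:
  assumes "open S" "bounded_linear L" "Ck_on k f S"
  shows "Ck_on k (\<lambda>x. L (f x)) S"
  using assms(3)
proof (induction k arbitrary: f)
  case 0
  then show ?case by (simp add: bounded_linear.continuous_on[OF assms(2)])
next
  case (Suc k)
  show ?case
    by (rule Ck_on_SucI[OF assms(1), where f' = "\<lambda>x v. L (frechet_derivative f (at x) v)"])
      (rule bounded_linear.has_derivative[OF assms(2)] Suc.IH Ck_on_SucD[OF Suc.prems] | assumption)+
qed

lemma Ck_on_add: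
  assumes "open S" "Ck_on k f S" "Ck_on k g S"
  shows "Ck_on k (\<lambda>x. f x + g x) S"
  using assms(2,3)
proof (induction k arbitrary: f g)
  case 0
  then show ?case by (auto intro: continuous_intros)
next
  case (Suc k)
  show ?case
    by (rule Ck_on_SucI[OF assms(1), where
          f' = "\<lambda>x v. frechet_derivative f (at x) v + frechet_derivative g (at x) v"])
      (rule has_derivative_add Suc.IH Ck_on_SucD[OF Suc.prems(1)] Ck_on_SucD[OF Suc.prems(2)]
        | assumption)+
qed

lemma Ck_on_mult:
  fixes f g :: "'v::real_normed_vector \<Rightarrow> real"
  assumes "open S" "Ck_on k f S" "Ck_on k g S"
  shows "Ck_on k (\<lambda>x. f x * g x) S"
  using assms(2,3)
proof (induction k arbitrary: f g)
  case 0
  then show ?case by (auto intro: continuous_intros)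
next
  case (Suc k)
  show ?case
  proof (rule Ck_on_SucI[OF assms(1)])
    show "((\<lambda>x. f x * g x) has_derivative
      (\<lambda>v. f x * frechet_derivative g (at x) v + frechet_derivative f (at x) v * g x)) (at x)"
      if "x \<in> S" for x
      using Suc.prems Ck_on_SucD(1) that by (intro has_derivative_mult) blast+
    show "Ck_on k (\<lambda>x. f x * frechet_derivative g (at x) v + frechet_derivative f (at x) v * g x) S"
      for v
      by (intro Ck_on_add assms Suc.IH Ck_on_SucD(2)[OF Suc.prems(1)] Ck_on_SucD(2)[OF Suc.prems(2)]
          Ck_on_Suc_imp[OF Suc.prems(1)] Ck_on_Suc_imp[OF Suc.prems(2)])
  qed
qed

lemma Ck_on_uminus: "open S \<Longrightarrow> Ck_on k f S \<Longrightarrow> Ck_on k (\<lambda>x. - f x) S"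
  by (rule Ck_on_bounded_linear) (auto intro: bounded_linear_minus bounded_linear_ident)

lemma Ck_on_diff:
  "open S \<Longrightarrow> Ck_on k f S \<Longrightarrow> Ck_on k g S \<Longrightarrow> Ck_on k (\<lambda>x. f x - g x) S"
  using Ck_on_add[OF _ _ Ck_on_uminus, of S k f g] by simp

lemma Ck_on_sum:
  "open S \<Longrightarrow> (\<And>i. i \<in> I \<Longrightarrow> Ck_on k (f i) S) \<Longrightarrow> Ck_on k (\<lambda>x. \<Sum>i\<in>I. f i x) S"
  by (induction I rule: infinite_finite_induct) (auto intro: Ck_on_const Ck_on_add)

lemma Ck_on_prod:
  fixes f :: "'i \<Rightarrow> 'v::real_normed_vector \<Rightarrow> real"
  shows "open S \<Longrightarrow> (\<And>i. i \<in> I \<Longrightarrow> Ck_on k (f i) S) \<Longrightarrow> Ck_on k (\<lambda>x. \<Prod>i\<in>I. f i x) S"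
  by (induction I rule: infinite_finite_induct) (auto intro: Ck_on_const Ck_on_mult)

text \<open>The derivative is a product that contains \<open>inverse (f x)\<close> itself, so the
  induction hypothesis covers that factor.\<close>

lemma Ck_on_inverse:
  fixes f :: "'v::real_normed_vector \<Rightarrow> real"
  assumes "open S" "Ck_on k f S" "\<And>x. x \<in> S \<Longrightarrow> f x \<noteq> 0"
  shows "Ck_on k (\<lambda>x. inverse (f x)) S"
  using assms(2)
proof (induction k)
  case 0
  then show ?case using assms(3) by (auto intro: continuous_intros)
next
  case (Suc k)
  show ?case
  proof (rule Ck_on_SucI[OF assms(1)])
    show "((\<lambda>x. inverse (f x)) has_derivative
      (\<lambda>v. - (inverse (f x) * frechet_derivative f (at x) v * inverse (f x)))) (at x)"
      if "x \<in> S" for x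
      using Suc.prems Ck_on_SucD(1) that assms(3) by (intro Deriv.has_derivative_inverse) blast+
    show "Ck_on k (\<lambda>x. - (inverse (f x) * frechet_derivative f (at x) v * inverse (f x))) S"
      for v
      by (intro Ck_on_uminus Ck_on_mult assms(1) Suc.IH Ck_on_SucD(2)[OF Suc.prems]
          Ck_on_Suc_imp[OF Suc.prems])
  qed
qed

text \<open>On either side of 0 the derivative of sqrt |t| is sqrt |t| / (2 t). Written this way it
  contains the function itself, which is what the induction in \<open>Ck_on_sqrt_abs\<close> feeds
  on.\<close>

lemma has_derivative_sqrt_abs:
  fixes f :: "'v::real_normed_vector \<Rightarrow> real"
  assumes "(f has_derivative f') (at x)" "f x \<noteq> 0"
  shows "((\<lambda>x. sqrt \<bar>f x\<bar>) has_derivative (\<lambda>v. sqrt \<bar>f x\<bar> * inverse (2 * f x) * f' v)) (at x)"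
proof -
  have "((\<lambda>t. sqrt \<bar>t\<bar>) has_real_derivative sqrt \<bar>f x\<bar> * inverse (2 * f x)) (at (f x))"
  proof (cases "0 < f x")
    case True
    have "(sqrt has_real_derivative sqrt \<bar>f x\<bar> * inverse (2 * f x)) (at (f x))"
      using True by (intro DERIV_cong[OF DERIV_real_sqrt[OF True]])
        (simp add: field_simps flip: real_sqrt_mult)
    then show ?thesis
      by (rule has_field_derivative_transform_within_open[of _ _ _ "{0<..}"]) (use True in auto)
  next
    case False
    then have "0 < - f x" using assms(2) by simp
    have "((\<lambda>t. sqrt (- t)) has_real_derivative sqrt \<bar>f x\<bar> * inverse (2 * f x)) (at (f x))"
      using \<open>0 < - f x\<close>
      by (auto intro!: derivative_eq_intros simp: field_simps)
    then show ?thesis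
      by (rule has_field_derivative_transform_within_open[of _ _ _ "{..<0}"])
        (use \<open>0 < - f x\<close> in auto)
  qed
  from has_derivative_compose[OF assms(1) this[unfolded has_field_derivative_def]]
  show ?thesis by simp
qed

lemma Ck_on_sqrt_abs:
  fixes f :: "'v::real_normed_vector \<Rightarrow> real"
  assumes "open S" "Ck_on k f S" "\<And>x. x \<in> S \<Longrightarrow> f x \<noteq> 0"
  shows "Ck_on k (\<lambda>x. sqrt \<bar>f x\<bar>) S"
  using assms(2)
proof (induction k)
  case 0
  then show ?case by (auto intro: continuous_intros)
next
  case (Suc k)
  show ?case
  proof (rule Ck_on_SucI[OF assms(1)])
    show "((\<lambda>x. sqrt \<bar>f x\<bar>) has_derivative
      (\<lambda>v. sqrt \<bar>f x\<bar> * inverse (2 * f x) * frechet_derivative f (at x) v)) (at x)"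
      if "x \<in> S" for x
      using Suc.prems Ck_on_SucD(1) that assms(3) by (intro has_derivative_sqrt_abs) blast+
    show "Ck_on k (\<lambda>x. sqrt \<bar>f x\<bar> * inverse (2 * f x) * frechet_derivative f (at x) v) S" for v
      by (intro Ck_on_mult Ck_on_inverse Ck_on_const assms(1) Suc.IH Ck_on_SucD(2)[OF Suc.prems]
          Ck_on_Suc_imp[OF Suc.prems]) (use assms(3) in auto)
  qed
qed

section \<open>Closure properties of smooth maps\<close>

lemma smooth_on_cong:
  "open S \<Longrightarrow> (\<And>x. x \<in> S \<Longrightarrow> f x = g x) \<Longrightarrow> smooth_on f S \<Longrightarrow> smooth_on g S"
  unfolding smooth_on_def using Ck_on_cong by blast

lemma smooth_on_const: "open S \<Longrightarrow> smooth_on (\<lambda>x. c) S"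
  by (simp add: smooth_on_def Ck_on_const)

lemma smooth_on_add:
  "open S \<Longrightarrow> smooth_on f S \<Longrightarrow> smooth_on g S \<Longrightarrow> smooth_on (\<lambda>x. f x + g x) S"
  by (simp add: smooth_on_def Ck_on_add)

lemma smooth_on_diff:
  "open S \<Longrightarrow> smooth_on f S \<Longrightarrow> smooth_on g S \<Longrightarrow> smooth_on (\<lambda>x. f x - g x) S"
  by (simp add: smooth_on_def Ck_on_diff)

lemma smooth_on_mult:
  fixes f g :: "'v::real_normed_vector \<Rightarrow> real"
  shows "open S \<Longrightarrow> smooth_on f S \<Longrightarrow> smooth_on g S \<Longrightarrow> smooth_on (\<lambda>x. f x * g x) S"
  by (simp add: smooth_on_def Ck_on_mult)

lemma smooth_on_sum:
  "open S \<Longrightarrow> (\<And>i. i \<in> I \<Longrightarrow> smooth_on (f i) S) \<Longrightarrow> smooth_on (\<lambda>x. \<Sum>i\<in>I. f i x) S"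
  by (simp add: smooth_on_def Ck_on_sum)

lemma smooth_on_prod:
  fixes f :: "'i \<Rightarrow> 'v::real_normed_vector \<Rightarrow> real"
  shows "open S \<Longrightarrow> (\<And>i. i \<in> I \<Longrightarrow> smooth_on (f i) S) \<Longrightarrow> smooth_on (\<lambda>x. \<Prod>i\<in>I. f i x) S"
  by (simp add: smooth_on_def Ck_on_prod)

lemma smooth_on_inverse:
  fixes f :: "'v::real_normed_vector \<Rightarrow> real"
  shows "open S \<Longrightarrow> smooth_on f S \<Longrightarrow> (\<And>x. x \<in> S \<Longrightarrow> f x \<noteq> 0) \<Longrightarrow> smooth_on (\<lambda>x. inverse (f x)) S"
  by (simp add: smooth_on_def Ck_on_inverse)

lemma smooth_on_sqrt_abs:
  fixes f :: "'v::real_normed_vector \<Rightarrow> real"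
  shows "open S \<Longrightarrow> smooth_on f S \<Longrightarrow> (\<And>x. x \<in> S \<Longrightarrow> f x \<noteq> 0) \<Longrightarrow> smooth_on (\<lambda>x. sqrt \<bar>f x\<bar>) S"
  by (simp add: smooth_on_def Ck_on_sqrt_abs)

lemma smooth_on_bounded_linear:
  "open S \<Longrightarrow> bounded_linear L \<Longrightarrow> smooth_on f S \<Longrightarrow> smooth_on (\<lambda>x. L (f x)) S"
  by (simp add: smooth_on_def Ck_on_bounded_linear)

lemma smooth_on_vec_nth: "open S \<Longrightarrow> smooth_on f S \<Longrightarrow> smooth_on (\<lambda>x. f x $ i) S"
  using smooth_on_bounded_linear[OF _ bounded_linear_vec_nth] .

lemma vec_lambda_axis:
  fixes f :: "'n::finite \<Rightarrow> 'b::real_normed_vector"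
  shows "(\<chi> i. f i) = (\<Sum>i\<in>UNIV. \<chi> j. if j = i then f i else 0)"
  by (simp add: vec_eq_iff)

text \<open>A vector is the sum of its components, each placed in its slot by a bounded linear map,
  so closure under sums and bounded linear maps suffices.\<close>

lemma smooth_on_vec_lambda:
  fixes f :: "'v::real_normed_vector \<Rightarrow> 'n::finite \<Rightarrow> 'b::real_normed_vector"
  assumes "open S" "\<And>i. smooth_on (\<lambda>x. f x i) S"
  shows "smooth_on (\<lambda>x. \<chi> i. f x i) S"
proof -
  have "linear (\<lambda>b. \<chi> j. if j = i then b else (0::'b))" for i :: 'n
    by (auto intro!: linearI simp: vec_eq_iff)
  moreover have "norm ((\<chi> j. if j = i then b else 0) :: 'b^'n) \<le> norm b * 1" for i :: 'n and b :: 'b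
    by (simp add: norm_vec_def L2_set_def if_distrib[of norm] if_distrib[of "\<lambda>t. t^2"] cong: if_cong)
  ultimately have L: "bounded_linear (\<lambda>b. \<chi> j. if j = i then b else (0::'b))" for i :: 'n
    unfolding bounded_linear_def bounded_linear_axioms_def by blast
  have "smooth_on (\<lambda>x. \<Sum>i\<in>UNIV. \<chi> j. if j = i then f x i else 0) S"
    by (rule smooth_on_sum[OF assms(1)]) (rule smooth_on_bounded_linear[OF assms(1) L assms(2)])
  then show ?thesis
    by (simp only: vec_lambda_axis[symmetric])
qed

lemma smooth_on_subset: "smooth_on f S \<Longrightarrow> T \<subseteq> S \<Longrightarrow> smooth_on f T"
  by (auto simp: smooth_on_def intro: Ck_on_subset)

lemma smooth_onD:
  assumes "smooth_on f S"
  shows "x \<in> S \<Longrightarrow> f differentiable (at x)"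
    and "x \<in> S \<Longrightarrow> (f has_derivative frechet_derivative f (at x)) (at x)"
    and "continuous_on S f"
    and "smooth_on (\<lambda>x. frechet_derivative f (at x) v) S"
proof -
  have k: "Ck_on k f S" for k using assms by (simp add: smooth_on_def)
  show "x \<in> S \<Longrightarrow> f differentiable (at x)" using k[of 1] by simp
  then show "x \<in> S \<Longrightarrow> (f has_derivative frechet_derivative f (at x)) (at x)"
    by (simp flip: frechet_derivative_works)
  show "continuous_on S f" using k[of 0] by simp
  show "smooth_on (\<lambda>x. frechet_derivative f (at x) v) S"
    using k[of "Suc _"] by (simp add: smooth_on_def)
qed

lemma smooth_on_partial: "smooth_on f S \<Longrightarrow> smooth_on (partial i f) S"
  using smooth_onD(4)[of f S "axis i 1"] by (simp add: partial_def[abs_def])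

section \<open>Partial derivatives\<close>

lemma partial_eqI: "(f has_derivative f') (at x) \<Longrightarrow> partial i f x = f' (axis i 1)"
  unfolding partial_def using frechet_derivative_at by metis

lemma frechet_derivative_eq_partial:
  fixes f :: "real^'n \<Rightarrow> real"
  assumes "f differentiable (at x)"
  shows "frechet_derivative f (at x) v = (\<Sum>i\<in>UNIV. v $ i * partial i f x)"
proof -
  have lin: "linear (frechet_derivative f (at x))"
    using assms by (rule linear_frechet_derivative)
  have "v = (\<Sum>i\<in>UNIV. v $ i *\<^sub>R axis i 1)"
    using basis_expansion[of v] by (simp add: scalar_mult_eq_scaleR)
  then have "frechet_derivative f (at x) v = frechet_derivative f (at x) (\<Sum>i\<in>UNIV. v $ i *\<^sub>R axis i 1)"
    by simp
  also have "\<dots> = (\<Sum>i\<in>UNIV. v $ i * partial i f x)"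
    by (simp add: linear_sum[OF lin] linear_cmul[OF lin] partial_def)
  finally show ?thesis .
qed

lemma partial_cong:
  fixes f :: "real^'n \<Rightarrow> real"
  assumes "f differentiable (at x)" "open S" "x \<in> S" "\<And>y. y \<in> S \<Longrightarrow> f y = h y"
  shows "partial i f x = partial i h x"
  unfolding partial_def using frechet_derivative_transform_within_open[OF assms] by simp

lemma partial_const: "partial i (\<lambda>x. c) x = 0"
  by (simp add: partial_def)

lemma partial_add:
  "f differentiable (at x) \<Longrightarrow> h differentiable (at x) \<Longrightarrow>
    partial i (\<lambda>y. f y + h y) x = partial i f x + partial i h x"
  unfolding frechet_derivative_works
  by (subst partial_eqI[OF has_derivative_add]) (auto simp: partial_def)

lemma partial_diff:
  "f differentiable (at x) \<Longrightarrow> h differentiable (at x) \<Longrightarrow>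
    partial i (\<lambda>y. f y - h y) x = partial i f x - partial i h x"
  unfolding frechet_derivative_works
  by (subst partial_eqI[OF has_derivative_diff]) (auto simp: partial_def)

lemma partial_uminus:
  "f differentiable (at x) \<Longrightarrow> partial i (\<lambda>y. - f y) x = - partial i f x"
  unfolding frechet_derivative_works
  by (subst partial_eqI[OF has_derivative_minus]) (auto simp: partial_def)

lemma partial_mult:
  "f differentiable (at x) \<Longrightarrow> h differentiable (at x) \<Longrightarrow>
    partial i (\<lambda>y. f y * h y) x = partial i f x * h x + f x * partial i h x"
  unfolding frechet_derivative_works
  by (subst partial_eqI[OF has_derivative_mult]) (auto simp: partial_def)

lemma partial_sum:
  "(\<And>k. k \<in> I \<Longrightarrow> f k differentiable (at x)) \<Longrightarrow>
    partial i (\<lambda>y. \<Sum>k\<in>I. f k y) x = (\<Sum>k\<in>I. partial i (f k) x)"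
  unfolding frechet_derivative_works
  by (subst partial_eqI[OF has_derivative_sum]) (auto simp: partial_def)

section \<open>Symmetry of second derivatives\<close>

lemma has_real_derivative_along_line:
  fixes f :: "'v::real_normed_vector \<Rightarrow> real"
  assumes "f differentiable (at (x + s *\<^sub>R u))"
  shows "((\<lambda>s. f (x + s *\<^sub>R u)) has_real_derivative frechet_derivative f (at (x + s *\<^sub>R u)) u) (at s)"
proof -
  have *: "((\<lambda>s. x + s *\<^sub>R u) has_derivative (\<lambda>h. h *\<^sub>R u)) (at s)"
    by (auto intro!: derivative_eq_intros)
  have "((\<lambda>s. f (x + s *\<^sub>R u)) has_derivative
      (\<lambda>h. frechet_derivative f (at (x + s *\<^sub>R u)) (h *\<^sub>R u))) (at s)"
    using has_derivative_compose[OF *] assms frechet_derivative_works by blast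
  then show ?thesis
    using linear_cmul[OF linear_frechet_derivative[OF assms]]
    by (simp add: has_field_derivative_def mult.commute[of _ "frechet_derivative _ _ _"] )
qed

text \<open>The mean value theorem is applied twice: in direction \<open>u\<close> to the difference
  of \<open>f\<close> across the side \<open>h *\<^sub>R v\<close>, then in direction
  \<open>v\<close> to the derivative obtained.\<close>

lemma second_difference_mean_value:
  fixes f :: "'v::real_normed_vector \<Rightarrow> real"
  assumes f: "smooth_on f S" and "0 < h"
    and S: "\<And>s t. 0 \<le> s \<Longrightarrow> s \<le> h \<Longrightarrow> 0 \<le> t \<Longrightarrow> t \<le> h \<Longrightarrow> x + s *\<^sub>R u + t *\<^sub>R v \<in> S"
  obtains s t where "0 < s" "s < h" "0 < t" "t < h"
    "f (x + h *\<^sub>R u + h *\<^sub>R v) - f (x + h *\<^sub>R u) - (f (x + h *\<^sub>R v) - f x)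
     = h^2 * frechet_derivative (\<lambda>y. frechet_derivative f (at y) u) (at (x + s *\<^sub>R u + t *\<^sub>R v)) v"
proof -
  let ?D = "\<lambda>y. frechet_derivative f (at y) u"
  note D = smooth_onD(4)[OF f, of u]
  have "\<exists>s>0. s < h \<and>
      (f (x + h *\<^sub>R v + h *\<^sub>R u) - f (x + h *\<^sub>R u)) - (f (x + h *\<^sub>R v + 0 *\<^sub>R u) - f (x + 0 *\<^sub>R u))
      = (h - 0) * (?D (x + h *\<^sub>R v + s *\<^sub>R u) - ?D (x + s *\<^sub>R u))"
  proof (rule MVT2[OF \<open>0 < h\<close>])
    fix s assume s: "0 \<le> s" "s \<le> h"
    have "x + h *\<^sub>R v + s *\<^sub>R u \<in> S" "x + s *\<^sub>R u \<in> S"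
      using S[OF s, of h] S[OF s, of 0] \<open>0 < h\<close> by (auto simp: algebra_simps)
    then show "((\<lambda>s. f (x + h *\<^sub>R v + s *\<^sub>R u) - f (x + s *\<^sub>R u)) has_real_derivative
        ?D (x + h *\<^sub>R v + s *\<^sub>R u) - ?D (x + s *\<^sub>R u)) (at s)"
      using smooth_onD(1)[OF f] by (intro DERIV_diff has_real_derivative_along_line) auto
  qed
  then obtain s where s: "0 < s" "s < h"
    and 1: "f (x + h *\<^sub>R u + h *\<^sub>R v) - f (x + h *\<^sub>R u) - (f (x + h *\<^sub>R v) - f x)
      = h * (?D (x + s *\<^sub>R u + h *\<^sub>R v) - ?D (x + s *\<^sub>R u))"
    by (auto simp: algebra_simps)
  have "\<exists>t>0. t < h \<and> ?D (x + s *\<^sub>R u + h *\<^sub>R v) - ?D (x + s *\<^sub>R u + 0 *\<^sub>R v)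
      = (h - 0) * frechet_derivative ?D (at (x + s *\<^sub>R u + t *\<^sub>R v)) v"
  proof (rule MVT2[OF \<open>0 < h\<close>])
    fix t assume t: "0 \<le> t" "t \<le> h"
    have "x + s *\<^sub>R u + t *\<^sub>R v \<in> S" using S t s by auto
    then show "((\<lambda>t. ?D (x + s *\<^sub>R u + t *\<^sub>R v)) has_real_derivative
        frechet_derivative ?D (at (x + s *\<^sub>R u + t *\<^sub>R v)) v) (at t)"
      using smooth_onD(1)[OF D] by (intro has_real_derivative_along_line) auto
  qed
  then obtain t where "0 < t" "t < h"
    "?D (x + s *\<^sub>R u + h *\<^sub>R v) - ?D (x + s *\<^sub>R u)
      = h * frechet_derivative ?D (at (x + s *\<^sub>R u + t *\<^sub>R v)) v" by auto
  with 1 s that show thesis by (simp add: power2_eq_square)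
qed

text \<open>The second difference of \<open>f\<close> over a parallelogram is symmetric in
  \<open>u\<close> and \<open>v\<close>. Its two mean value expressions are values of the two mixed
  derivatives near \<open>x\<close>, and both are continuous, so they differ by less than any
  \<open>2 * e\<close> at \<open>x\<close>.\<close>

lemma second_derivative_commute:
  fixes f :: "'v::real_normed_vector \<Rightarrow> real"
  assumes f: "smooth_on f S" and "open S" "x \<in> S"
  shows "frechet_derivative (\<lambda>y. frechet_derivative f (at y) u) (at x) v
       = frechet_derivative (\<lambda>y. frechet_derivative f (at y) v) (at x) u"
proof -
  define D where "D u v y = frechet_derivative (\<lambda>y. frechet_derivative f (at y) u) (at y) v" for u v y
  have cont: "continuous_on S (D u v)" for u v
    unfolding D_def by (intro smooth_onD(3)[OF smooth_onD(4)] smooth_onD(4) f)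
  have *: "\<bar>D u v x - D v u x\<bar> < 2 * e" if "0 < e" for e
  proof -
    obtain d1 where d1: "d1 > 0" "\<And>y. y \<in> S \<Longrightarrow> dist y x < d1 \<Longrightarrow> \<bar>D u v y - D u v x\<bar> < e"
      using cont[of u v, unfolded continuous_on_iff, rule_format, OF \<open>x \<in> S\<close> \<open>0 < e\<close>]
      by (auto simp: dist_real_def)
    obtain d2 where d2: "d2 > 0" "\<And>y. y \<in> S \<Longrightarrow> dist y x < d2 \<Longrightarrow> \<bar>D v u y - D v u x\<bar> < e"
      using cont[of v u, unfolded continuous_on_iff, rule_format, OF \<open>x \<in> S\<close> \<open>0 < e\<close>]
      by (auto simp: dist_real_def)
    obtain r where r: "0 < r" "ball x r \<subseteq> S" using \<open>open S\<close> \<open>x \<in> S\<close> open_contains_ball by blast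
    define q where "q = min r (min d1 d2)"
    \<comment> \<open>This keeps the whole parallelogram with sides \<open>h *\<^sub>R u\<close> and
      \<open>h *\<^sub>R v\<close> within distance \<open>q\<close> of \<open>x\<close>; the 1 keeps
      the denominator positive when \<open>u\<close> and \<open>v\<close> vanish.\<close>
    define h where "h = q / (norm u + norm v + 1)"
    have "0 < q" using d1(1) d2(1) r by (simp add: q_def)
    have nz: "0 < norm u + norm v + 1" by (simp add: add_nonneg_pos)
    then have "0 < h" using \<open>0 < q\<close> by (simp add: h_def)
    have near: "dist (x + s *\<^sub>R u + t *\<^sub>R v) x < q" if "0 \<le> s" "s \<le> h" "0 \<le> t" "t \<le> h" for s t
    proof -
      have "dist (x + s *\<^sub>R u + t *\<^sub>R v) x = norm (s *\<^sub>R u + t *\<^sub>R v)" by (simp add: dist_norm)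
      also have "\<dots> \<le> s * norm u + t * norm v"
        using that by (intro order_trans[OF norm_triangle_ineq]) simp
      also have "\<dots> \<le> h * norm u + h * norm v"
        using that by (intro add_mono mult_right_mono) auto
      also have "\<dots> < h * (norm u + norm v + 1)" using \<open>0 < h\<close> by (simp add: algebra_simps)
      also have "\<dots> = q" using nz by (simp add: h_def)
      finally show ?thesis .
    qed
    then have inS: "x + s *\<^sub>R u + t *\<^sub>R v \<in> S" if "0 \<le> s" "s \<le> h" "0 \<le> t" "t \<le> h" for s t
    proof -
      have "x + s *\<^sub>R u + t *\<^sub>R v \<in> ball x r"
        using near[OF that] by (simp add: q_def dist_commute)
      then show ?thesis using r(2) by blast
    qed
    obtain s t where st: "0 < s" "s < h" "0 < t" "t < h" and
      1: "f (x + h *\<^sub>R u + h *\<^sub>R v) - f (x + h *\<^sub>R u) - (f (x + h *\<^sub>R v) - f x)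
        = h^2 * D u v (x + s *\<^sub>R u + t *\<^sub>R v)"
      using second_difference_mean_value[OF f \<open>0 < h\<close> inS] unfolding D_def .
    have inS': "x + s *\<^sub>R v + t *\<^sub>R u \<in> S" if "0 \<le> s" "s \<le> h" "0 \<le> t" "t \<le> h" for s t
      using inS[OF that(3,4,1,2)] by (simp add: algebra_simps)
    obtain s' t' where st': "0 < s'" "s' < h" "0 < t'" "t' < h" and
      2: "f (x + h *\<^sub>R v + h *\<^sub>R u) - f (x + h *\<^sub>R v) - (f (x + h *\<^sub>R u) - f x)
        = h^2 * D v u (x + s' *\<^sub>R v + t' *\<^sub>R u)"
      using second_difference_mean_value[OF f \<open>0 < h\<close> inS'] unfolding D_def .
    have "h^2 * D u v (x + s *\<^sub>R u + t *\<^sub>R v) = h^2 * D v u (x + s' *\<^sub>R v + t' *\<^sub>R u)"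
      unfolding 1[symmetric] 2[symmetric] by (simp add: algebra_simps)
    then have 3: "D u v (x + s *\<^sub>R u + t *\<^sub>R v) = D v u (x + t' *\<^sub>R u + s' *\<^sub>R v)"
      using \<open>0 < h\<close> by (simp add: algebra_simps)
    have "\<bar>D u v (x + s *\<^sub>R u + t *\<^sub>R v) - D u v x\<bar> < e"
      using near[of s t] st inS[of s t] by (intro d1(2)) (auto simp: q_def)
    moreover have "\<bar>D v u (x + t' *\<^sub>R u + s' *\<^sub>R v) - D v u x\<bar> < e"
      using near[of t' s'] st' inS[of t' s'] by (intro d2(2)) (auto simp: q_def)
    ultimately show ?thesis using 3 by linarith
  qed
  have "D u v x = D v u x"
    using *[of "\<bar>D u v x - D v u x\<bar> / 2"] by (cases "D u v x = D v u x") auto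
  then show ?thesis by (simp add: D_def)
qed

lemma partial_commute:
  "smooth_on f S \<Longrightarrow> open S \<Longrightarrow> x \<in> S \<Longrightarrow> partial i (partial j f) x = partial j (partial i f) x"
  using second_derivative_commute[of f S x "axis j 1" "axis i 1"]
  by (simp add: partial_def[abs_def])

section \<open>Matrix-valued functions\<close>

lemma smooth_on_matrix_iff:
  fixes F :: "'v::real_normed_vector \<Rightarrow> real^'m::finite^'n::finite"
  assumes "open S"
  shows "smooth_on F S \<longleftrightarrow> (\<forall>a b. smooth_on (\<lambda>x. F x $ a $ b) S)"
proof
  assume "smooth_on F S"
  then show "\<forall>a b. smooth_on (\<lambda>x. F x $ a $ b) S" using assms by (simp add: smooth_on_vec_nth)
next
  assume "\<forall>a b. smooth_on (\<lambda>x. F x $ a $ b) S"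
  then have "smooth_on (\<lambda>x. \<chi> a b. F x $ a $ b) S"
    by (intro smooth_on_vec_lambda assms) blast
  then show "smooth_on F S" by simp
qed

lemma smooth_on_matrixI:
  "open S \<Longrightarrow> (\<And>a b. smooth_on (\<lambda>x. F x $ a $ b) S) \<Longrightarrow> smooth_on F S"
  for F :: "'v::real_normed_vector \<Rightarrow> real^'m::finite^'n::finite"
  by (simp add: smooth_on_matrix_iff)

lemma smooth_on_matrixD:
  "smooth_on F S \<Longrightarrow> open S \<Longrightarrow> smooth_on (\<lambda>x. F x $ a $ b) S"
  for F :: "'v::real_normed_vector \<Rightarrow> real^'m::finite^'n::finite"
  by (simp add: smooth_on_matrix_iff)

lemma smooth_on_matrix_mult:
  fixes F :: "'v::real_normed_vector \<Rightarrow> real^'m::finite^'n::finite"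
    and K :: "'v \<Rightarrow> real^'p::finite^'m"
  assumes "open S" "smooth_on F S" "smooth_on K S"
  shows "smooth_on (\<lambda>x. F x ** K x) S"
  by (rule smooth_on_matrixI[OF assms(1)])
    (simp add: matrix_matrix_mult_def smooth_on_sum smooth_on_mult smooth_on_vec_nth assms)

lemma smooth_on_matrix_vector_mult:
  fixes F :: "'v::real_normed_vector \<Rightarrow> real^'m::finite^'n::finite"
  assumes "open S" "smooth_on F S" "smooth_on K S"
  shows "smooth_on (\<lambda>x. F x *v K x) S"
  by (simp add: matrix_vector_mult_def smooth_on_vec_lambda smooth_on_sum smooth_on_mult
      smooth_on_vec_nth assms)

lemma smooth_on_transpose:
  fixes F :: "'v::real_normed_vector \<Rightarrow> real^'m::finite^'n::finite"
  assumes "open S" "smooth_on F S"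
  shows "smooth_on (\<lambda>x. transpose (F x)) S"
  by (rule smooth_on_matrixI[OF assms(1)]) (simp add: transpose_def smooth_on_vec_nth assms)

lemma smooth_on_det:
  fixes F :: "'v::real_normed_vector \<Rightarrow> real^'n::finite^'n"
  assumes "open S" "\<And>a b. smooth_on (\<lambda>x. F x $ a $ b) S"
  shows "smooth_on (\<lambda>x. det (F x)) S"
  unfolding det_def
  by (intro smooth_on_sum smooth_on_mult smooth_on_prod smooth_on_const assms)

section \<open>Inverse matrices\<close>

lemma
  fixes B :: "real^'n::finite^'n"
  assumes "det B \<noteq> 0"
  shows matrix_inv_right: "B ** matrix_inv B = mat 1" and matrix_inv_left: "matrix_inv B ** B = mat 1"
proof -
  have "\<exists>B'. B ** B' = mat 1 \<and> B' ** B = mat 1"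
    using assms by (simp add: invertible_det_nz flip: invertible_def)
  from someI_ex[OF this] show "B ** matrix_inv B = mat 1" "matrix_inv B ** B = mat 1"
    by (simp_all add: matrix_inv_def)
qed

text \<open>Exhibits each entry of the inverse as a polynomial in the entries times
  \<open>inverse (det B)\<close>, from which the smoothness of the inverse metric can be read
  off.\<close>

lemma matrix_inv_cramer:
  fixes B :: "real^'n::finite^'n"
  assumes "det B \<noteq> 0"
  shows "matrix_inv B $ k $ l
    = det (\<chi> i j. if j = k then axis l 1 $ i else B $ i $ j) * inverse (det B)"
proof -
  have "B *v (matrix_inv B *v axis l 1) = axis l 1"
    using assms by (simp add: matrix_vector_mul_assoc matrix_inv_right assms)
  then have "matrix_inv B *v axis l 1
      = (\<chi> k. det (\<chi> i j. if j = k then axis l 1 $ i else B $ i $ j) / det B)"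
    by (simp add: cramer[OF assms])
  moreover have "matrix_inv B $ k $ l = (matrix_inv B *v axis l 1) $ k"
    by (simp add: matrix_vector_mul_component inner_axis)
  ultimately show ?thesis by (simp add: divide_inverse)
qed

section \<open>Entrywise derivatives of matrix-valued functions, and matrix algebra\<close>

definition mpartial :: "'n::finite \<Rightarrow> (real^'n \<Rightarrow> real^'n^'n) \<Rightarrow> real^'n \<Rightarrow> real^'n^'n" where
  "mpartial i F x = (\<chi> a b. partial i (\<lambda>y. F y $ a $ b) x)"

lemma mpartial_nth: "mpartial i F x $ a $ b = partial i (\<lambda>y. F y $ a $ b) x"
  by (simp add: mpartial_def)

lemma smooth_on_mpartial: "open S \<Longrightarrow> smooth_on F S \<Longrightarrow> smooth_on (mpartial i F) S"
  by (rule smooth_on_matrixI) (simp_all add: mpartial_nth smooth_on_partial smooth_on_matrixD)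

lemma differentiable_matrix_nth:
  fixes F :: "real^'n::finite \<Rightarrow> real^'n^'n"
  assumes "smooth_on F S" "open S" "x \<in> S"
  shows "(\<lambda>y. F y $ a $ b) differentiable (at x)"
  using smooth_onD(1)[OF smooth_on_matrixD[OF assms(1,2)] assms(3)] .

lemma mpartial_cong:
  assumes "smooth_on F S" "open S" "x \<in> S" "\<And>y. y \<in> S \<Longrightarrow> F y = K y"
  shows "mpartial i F x = mpartial i K x"
  unfolding mpartial_def
  by (simp add: vec_eq_iff partial_cong[OF differentiable_matrix_nth[OF assms(1-3)] assms(2,3)]
      assms(4))

lemma mpartial_const: "mpartial i (\<lambda>y. C) x = 0"
  by (simp add: mpartial_def partial_const vec_eq_iff)

lemma mpartial_add:
  assumes "smooth_on F S" "smooth_on K S" "open S" "x \<in> S"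
  shows "mpartial i (\<lambda>y. F y + K y) x = mpartial i F x + mpartial i K x"
  unfolding mpartial_def
  by (simp add: vec_eq_iff partial_add differentiable_matrix_nth[OF assms(1) assms(3-)]
      differentiable_matrix_nth[OF assms(2) assms(3-)])

lemma mpartial_diff:
  assumes "smooth_on F S" "smooth_on K S" "open S" "x \<in> S"
  shows "mpartial i (\<lambda>y. F y - K y) x = mpartial i F x - mpartial i K x"
  unfolding mpartial_def
  by (simp add: vec_eq_iff partial_diff differentiable_matrix_nth[OF assms(1) assms(3-)]
      differentiable_matrix_nth[OF assms(2) assms(3-)])

lemma mpartial_mult:
  assumes "smooth_on F S" "smooth_on K S" "open S" "x \<in> S"
  shows "mpartial i (\<lambda>y. F y ** K y) x = mpartial i F x ** K x + F x ** mpartial i K x"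
  unfolding mpartial_def matrix_matrix_mult_def
  by (simp add: vec_eq_iff partial_sum partial_mult differentiable_mult sum.distrib
      differentiable_matrix_nth[OF assms(1) assms(3-)]
      differentiable_matrix_nth[OF assms(2) assms(3-)])

lemma mpartial_transpose: "mpartial i (\<lambda>y. transpose (F y)) x = transpose (mpartial i F x)"
  by (simp add: mpartial_def transpose_def)

lemma mpartial_commute:
  assumes "smooth_on F S" "open S" "x \<in> S"
  shows "mpartial i (mpartial j F) x = mpartial j (mpartial i F) x"
  using partial_commute[OF smooth_on_matrixD[OF assms(1,2)] assms(2,3), of i j]
  by (simp add: mpartial_def vec_eq_iff)

lemma matrix_mult_minus_left: "(- A) ** B = - (A ** B)"
  for A :: "real^'m::finite^'n::finite" and B :: "real^'p::finite^'m"
  by (simp add: matrix_matrix_mult_def vec_eq_iff sum_negf)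

lemma matrix_mult_minus_right: "A ** (- B) = - (A ** B)"
  for A :: "real^'m::finite^'n::finite" and B :: "real^'p::finite^'m"
  by (simp add: matrix_matrix_mult_def vec_eq_iff sum_negf)

lemma matrix_add_rdistrib: "(A + B) ** C = A ** C + B ** C"
  for A :: "real^'m::finite^'n::finite" and C :: "real^'p::finite^'m"
  by (simp add: matrix_matrix_mult_def vec_eq_iff algebra_simps sum.distrib)

lemma matrix_diff_ldistrib: "A ** (B - C) = A ** B - A ** C"
  for A :: "real^'m::finite^'n::finite" and C :: "real^'p::finite^'m"
  by (simp add: matrix_matrix_mult_def vec_eq_iff algebra_simps sum_subtractf)

lemma matrix_diff_rdistrib: "(A - B) ** C = A ** C - B ** C"
  for A :: "real^'m::finite^'n::finite" and C :: "real^'p::finite^'m"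
  by (simp add: matrix_matrix_mult_def vec_eq_iff algebra_simps sum_subtractf)

lemma matrix_scaleR_left: "(c *\<^sub>R A) ** B = c *\<^sub>R (A ** B)"
  for A :: "real^'m::finite^'n::finite" and B :: "real^'p::finite^'m"
  by (simp add: matrix_matrix_mult_def vec_eq_iff sum_distrib_left mult_ac)

lemma matrix_scaleR_right: "A ** (c *\<^sub>R B) = c *\<^sub>R (A ** B)"
  for A :: "real^'m::finite^'n::finite" and B :: "real^'p::finite^'m"
  by (simp add: matrix_matrix_mult_def vec_eq_iff sum_distrib_left mult_ac)

lemmas matrix_ring_simps = matrix_add_ldistrib matrix_add_rdistrib matrix_diff_ldistrib
  matrix_diff_rdistrib matrix_mult_minus_left matrix_mult_minus_right
  matrix_scaleR_left matrix_scaleR_right matrix_mul_assoc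

lemma transpose_add: "transpose (A + B) = transpose A + transpose B"
  for A :: "real^'m::finite^'n::finite" by (simp add: transpose_def vec_eq_iff)

lemma transpose_diff: "transpose (A - B) = transpose A - transpose B"
  for A :: "real^'m::finite^'n::finite" by (simp add: transpose_def vec_eq_iff)

section \<open>Curvature in one chart\<close>

text \<open>\<open>K i j l k\<close> stands for \<open>R\<^sub>i\<^sub>j\<^sup>l\<^sup>k\<close>, \<open>dK p\<close> for its \<open>p\<close>-th partial derivative and
  \<open>A\<close> for the Ricci tensor with its second index raised.\<close>

lemma contract_bianchi:
  fixes dK :: "'n::finite \<Rightarrow> 'n \<Rightarrow> 'n \<Rightarrow> 'n \<Rightarrow> 'n \<Rightarrow> real"
    and K :: "'n \<Rightarrow> 'n \<Rightarrow> 'n \<Rightarrow> 'n \<Rightarrow> real" and \<Gamma> :: "'n \<Rightarrow> 'n \<Rightarrow> 'n \<Rightarrow> real"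
  defines "D \<equiv> \<lambda>p i j l k. dK p i j l k + (\<Sum>m\<in>UNIV. \<Gamma> l p m * K i j m k)
      + (\<Sum>m\<in>UNIV. K i j l m * \<Gamma> k p m)"
    and "A \<equiv> \<lambda>p i. \<Sum>j\<in>UNIV. K j p j i" and "dA \<equiv> \<lambda>q p i. \<Sum>j\<in>UNIV. dK q j p j i"
  assumes torsion: "\<And>l i j. \<Gamma> l i j = \<Gamma> l j i"
    and K1: "\<And>i j l k. K i j l k = - K j i l k" and K2: "\<And>i j l k. K i j l k = - K i j k l"
    and dK1: "\<And>p i j l k. dK p i j l k = - dK p j i l k"
    and dK2: "\<And>p i j l k. dK p i j l k = - dK p i j k l"
    and bianchi: "\<And>p i j l k. D p i j l k + D i j p l k + D j p i l k = 0"
  shows "(\<Sum>i\<in>UNIV. dA i p i) + (\<Sum>i\<in>UNIV. \<Sum>m\<in>UNIV. \<Gamma> i i m * A p m)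
    = (1/2) * (\<Sum>j\<in>UNIV. dA p j j) + (\<Sum>i\<in>UNIV. \<Sum>m\<in>UNIV. \<Gamma> i p m * A i m)"
proof -
  \<comment> \<open>This kills the terms where the two symmetric lower indices of \<Gamma> meet a
    skew index pair of \<open>K\<close>.\<close>
  have antisym: "(\<Sum>i\<in>UNIV. \<Sum>m\<in>UNIV. f i m * h i m) = 0"
    if "\<And>i m. f i m = - f m i" "\<And>i m. h i m = h m i" for f h :: "'n \<Rightarrow> 'n \<Rightarrow> real"
  proof -
    have "(\<Sum>i\<in>UNIV. \<Sum>m\<in>UNIV. f i m * h i m) = (\<Sum>m\<in>UNIV. \<Sum>i\<in>UNIV. f i m * h i m)"
      by (rule sum.swap)
    also have "\<dots> = - (\<Sum>m\<in>UNIV. \<Sum>i\<in>UNIV. f m i * h m i)"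
      unfolding sum_negf[symmetric]
      by (intro sum.cong refl) (metis that mult_minus_left)
    finally show ?thesis by simp
  qed
  have swap_inner: "(\<Sum>i\<in>UNIV. \<Sum>j\<in>UNIV. \<Sum>m\<in>UNIV. f i j m)
      = (\<Sum>i\<in>UNIV. \<Sum>m\<in>UNIV. \<Sum>j\<in>UNIV. f i j m)" for f :: "'n \<Rightarrow> 'n \<Rightarrow> 'n \<Rightarrow> real"
    by (rule sum.cong[OF refl sum.swap])
  have rotate: "(\<Sum>i\<in>UNIV. \<Sum>j\<in>UNIV. \<Sum>m\<in>UNIV. f i j m)
      = (\<Sum>j\<in>UNIV. \<Sum>m\<in>UNIV. \<Sum>i\<in>UNIV. f i j m)" for f :: "'n \<Rightarrow> 'n \<Rightarrow> 'n \<Rightarrow> real"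
    by (rule trans[OF sum.swap sum.cong[OF refl sum.swap]])
  \<comment> \<open>Put l = i and k = j in \<open>bianchi\<close> and sum. The first cyclic term
    yields the derivative of the scalar curvature (\<open>T1\<close>); the other two each yield
    minus the divergence of the Ricci tensor (\<open>T2\<close>, \<open>T3\<close>), whence the
    factor 1/2.\<close>
  have T1: "(\<Sum>i\<in>UNIV. \<Sum>j\<in>UNIV. D p i j i j)
      = (\<Sum>j\<in>UNIV. dA p j j) + 2 * (\<Sum>i\<in>UNIV. \<Sum>m\<in>UNIV. \<Gamma> i p m * A i m)"
  proof -
    have "(\<Sum>i\<in>UNIV. \<Sum>j\<in>UNIV. dK p i j i j) = (\<Sum>j\<in>UNIV. dA p j j)"
      unfolding dA_def by (rule sum.swap)
    moreover have "(\<Sum>i\<in>UNIV. \<Sum>j\<in>UNIV. \<Sum>m\<in>UNIV. \<Gamma> i p m * K i j m j)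
        = (\<Sum>i\<in>UNIV. \<Sum>m\<in>UNIV. \<Gamma> i p m * A i m)"
      unfolding A_def sum_distrib_left
      by (rule trans[OF swap_inner], intro sum.cong refl) (metis K1 K2 minus_minus)
    moreover have "(\<Sum>i\<in>UNIV. \<Sum>j\<in>UNIV. \<Sum>m\<in>UNIV. K i j i m * \<Gamma> j p m)
        = (\<Sum>i\<in>UNIV. \<Sum>m\<in>UNIV. \<Gamma> i p m * A i m)"
      unfolding A_def sum_distrib_left
      by (rule trans[OF rotate], intro sum.cong refl)
        (simp add: mult.commute)
    ultimately show ?thesis by (simp add: D_def sum.distrib)
  qed
  have T2: "(\<Sum>i\<in>UNIV. \<Sum>j\<in>UNIV. D i j p i j)
      = - (\<Sum>i\<in>UNIV. dA i p i) - (\<Sum>i\<in>UNIV. \<Sum>m\<in>UNIV. \<Gamma> i i m * A p m)"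
  proof -
    have "(\<Sum>i\<in>UNIV. \<Sum>j\<in>UNIV. dK i j p i j) = - (\<Sum>i\<in>UNIV. dA i p i)"
      unfolding dA_def sum_negf[symmetric] by (intro sum.cong refl) (rule dK2)
    moreover have "(\<Sum>i\<in>UNIV. \<Sum>j\<in>UNIV. \<Sum>m\<in>UNIV. \<Gamma> i i m * K j p m j)
        = - (\<Sum>i\<in>UNIV. \<Sum>m\<in>UNIV. \<Gamma> i i m * A p m)"
      unfolding A_def sum_distrib_left sum_negf[symmetric]
      by (rule trans[OF swap_inner], intro sum.cong refl) (metis K2 mult_minus_right)
    moreover have "(\<Sum>i\<in>UNIV. \<Sum>j\<in>UNIV. \<Sum>m\<in>UNIV. K j p i m * \<Gamma> j i m) = 0"
      by (rule trans[OF sum.swap sum.neutral]) (use antisym K2 torsion in blast)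
    ultimately show ?thesis by (simp add: D_def sum.distrib)
  qed
  have T3: "(\<Sum>i\<in>UNIV. \<Sum>j\<in>UNIV. D j p i i j)
      = - (\<Sum>i\<in>UNIV. dA i p i) - (\<Sum>i\<in>UNIV. \<Sum>m\<in>UNIV. \<Gamma> i i m * A p m)"
  proof -
    have "(\<Sum>i\<in>UNIV. \<Sum>j\<in>UNIV. dK j p i i j) = - (\<Sum>i\<in>UNIV. dA i p i)"
      unfolding dA_def sum_negf[symmetric]
      by (rule trans[OF sum.swap], intro sum.cong refl) (rule dK1)
    moreover have "(\<Sum>i\<in>UNIV. \<Sum>j\<in>UNIV. \<Sum>m\<in>UNIV. \<Gamma> i j m * K p i m j) = 0"
    proof (rule sum.neutral, intro ballI)
      fix i
      show "(\<Sum>j\<in>UNIV. \<Sum>m\<in>UNIV. \<Gamma> i j m * K p i m j) = 0"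
        unfolding mult.commute[of "\<Gamma> _ _ _"] by (rule antisym[OF K2 torsion])
    qed
    moreover have "(\<Sum>i\<in>UNIV. \<Sum>j\<in>UNIV. \<Sum>m\<in>UNIV. K p i i m * \<Gamma> j j m)
        = - (\<Sum>i\<in>UNIV. \<Sum>m\<in>UNIV. \<Gamma> i i m * A p m)"
      unfolding A_def sum_distrib_left sum_negf[symmetric]
      by (rule trans[OF rotate], intro sum.cong refl)
        (metis K1 mult_minus_right mult.commute)
    ultimately show ?thesis by (simp add: D_def sum.distrib)
  qed
  have "(\<Sum>i\<in>UNIV. \<Sum>j\<in>UNIV. D p i j i j + D i j p i j + D j p i i j) = 0"
    by (simp add: bianchi)
  then show ?thesis using T1 T2 T3 by (simp add: sum.distrib)
qed

section \<open>The Levi-Civita connection of a metric in one chart\<close>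

lemma matrix_inv_pos_def:
  fixes B :: "real^'n::finite^'n"
  assumes "\<And>v. v \<noteq> 0 \<Longrightarrow> 0 < v \<bullet> (B *v v)"
  shows "B ** matrix_inv B = mat 1" "matrix_inv B ** B = mat 1" "det B \<noteq> 0"
proof -
  have "\<forall>x. B *v x = 0 \<longrightarrow> x = 0"
    using assms by (metis inner_zero_right less_irrefl)
  then have "invertible B"
    using invertible_left_inverse matrix_left_invertible_ker by blast
  then show "det B \<noteq> 0" by (simp add: invertible_det_nz)
  then show "B ** matrix_inv B = mat 1" "matrix_inv B ** B = mat 1"
    by (simp_all add: matrix_inv_left matrix_inv_right)
qed

locale local_metric =
  fixes S :: "(real^'n::finite) set" and G :: "real^'n \<Rightarrow> real^'n^'n"
  assumes open_S: "open S" and smooth_G: "smooth_on G S"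
    and sym_G: "x \<in> S \<Longrightarrow> transpose (G x) = G x"
    and pos_G: "x \<in> S \<Longrightarrow> v \<noteq> 0 \<Longrightarrow> 0 < v \<bullet> (G x *v v)"
begin

definition H :: "real^'n \<Rightarrow> real^'n^'n" where "H x = matrix_inv (G x)"

text \<open>The connection matrix: \<open>Gam i x *v X x\<close> is the part of order zero of
  \<nabla>_i X. In these terms the curvature \<open>Rm\<close> is the matrix-valued 2-form d\<Gamma>
  + \<Gamma> \<and> \<Gamma>.\<close>

definition Gam :: "'n \<Rightarrow> real^'n \<Rightarrow> real^'n^'n" where
  "Gam i x = (\<chi> l k. christoffel G x l i k)"

definition Rm :: "'n \<Rightarrow> 'n \<Rightarrow> real^'n \<Rightarrow> real^'n^'n" where
  "Rm i j x = mpartial i (Gam j) x - mpartial j (Gam i) x + Gam i x ** Gam j x - Gam j x ** Gam i x"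

lemma GH: "x \<in> S \<Longrightarrow> G x ** H x = mat 1" and HG: "x \<in> S \<Longrightarrow> H x ** G x = mat 1"
  and det_G: "x \<in> S \<Longrightarrow> det (G x) \<noteq> 0"
  using matrix_inv_pos_def pos_G unfolding H_def by blast+

lemma sym_H: assumes "x \<in> S" shows "transpose (H x) = H x"
proof -
  have "transpose (H x) ** G x = mat 1"
    using arg_cong[OF GH[OF assms], of transpose] by (simp add: matrix_transpose_mul sym_G assms)
  then have "(transpose (H x) ** G x) ** H x = H x" by simp
  then show ?thesis by (simp add: GH assms flip: matrix_mul_assoc)
qed

lemma smooth_H: "smooth_on H S"
proof (rule smooth_on_matrixI[OF open_S])
  fix k l
  have "smooth_on (\<lambda>x. (\<chi> i j. if j = k then axis l 1 $ i else G x $ i $ j) $ a $ b) S" for a b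
    by (cases "b = k") (simp_all add: smooth_on_const open_S smooth_on_matrixD smooth_G)
  then have "smooth_on (\<lambda>x. det (\<chi> i j. if j = k then axis l 1 $ i else G x $ i $ j)
      * inverse (det (G x))) S"
    by (intro smooth_on_mult smooth_on_det smooth_on_inverse open_S det_G
        smooth_on_matrixD[OF smooth_G])
  then show "smooth_on (\<lambda>x. H x $ k $ l) S"
    by (rule smooth_on_cong[OF open_S, rotated]) (simp add: H_def matrix_inv_cramer det_G)
qed

lemma smooth_G_nth: "smooth_on (\<lambda>y. G y $ i $ j) S"
  using smooth_on_matrixD[OF smooth_G open_S] .

lemma smooth_Gam: "smooth_on (Gam i) S"
proof (rule smooth_on_matrixI[OF open_S])
  fix l k
  have "smooth_on (\<lambda>x. (1/2) * (\<Sum>la\<in>UNIV. H x $ l $ la * (partial i (\<lambda>y. G y $ k $ la) x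
      + partial k (\<lambda>y. G y $ i $ la) x - partial la (\<lambda>y. G y $ i $ k) x))) S"
    by (intro smooth_on_mult smooth_on_sum smooth_on_add smooth_on_diff smooth_on_const open_S
       smooth_on_partial smooth_G_nth smooth_on_matrixD[OF smooth_H])
  then show "smooth_on (\<lambda>x. Gam i x $ l $ k) S"
    by (simp add: Gam_def christoffel_def H_def)
qed

lemma smooth_Rm: "smooth_on (Rm i j) S"
  unfolding Rm_def[abs_def]
  by (intro smooth_on_add smooth_on_diff smooth_on_matrix_mult smooth_on_mpartial open_S smooth_Gam)

lemma G_nth_commute: "x \<in> S \<Longrightarrow> G x $ i $ j = G x $ j $ i"
  using arg_cong[OF sym_G, of x "\<lambda>B. B $ j $ i"] by (simp add: transpose_def)

lemma partial_G_commute: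
  "x \<in> S \<Longrightarrow> partial k (\<lambda>y. G y $ i $ j) x = partial k (\<lambda>y. G y $ j $ i) x"
  using G_nth_commute by (intro partial_cong[OF smooth_onD(1)[OF smooth_G_nth] open_S]) auto

text \<open>Lowering the upper index cancels the inverse metric in \<open>christoffel\<close> and
  leaves the Christoffel symbols of the first kind.\<close>

lemma G_Gam_nth:
  assumes "x \<in> S"
  shows "(G x ** Gam i x) $ m $ j = (1/2) * (partial i (\<lambda>y. G y $ j $ m) x
      + partial j (\<lambda>y. G y $ i $ m) x - partial m (\<lambda>y. G y $ i $ j) x)"
proof -
  define b where "b = (\<chi> l. (1/2) * (partial i (\<lambda>y. G y $ j $ l) x
      + partial j (\<lambda>y. G y $ i $ l) x - partial l (\<lambda>y. G y $ i $ j) x))"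
  have "Gam i x $ l $ j = (H x *v b) $ l" for l
    by (simp add: Gam_def christoffel_def H_def matrix_vector_mult_def b_def sum_distrib_left
        mult_ac)
  then have "(G x ** Gam i x) $ m $ j = (G x *v (H x *v b)) $ m"
    by (simp add: matrix_matrix_mult_def matrix_vector_mult_def[of "G x"])
  also have "\<dots> = b $ m" by (simp add: matrix_vector_mul_assoc GH assms)
  finally show ?thesis by (simp add: b_def)
qed

lemma Gam_torsion: "x \<in> S \<Longrightarrow> Gam i x $ l $ j = Gam j x $ l $ i"
  unfolding Gam_def christoffel_def
  by (simp add: partial_G_commute[of x _ i j] algebra_simps)

text \<open>In the sum of two Christoffel symbols of the first kind with exchanged indices, all
  derivatives of the metric cancel except the \<open>i\<close>-th; this is \<nabla>g = 0.\<close>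

lemma metric_compatible:
  assumes "x \<in> S"
  shows "mpartial i G x = transpose (Gam i x) ** G x + G x ** Gam i x"
proof -
  have "transpose (Gam i x) ** G x = transpose (G x ** Gam i x)"
    by (simp add: matrix_transpose_mul sym_G assms)
  then have "(transpose (Gam i x) ** G x) $ a $ b = (G x ** Gam i x) $ b $ a" for a b
    by (simp add: transpose_def)
  then show ?thesis
    using partial_G_commute[OF assms, of i]
    by (simp add: vec_eq_iff mpartial_nth G_Gam_nth assms field_simps)
qed

text \<open>Differentiating \<open>H y ** G y = mat 1\<close> transfers metric compatibility to the
  inverse metric, which is therefore parallel.\<close>

lemma mpartial_H:
  assumes "x \<in> S"
  shows "mpartial i H x = - (Gam i x ** H x + H x ** transpose (Gam i x))"
proof -
  have "0 = mpartial i (\<lambda>y. mat 1) x" by (simp add: mpartial_const)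
  also have "\<dots> = mpartial i (\<lambda>y. H y ** G y) x"
    by (rule mpartial_cong[OF smooth_on_const[OF open_S] open_S assms]) (simp add: HG)
  also have "\<dots> = mpartial i H x ** G x + H x ** mpartial i G x"
    by (rule mpartial_mult[OF smooth_H smooth_G open_S assms])
  finally have "mpartial i H x ** G x = - (H x ** mpartial i G x)"
    by (simp add: eq_neg_iff_add_eq_0)
  then have "mpartial i H x ** G x ** H x = - (H x ** mpartial i G x) ** H x" by simp
  then have "mpartial i H x = - (H x ** mpartial i G x ** H x)"
    by (simp add: GH assms matrix_mult_minus_left flip: matrix_mul_assoc)
  moreover have "H x ** (G x ** B) = B" for B
    by (simp add: matrix_mul_assoc HG assms)
  ultimately show ?thesis
    by (simp add: metric_compatible assms matrix_add_ldistrib matrix_add_rdistrib GH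
        add.commute flip: matrix_mul_assoc)
qed

section \<open>Symmetries of the curvature and the second Bianchi identity\<close>

lemma Rm_swap: "Rm i j x = - Rm j i x"
  by (simp add: Rm_def)

text \<open>The commutator of two covariant derivatives annihilates the metric. Concretely, the
  second derivatives of \<open>G\<close>, expanded by metric compatibility, are symmetric in
  \<open>i\<close> and \<open>j\<close>, and in the difference of the two expansions everything but
  the curvature cancels.\<close>

lemma Rm_skew:
  assumes "x \<in> S"
  shows "transpose (Rm i j x) ** G x + G x ** Rm i j x = 0"
proof -
  let ?t = transpose
  have second: "mpartial i (mpartial j G) x
      = ?t (mpartial i (Gam j) x) ** G x + ?t (Gam j x) ** (?t (Gam i x) ** G x + G x ** Gam i x)
        + ((?t (Gam i x) ** G x + G x ** Gam i x) ** Gam j x + G x ** mpartial i (Gam j) x)" for i j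
  proof -
    have "mpartial i (mpartial j G) x
        = mpartial i (\<lambda>y. ?t (Gam j y) ** G y + G y ** Gam j y) x"
      by (rule mpartial_cong[OF smooth_on_mpartial[OF open_S smooth_G] open_S assms])
        (rule metric_compatible)
    also have "\<dots> = mpartial i (\<lambda>y. ?t (Gam j y) ** G y) x + mpartial i (\<lambda>y. G y ** Gam j y) x"
      by (intro mpartial_add[OF _ _ open_S assms] smooth_on_matrix_mult open_S smooth_G smooth_Gam
          smooth_on_transpose)
    also have "mpartial i (\<lambda>y. ?t (Gam j y) ** G y) x
        = ?t (mpartial i (Gam j) x) ** G x + ?t (Gam j x) ** mpartial i G x"
      by (subst mpartial_mult[OF smooth_on_transpose[OF open_S smooth_Gam] smooth_G open_S assms])
        (simp add: mpartial_transpose)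
    also have "mpartial i (\<lambda>y. G y ** Gam j y) x
        = mpartial i G x ** Gam j x + G x ** mpartial i (Gam j) x"
      by (rule mpartial_mult[OF smooth_G smooth_Gam open_S assms])
    finally show ?thesis by (simp add: metric_compatible assms)
  qed
  have "mpartial i (mpartial j G) x = mpartial j (mpartial i G) x"
    by (rule mpartial_commute[OF smooth_G open_S assms])
  then show ?thesis
    unfolding second Rm_def
    by (simp add: matrix_ring_simps transpose_add transpose_diff matrix_transpose_mul algebra_simps)
qed

text \<open>For \<Omega> = d\<Gamma> + \<Gamma> \<and> \<Gamma> this is d\<Omega> +
  [\<Gamma>, \<Omega>] = 0: second derivatives of \<Gamma> cancel by symmetry, products by
  associativity. Only the matrix indices carry connection terms; those belonging to
  \<open>p\<close>, \<open>i\<close>, \<open>j\<close> would cancel in the cyclic sum, as the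
  connection is torsion-free.\<close>

lemma bianchi_Rm:
  assumes "x \<in> S"
  shows "(mpartial p (Rm i j) x + Gam p x ** Rm i j x - Rm i j x ** Gam p x)
    + (mpartial i (Rm j p) x + Gam i x ** Rm j p x - Rm j p x ** Gam i x)
    + (mpartial j (Rm p i) x + Gam j x ** Rm p i x - Rm p i x ** Gam j x) = 0"
proof -
  note sm = smooth_on_add smooth_on_diff smooth_on_matrix_mult smooth_on_mpartial open_S smooth_Gam
  have d: "mpartial p (Rm i j) x = mpartial p (mpartial i (Gam j)) x - mpartial p (mpartial j (Gam i)) x
      + (mpartial p (Gam i) x ** Gam j x + Gam i x ** mpartial p (Gam j) x)
      - (mpartial p (Gam j) x ** Gam i x + Gam j x ** mpartial p (Gam i) x)" for p i j
  proof -
    have "mpartial p (Rm i j) x = mpartial p (\<lambda>y. mpartial i (Gam j) y - mpartial j (Gam i) y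
        + Gam i y ** Gam j y - Gam j y ** Gam i y) x"
      by (simp add: Rm_def[abs_def])
    also have "\<dots> = mpartial p (\<lambda>y. mpartial i (Gam j) y - mpartial j (Gam i) y
        + Gam i y ** Gam j y) x - mpartial p (\<lambda>y. Gam j y ** Gam i y) x"
      by (intro mpartial_diff[OF _ _ open_S assms] sm)
    also have "mpartial p (\<lambda>y. mpartial i (Gam j) y - mpartial j (Gam i) y + Gam i y ** Gam j y) x
       = mpartial p (\<lambda>y. mpartial i (Gam j) y - mpartial j (Gam i) y) x
         + mpartial p (\<lambda>y. Gam i y ** Gam j y) x"
      by (intro mpartial_add[OF _ _ open_S assms] sm)
    also have "mpartial p (\<lambda>y. mpartial i (Gam j) y - mpartial j (Gam i) y) x
       = mpartial p (mpartial i (Gam j)) x - mpartial p (mpartial j (Gam i)) x"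
      by (intro mpartial_diff[OF _ _ open_S assms] sm)
    finally show ?thesis
      by (simp add: mpartial_mult[OF smooth_Gam smooth_Gam open_S assms])
  qed
  have c: "mpartial i (mpartial j (Gam k)) x = mpartial j (mpartial i (Gam k)) x" for i j k
    by (rule mpartial_commute[OF smooth_Gam open_S assms])
  show ?thesis
    unfolding d c[of p i] c[of j p] c[of j i]
    unfolding Rm_def by (simp add: matrix_ring_simps algebra_simps)
qed

end

section \<open>The Ricci tensor and the contracted Bianchi identity\<close>

context local_metric
begin

lemma Rm_nth: "Rm i j x $ l $ k = riemann G x l i j k"
  by (simp add: Rm_def riemann_def mpartial_nth Gam_def matrix_matrix_mult_def sum_subtractf)

lemma ricci_nth: "ricci G x $ j $ k = (\<Sum>i\<in>UNIV. Rm i j x $ i $ k)"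
  by (simp add: ricci_def Rm_nth)

lemma smooth_ricci: "smooth_on (ricci G) S"
  by (rule smooth_on_matrixI[OF open_S])
    (simp add: ricci_nth smooth_on_sum open_S smooth_on_matrixD smooth_Rm)

text \<open>With the second matrix index raised, the curvature matrix is skew in the plain sense,
  and contracting it takes no factor of the metric.\<close>

definition Km :: "'n \<Rightarrow> 'n \<Rightarrow> real^'n \<Rightarrow> real^'n^'n" where
  "Km i j x = Rm i j x ** H x"

lemma smooth_Km: "smooth_on (Km i j) S"
  unfolding Km_def[abs_def] by (intro smooth_on_matrix_mult open_S smooth_Rm smooth_H)

lemma Km_swap: "Km i j x = - Km j i x"
  unfolding Km_def by (subst Rm_swap) (simp add: matrix_mult_minus_left)

lemma Km_skew:
  assumes "x \<in> S"
  shows "transpose (Km i j x) = - Km i j x"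
proof -
  have "H x ** (transpose (Rm i j x) ** G x + G x ** Rm i j x) ** H x = 0"
    by (simp add: Rm_skew assms)
  then have "H x ** transpose (Rm i j x) ** (G x ** H x) + (H x ** G x) ** Rm i j x ** H x = 0"
    by (simp add: matrix_ring_simps)
  then show ?thesis
    by (simp add: GH HG assms Km_def matrix_transpose_mul sym_H eq_neg_iff_add_eq_0)
qed

text \<open>As \<open>H\<close> is parallel, raising an index commutes with covariant
  differentiation.\<close>

lemma mpartial_Km:
  assumes "x \<in> S"
  shows "mpartial p (Km i j) x + Gam p x ** Km i j x + Km i j x ** transpose (Gam p x)
    = (mpartial p (Rm i j) x + Gam p x ** Rm i j x - Rm i j x ** Gam p x) ** H x"
  unfolding Km_def[abs_def] mpartial_mult[OF smooth_Rm smooth_H open_S assms]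
  by (simp add: mpartial_H assms matrix_ring_simps)

lemma bianchi_Km:
  assumes "x \<in> S"
  shows "(mpartial p (Km i j) x + Gam p x ** Km i j x + Km i j x ** transpose (Gam p x))
    + (mpartial i (Km j p) x + Gam i x ** Km j p x + Km j p x ** transpose (Gam i x))
    + (mpartial j (Km p i) x + Gam j x ** Km p i x + Km p i x ** transpose (Gam j x)) = 0"
  using arg_cong[OF bianchi_Rm[OF assms, of p i j], of "\<lambda>B. B ** H x"]
  by (simp add: mpartial_Km assms matrix_add_rdistrib)

definition Ric_up :: "real^'n \<Rightarrow> real^'n^'n" where
  "Ric_up x = ricci G x ** H x"

lemma smooth_Ric_up: "smooth_on Ric_up S"
  unfolding Ric_up_def[abs_def] by (intro smooth_on_matrix_mult open_S smooth_ricci smooth_H)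

lemma Ric_up_nth: "Ric_up x $ p $ i = (\<Sum>j\<in>UNIV. Km j p x $ j $ i)"
  unfolding Ric_up_def Km_def matrix_matrix_mult_def
  by (simp add: ricci_nth sum_distrib_right) (rule sum.swap)

lemma partial_Ric_up:
  "x \<in> S \<Longrightarrow> partial q (\<lambda>y. Ric_up y $ p $ i) x = (\<Sum>j\<in>UNIV. mpartial q (Km j p) x $ j $ i)"
  by (simp add: Ric_up_nth mpartial_nth partial_sum differentiable_matrix_nth[OF smooth_Km open_S])

text \<open>This is div Ric = dR / 2 in coordinates. The last sum is the connection term of the
  lower index \<open>p\<close>, moved to the right-hand side.\<close>

lemma contracted_bianchi:
  assumes "x \<in> S"
  shows "(\<Sum>i\<in>UNIV. partial i (\<lambda>y. Ric_up y $ p $ i) x)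
      + (\<Sum>i\<in>UNIV. \<Sum>m\<in>UNIV. Gam i x $ i $ m * Ric_up x $ p $ m)
    = (1/2) * partial p (\<lambda>y. trace (Ric_up y)) x
      + (\<Sum>i\<in>UNIV. \<Sum>m\<in>UNIV. Gam p x $ i $ m * Ric_up x $ i $ m)"
proof -
  have Kskew: "Km i j y $ l $ k = - Km i j y $ k $ l" if "y \<in> S" for i j l k y
    using arg_cong[OF Km_skew[OF that, of i j], of "\<lambda>B. B $ k $ l"] by (simp add: transpose_def)
  have Kswap: "Km i j y $ l $ k = - Km j i y $ l $ k" for i j l k y
    using arg_cong[OF Km_swap[of i j y], of "\<lambda>B. B $ l $ k"] by simp
  have neg: "mpartial q F x $ a $ b = - mpartial q K x $ c $ d"
    if "smooth_on K S" "\<And>y. y \<in> S \<Longrightarrow> F y $ a $ b = - K y $ c $ d" for q F K a b c d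
  proof -
    have K: "(\<lambda>y. K y $ c $ d) differentiable (at x)"
      by (rule differentiable_matrix_nth[OF that(1) open_S assms])
    have "partial q (\<lambda>y. - K y $ c $ d) x = partial q (\<lambda>y. F y $ a $ b) x"
      using that(2) by (intro partial_cong[OF _ open_S assms] differentiable_minus K) simp
    then show ?thesis by (simp add: mpartial_nth partial_uminus K)
  qed
  have bianchi: "(mpartial p (Km i j) x $ l $ k + (\<Sum>m\<in>UNIV. Gam p x $ l $ m * Km i j x $ m $ k)
        + (\<Sum>m\<in>UNIV. Km i j x $ l $ m * Gam p x $ k $ m))
    + (mpartial i (Km j p) x $ l $ k + (\<Sum>m\<in>UNIV. Gam i x $ l $ m * Km j p x $ m $ k)
        + (\<Sum>m\<in>UNIV. Km j p x $ l $ m * Gam i x $ k $ m))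
    + (mpartial j (Km p i) x $ l $ k + (\<Sum>m\<in>UNIV. Gam j x $ l $ m * Km p i x $ m $ k)
        + (\<Sum>m\<in>UNIV. Km p i x $ l $ m * Gam j x $ k $ m)) = 0" for p i j l k
    using arg_cong[OF bianchi_Km[OF assms, of p i j], of "\<lambda>B. B $ l $ k"]
    by (simp add: matrix_matrix_mult_def transpose_def)
  have "(\<Sum>j\<in>UNIV. partial p (\<lambda>y. Ric_up y $ j $ j) x) = partial p (\<lambda>y. trace (Ric_up y)) x"
    unfolding trace_def
    by (rule partial_sum[symmetric]) (rule differentiable_matrix_nth[OF smooth_Ric_up open_S assms])
  then show ?thesis
    using contract_bianchi[of "\<lambda>l i j. Gam i x $ l $ j" "\<lambda>i j l k. Km i j x $ l $ k"
        "\<lambda>q i j l k. mpartial q (Km i j) x $ l $ k" p, OF Gam_torsion[OF assms] Kswap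
        Kskew[OF assms] neg[OF smooth_Km Kswap] neg[OF smooth_Km Kskew] bianchi]
    by (simp add: Ric_up_nth[symmetric] partial_Ric_up[OF assms, symmetric])
qed

section \<open>Divergence and Lie derivative through the connection\<close>

lemma covariant_derivative_nth:
  "covariant_derivative G X x $ k $ i = partial i (\<lambda>y. X y $ k) x + (Gam i x *v X x) $ k"
  by (simp add: covariant_derivative_def Gam_def matrix_vector_mult_def)

lemma divergence_eq:
  "divergence G X x = (\<Sum>i\<in>UNIV. partial i (\<lambda>y. X y $ i) x + (\<Sum>j\<in>UNIV. Gam i x $ i $ j * X x $ j))"
  by (simp add: divergence_def trace_def covariant_derivative_nth matrix_vector_mult_def)

text \<open>The product rule splits the divergence of Ric(X) into (div Ric)(X) and a pairing of Ric
  with the derivatives of \<open>X\<close>. The contracted Bianchi identity rewrites the former, and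
  the \<Gamma> sum it leaves over is, by vanishing torsion, exactly what completes partial to
  covariant derivatives in the latter.\<close>

lemma divergence_Ric_up:
  assumes "x \<in> S" and X: "smooth_on X S"
  shows "divergence G (\<lambda>y. transpose (Ric_up y) *v X y) x
    = (1/2) * (\<Sum>p\<in>UNIV. X x $ p * partial p (\<lambda>y. trace (Ric_up y)) x)
      + trace (transpose (Ric_up x) ** covariant_derivative G X x)"
proof -
  have dX: "(\<lambda>y. X y $ p) differentiable (at x)" for p
    using smooth_onD(1)[OF smooth_on_vec_nth[OF open_S X] assms(1)] .
  have dA: "(\<lambda>y. Ric_up y $ p $ i) differentiable (at x)" for p i
    by (rule differentiable_matrix_nth[OF smooth_Ric_up open_S assms(1)])
  have "divergence G (\<lambda>y. transpose (Ric_up y) *v X y) x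
      = (\<Sum>i\<in>UNIV. (\<Sum>p\<in>UNIV. partial i (\<lambda>y. Ric_up y $ p $ i) x * X x $ p
          + Ric_up x $ p $ i * partial i (\<lambda>y. X y $ p) x)
        + (\<Sum>j\<in>UNIV. Gam i x $ i $ j * (\<Sum>p\<in>UNIV. Ric_up x $ p $ j * X x $ p)))"
    unfolding divergence_eq
    by (simp add: matrix_vector_mult_def vector_matrix_mult_def transpose_def partial_sum
        partial_mult dX dA differentiable_mult mult.commute add.commute)
  also have "\<dots> = (\<Sum>p\<in>UNIV. X x $ p * ((\<Sum>i\<in>UNIV. partial i (\<lambda>y. Ric_up y $ p $ i) x)
        + (\<Sum>i\<in>UNIV. \<Sum>m\<in>UNIV. Gam i x $ i $ m * Ric_up x $ p $ m)))
      + (\<Sum>i\<in>UNIV. \<Sum>p\<in>UNIV. Ric_up x $ p $ i * partial i (\<lambda>y. X y $ p) x)"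
  proof -
    have "(\<Sum>i\<in>UNIV. \<Sum>p\<in>UNIV. partial i (\<lambda>y. Ric_up y $ p $ i) x * X x $ p)
        = (\<Sum>p\<in>UNIV. X x $ p * (\<Sum>i\<in>UNIV. partial i (\<lambda>y. Ric_up y $ p $ i) x))"
      unfolding sum_distrib_left by (rule trans[OF sum.swap]) (simp add: mult.commute)
    moreover have "(\<Sum>i\<in>UNIV. \<Sum>j\<in>UNIV. Gam i x $ i $ j * (\<Sum>p\<in>UNIV. Ric_up x $ p $ j * X x $ p))
        = (\<Sum>p\<in>UNIV. X x $ p * (\<Sum>i\<in>UNIV. \<Sum>m\<in>UNIV. Gam i x $ i $ m * Ric_up x $ p $ m))"
      unfolding sum_distrib_left
      by (rule trans[OF sum.cong[OF refl sum.swap] trans[OF sum.swap]])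
        (simp add: mult_ac)
    ultimately show ?thesis by (simp add: sum.distrib distrib_left)
  qed
  also have "\<dots> = (\<Sum>p\<in>UNIV. X x $ p * ((1/2) * partial p (\<lambda>y. trace (Ric_up y)) x
      + (\<Sum>i\<in>UNIV. \<Sum>m\<in>UNIV. Gam p x $ i $ m * Ric_up x $ i $ m)))
      + (\<Sum>i\<in>UNIV. \<Sum>p\<in>UNIV. Ric_up x $ p $ i * partial i (\<lambda>y. X y $ p) x)"
    by (simp only: contracted_bianchi[OF assms(1)])
  also have "\<dots> = (1/2) * (\<Sum>p\<in>UNIV. X x $ p * partial p (\<lambda>y. trace (Ric_up y)) x)
      + ((\<Sum>m\<in>UNIV. \<Sum>i\<in>UNIV. Ric_up x $ i $ m * partial m (\<lambda>y. X y $ i) x)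
      + (\<Sum>p\<in>UNIV. \<Sum>i\<in>UNIV. \<Sum>m\<in>UNIV. X x $ p * (Gam p x $ i $ m * Ric_up x $ i $ m)))"
    by (simp add: distrib_left sum.distrib sum_distrib_left mult_ac)
  also have "(\<Sum>p\<in>UNIV. \<Sum>i\<in>UNIV. \<Sum>m\<in>UNIV. X x $ p * (Gam p x $ i $ m * Ric_up x $ i $ m))
      = (\<Sum>m\<in>UNIV. \<Sum>i\<in>UNIV. \<Sum>p\<in>UNIV. Ric_up x $ i $ m * (Gam m x $ i $ p * X x $ p))"
    by (rule trans[OF sum.cong[OF refl sum.swap] trans[OF sum.swap trans[OF sum.cong[OF refl sum.swap]]]])
      (simp add: Gam_torsion[OF assms(1)] mult_ac)
  also have "(\<Sum>m\<in>UNIV. \<Sum>i\<in>UNIV. Ric_up x $ i $ m * partial m (\<lambda>y. X y $ i) x) + \<dots>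
      = trace (transpose (Ric_up x) ** covariant_derivative G X x)"
    by (simp add: trace_def matrix_matrix_mult_def transpose_def covariant_derivative_nth
        matrix_vector_mult_def distrib_left sum.distrib sum_distrib_left)
  finally show ?thesis .
qed

text \<open>The connection terms of the two summands are Christoffel symbols of the first kind;
  their sum is the derivative of the metric along \<open>X\<close>, the first term of
  \<open>lie_metric\<close>.\<close>

lemma lie_metric_eq:
  assumes "x \<in> S"
  shows "lie_metric X G x
    = G x ** covariant_derivative G X x + transpose (G x ** covariant_derivative G X x)"
proof -
  have GN: "(G x ** covariant_derivative G X x) $ i $ j
      = (\<Sum>k\<in>UNIV. G x $ i $ k * partial j (\<lambda>y. X y $ k) x) + ((G x ** Gam j x) *v X x) $ i" for i j
  proof -
    have "(\<Sum>k\<in>UNIV. G x $ i $ k * (Gam j x *v X x) $ k) = (G x *v (Gam j x *v X x)) $ i"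
      by (simp add: matrix_vector_mult_def[of "G x"])
    then show ?thesis
      by (simp add: matrix_matrix_mult_def[of _ "covariant_derivative G X x"]
          covariant_derivative_nth distrib_left sum.distrib matrix_vector_mul_assoc)
  qed
  have "((G x ** Gam j x) *v X x) $ i + ((G x ** Gam i x) *v X x) $ j
      = (\<Sum>k\<in>UNIV. X x $ k * partial k (\<lambda>y. G y $ i $ j) x)" for i j
  proof -
    have "(G x ** Gam j x) $ i $ k + (G x ** Gam i x) $ j $ k = partial k (\<lambda>y. G y $ i $ j) x" for k
      using partial_G_commute[OF assms, of j k i] partial_G_commute[OF assms, of k j i]
        partial_G_commute[OF assms, of i j k]
      by (simp add: G_Gam_nth assms field_simps)
    then show ?thesis
      by (simp add: matrix_vector_mult_def mult.commute flip: sum.distrib distrib_left)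
  qed
  then have *: "((G x ** Gam j x) *v X x) $ i + ((G x ** Gam i x) *v X x) $ j
      + ((\<Sum>k\<in>UNIV. G x $ i $ k * partial j (\<lambda>y. X y $ k) x)
        + (\<Sum>k\<in>UNIV. G x $ j $ k * partial i (\<lambda>y. X y $ k) x))
      = lie_metric X G x $ i $ j" for i j
    using G_nth_commute[OF assms, of _ j] by (simp add: lie_metric_def sum.distrib)
  show ?thesis
    unfolding vec_eq_iff by (simp add: GN transpose_def *[symmetric] del: add_left_cancel add_right_cancel)
qed

end

section \<open>Positive semidefinite matrices\<close>

lemma inner_axis_matrix: "axis i 1 \<bullet> (B *v v) = (B *v v) $ i"
  for B :: "real^'n::finite^'n"
  by (simp add: inner_axis')

lemma symmetric_inner: "transpose B = B \<Longrightarrow> v \<bullet> (B *v w) = (B *v v) \<bullet> w"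
  for B :: "real^'n::finite^'n"
  by (metis dot_lmul_matrix transpose_matrix_vector)

lemma symmetric_inner_swap: "transpose B = B \<Longrightarrow> v \<bullet> (B *v w) = w \<bullet> (B *v v)"
  for B :: "real^'n::finite^'n"
  by (metis symmetric_inner inner_commute)

lemma psd_zero_row:
  fixes B :: "real^'n::finite^'n"
  assumes sym: "transpose B = B" and pos: "\<And>v. 0 \<le> v \<bullet> (B *v v)" and "B $ i $ i = 0"
  shows "B $ i $ j = 0"
proof (rule ccontr)
  assume nz: "B $ i $ j \<noteq> 0"
  \<comment> \<open>As the diagonal entry at \<open>i\<close> is 0, the quadratic form at t e_i +
    e_j is affine in t, namely 2 t B_ij + B_jj. This t gives it the value -1.\<close>
  define t where "t = - (B $ j $ j + 1) / (2 * B $ i $ j)"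
  have e: "(B *v axis k 1) $ l = B $ l $ k" for k l by (simp add: matrix_vector_mul_component inner_axis)
  have ji: "B $ j $ i = B $ i $ j" using arg_cong[OF sym, of "\<lambda>B. B $ i $ j"] by (simp add: transpose_def)
  have "0 \<le> (t *\<^sub>R axis i 1 + axis j 1) \<bullet> (B *v (t *\<^sub>R axis i 1 + axis j 1))" by (rule pos)
  also have "\<dots> = 2 * t * B $ i $ j + B $ j $ j"
    by (simp add: matrix_vector_right_distrib matrix_vector_mult_scaleR inner_add_left
        inner_add_right inner_axis_matrix e ji assms(3))
  also have "\<dots> = -1" using nz by (simp add: t_def field_simps)
  finally show False by simp
qed

text \<open>One step of Cholesky elimination per index of \<open>s\<close>.\<close>

lemma psd_factorisation_on:
  fixes B :: "real^'n::finite^'n"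
  assumes "finite s" "transpose B = B" "\<And>v. 0 \<le> v \<bullet> (B *v v)"
    "\<And>i j. B $ i $ j \<noteq> 0 \<Longrightarrow> i \<in> s"
  shows "\<exists>Q. B = Q ** transpose Q \<and> (\<forall>j k. Q $ j $ k \<noteq> 0 \<longrightarrow> k \<in> s)"
  using assms
proof (induction s arbitrary: B)
  case empty
  have "B = 0" using empty.prems(3) by (simp add: vec_eq_iff) blast
  then show ?case by (intro exI[of _ 0]) simp
next
  case (insert i s)
  have comm: "B $ a $ b = B $ b $ a" for a b
    using arg_cong[OF insert.prems(1), of "\<lambda>B. B $ b $ a"] by (simp add: transpose_def)
  define d where "d = B $ i $ i"
  have e: "(B *v axis k 1) $ l = B $ l $ k" for k l by (simp add: matrix_vector_mul_component inner_axis)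
  show ?case
  proof (cases "d = 0")
    case True
    then have "B $ i $ j = 0" for j
      using psd_zero_row[OF insert.prems(1,2)] by (simp add: d_def)
    then have "a \<in> s" if "B $ a $ b \<noteq> 0" for a b
      using insert.prems(3)[OF that] that by auto
    then obtain Q where "B = Q ** transpose Q" "\<forall>j k. Q $ j $ k \<noteq> 0 \<longrightarrow> k \<in> s"
      using insert.IH[OF insert.prems(1,2)] by blast
    then show ?thesis by blast
  next
    case False
    have "0 \<le> d" using insert.prems(2)[of "axis i 1"] by (simp add: d_def inner_axis_matrix e)
    with False have "0 < d" by simp
    define h where "h = B *v axis i 1"
    have h: "h $ a = B $ a $ i" for a by (simp add: h_def e)
    \<comment> \<open>The Schur complement of the pivot \<open>d\<close>: row and column
      \<open>i\<close> become zero.\<close>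
    define B' where "B' = (\<chi> a b. B $ a $ b - h $ a * h $ b / d)"
    have "transpose B' = B'" by (simp add: B'_def transpose_def vec_eq_iff comm mult.commute)
    moreover have "0 \<le> v \<bullet> (B' *v v)" for v
    proof -
      have B'v: "B' *v v = B *v v - ((h \<bullet> v) / d) *\<^sub>R h"
        by (simp add: vec_eq_iff B'_def matrix_vector_mult_def inner_vec_def left_diff_distrib
            sum_subtractf sum_divide_distrib sum_distrib_right) (simp add: mult_ac)
      \<comment> \<open>Moving \<open>v\<close> along the \<open>i\<close>-th axis makes it
        B-orthogonal to that axis; the form of \<open>B\<close> at \<open>u\<close> is then the form
        of \<open>B'\<close> at \<open>v\<close>.\<close>
      define u where "u = v - ((h \<bullet> v) / d) *\<^sub>R axis i 1"
      have "0 \<le> u \<bullet> (B *v u)" by (rule insert.prems(2))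
      also have "u \<bullet> (B *v u) = v \<bullet> (B *v v) - (h \<bullet> v) / d * (v \<bullet> h)
          - (h \<bullet> v) / d * (axis i 1 \<bullet> (B *v v)) + (h \<bullet> v) / d * ((h \<bullet> v) / d * (axis i 1 \<bullet> h))"
        by (simp add: u_def matrix_vector_mult_diff_distrib matrix_vector_mult_scaleR
            inner_diff_left inner_diff_right h_def algebra_simps)
      also have "axis i 1 \<bullet> (B *v v) = h \<bullet> v"
        by (simp add: h_def symmetric_inner insert.prems(1))
      also have "axis i 1 \<bullet> h = d" by (simp add: inner_axis' h d_def)
      also have "v \<bullet> (B *v v) - (h \<bullet> v) / d * (v \<bullet> h) - (h \<bullet> v) / d * (h \<bullet> v)
          + (h \<bullet> v) / d * ((h \<bullet> v) / d * d) = v \<bullet> (B' *v v)"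
        using \<open>0 < d\<close> by (simp add: B'v inner_diff_right inner_commute)
      finally show ?thesis .
    qed
    moreover have "a \<in> s" if "B' $ a $ b \<noteq> 0" for a b
    proof -
      have "B $ a $ b \<noteq> 0 \<or> B $ a $ i \<noteq> 0" using that by (auto simp: B'_def h)
      then have "a \<in> insert i s" using insert.prems(3) by blast
      moreover have "a \<noteq> i" using that \<open>0 < d\<close> comm[of b i] by (auto simp: B'_def h d_def)
      ultimately show ?thesis by simp
    qed
    ultimately obtain Q where Q: "B' = Q ** transpose Q" and Qs: "\<And>j k. Q $ j $ k \<noteq> 0 \<Longrightarrow> k \<in> s"
      using insert.IH[of B'] by blast
    \<comment> \<open>Column \<open>i\<close> of \<open>Q\<close> is zero by the support condition,
      so it is free to hold the rank-one part that was split off from \<open>B\<close>.\<close>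
    define P where "P = (\<chi> j k. if k = i then h $ j / sqrt d else Q $ j $ k)"
    have Qi: "Q $ j $ i = 0" for j using Qs insert.hyps(2) by blast
    have "B $ a $ b = (P ** transpose P) $ a $ b" for a b
    proof -
      have "(P ** transpose P) $ a $ b = (\<Sum>k\<in>UNIV. Q $ a $ k * Q $ b $ k
          + (if k = i then h $ a / sqrt d * (h $ b / sqrt d) else 0))"
        by (simp add: P_def matrix_matrix_mult_def transpose_def) (intro sum.cong refl, simp add: Qi)
      also have "\<dots> = B' $ a $ b + h $ a * h $ b / d"
        using \<open>0 < d\<close> by (simp add: sum.distrib Q matrix_matrix_mult_def transpose_def)
      finally show ?thesis by (simp add: B'_def)
    qed
    then have "B = P ** transpose P" by (simp add: vec_eq_iff)
    moreover have "k \<in> insert i s" if "P $ j $ k \<noteq> 0" for j k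
      using that Qs by (auto simp: P_def split: if_splits)
    ultimately show ?thesis by blast
  qed
qed

lemma psd_factorisation:
  fixes B :: "real^'n::finite^'n"
  assumes "transpose B = B" "\<And>v. 0 \<le> v \<bullet> (B *v v)"
  obtains Q :: "real^'n^'n" where "B = Q ** transpose Q"
  using psd_factorisation_on[OF finite[of UNIV] assms UNIV_I] by blast

context local_metric
begin

lemma H_factorisation: assumes "x \<in> S" obtains Q :: "real^'n^'n" where "H x = Q ** transpose Q"
proof (rule psd_factorisation[OF sym_H[OF assms]])
  fix v
  have "v \<bullet> (H x *v v) = (H x *v v) \<bullet> (G x *v (H x *v v))"
    by (simp add: matrix_vector_mul_assoc GH assms inner_commute)
  also have "\<dots> \<ge> 0" using pos_G[OF assms] by (cases "H x *v v = 0") (auto intro: less_imp_le)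
  finally show "0 \<le> v \<bullet> (H x *v v)" .
qed (rule that)

text \<open>The trace is the squared norm of \<open>L\<close> with respect to the metric. Factoring
  \<open>H x\<close> as \<open>Q ** transpose Q\<close> and rotating the trace turns it into the sum
  of squares of the entries of \<open>transpose Q ** L ** Q\<close>.\<close>

lemma norm_tensor:
  assumes "x \<in> S" "transpose L = L"
  shows "0 \<le> trace (H x ** L ** H x ** L)" "trace (H x ** L ** H x ** L) = 0 \<Longrightarrow> L = 0"
proof -
  obtain Q :: "real^'n^'n" where Q: "H x = Q ** transpose Q" using H_factorisation[OF assms(1)] .
  define C where "C = transpose Q ** L ** Q"
  have C: "transpose C = C" by (simp add: C_def matrix_transpose_mul assms(2) matrix_mul_assoc)
  have "trace (H x ** L ** H x ** L) = trace (Q ** (transpose Q ** L ** Q ** transpose Q ** L))"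
    by (simp add: Q matrix_mul_assoc)
  also have "\<dots> = trace (C ** C)"
    by (subst trace_mul_sym) (simp add: C_def matrix_mul_assoc)
  also have "\<dots> = (\<Sum>i\<in>UNIV. \<Sum>j\<in>UNIV. (C $ i $ j)\<^sup>2)"
    by (subst C[symmetric], simp add: trace_def matrix_matrix_mult_def transpose_def power2_eq_square)
      (rule sum.swap)
  finally have *: "trace (H x ** L ** H x ** L) = (\<Sum>i\<in>UNIV. \<Sum>j\<in>UNIV. (C $ i $ j)\<^sup>2)" .
  show "0 \<le> trace (H x ** L ** H x ** L)" unfolding * by (intro sum_nonneg) auto
  assume "trace (H x ** L ** H x ** L) = 0"
  then have "C = 0"
    unfolding * by (simp add: sum_nonneg_eq_0_iff sum_nonneg vec_eq_iff)
  then have "Q ** C ** transpose Q = 0" by simp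
  then have "H x ** L ** H x = 0" by (simp add: Q C_def matrix_mul_assoc)
  then have "G x ** (H x ** L ** H x) ** G x = 0" by simp
  then have "(G x ** H x) ** L ** (H x ** G x) = 0" by (simp add: matrix_mul_assoc)
  then show "L = 0" by (simp add: GH HG assms(1))
qed

end

section \<open>The Riemannian volume density\<close>

text \<open>A permutation other than the identity moves at least two points, so an off-diagonal
  factor survives the omission of index \<open>i\<close>.\<close>

lemma prod_mat1_permutation:
  fixes p :: "'n::finite \<Rightarrow> 'n"
  assumes "p permutes UNIV" "p \<noteq> id"
  shows "(\<Prod>j\<in>UNIV - {i}. (mat 1 :: real^'n^'n) $ j $ p j) = 0"
proof -
  obtain j where j: "p j \<noteq> j" using assms(2) by (auto simp: fun_eq_iff)
  then have "p (p j) \<noteq> p j" using permutes_inj[OF assms(1)] by (auto dest: injD)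
  then obtain k where "k \<noteq> i" "p k \<noteq> k" using j by metis
  then show ?thesis by (intro prod_zero) (auto intro!: bexI[of _ k] simp: mat_def)
qed

text \<open>After differentiation of the Leibniz formula every permutation except the identity
  contributes a product with a vanishing factor.\<close>

lemma partial_det_at_identity:
  fixes F :: "real^'n::finite \<Rightarrow> real^'n^'n"
  assumes F: "\<And>a b. (\<lambda>y. F y $ a $ b) differentiable (at x)" and "F x = mat 1"
  shows "partial i (\<lambda>y. det (F y)) x = trace (mpartial i F x)"
proof -
  have dp: "((\<lambda>y. \<Prod>j\<in>UNIV. F y $ j $ p j) has_derivative
      (\<lambda>v. \<Sum>j\<in>UNIV. frechet_derivative (\<lambda>y. F y $ j $ p j) (at x) v * (\<Prod>k\<in>UNIV - {j}. F x $ k $ p k)))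
      (at x)" for p
    using F frechet_derivative_works by (intro has_derivative_prod) blast
  have "((\<lambda>y. det (F y)) has_derivative (\<lambda>v. \<Sum>p\<in>{p. p permutes UNIV}. of_int (sign p) *
      (\<Sum>j\<in>UNIV. frechet_derivative (\<lambda>y. F y $ j $ p j) (at x) v * (\<Prod>k\<in>UNIV - {j}. F x $ k $ p k))))
      (at x)"
    unfolding det_def by (intro has_derivative_sum has_derivative_mult_right dp)
  then have "partial i (\<lambda>y. det (F y)) x = (\<Sum>p\<in>{p. p permutes UNIV}. of_int (sign p) *
      (\<Sum>j\<in>UNIV. partial i (\<lambda>y. F y $ j $ p j) x * (\<Prod>k\<in>UNIV - {j}. F x $ k $ p k)))"
    by (simp add: partial_eqI) (simp add: partial_def)
  also have "\<dots> = (\<Sum>p\<in>{id :: 'n \<Rightarrow> 'n}. of_int (sign p) *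
      (\<Sum>j\<in>UNIV. partial i (\<lambda>y. F y $ j $ p j) x * (\<Prod>k\<in>UNIV - {j}. F x $ k $ p k)))"
    by (intro sum.mono_neutral_right)
      (auto simp: permutes_id assms(2) prod_mat1_permutation finite_permutations)
  also have "\<dots> = trace (mpartial i F x)"
    by (simp add: assms(2) trace_def mpartial_nth sign_id) (simp add: mat_def)
  finally show ?thesis .
qed

context local_metric
begin

definition vol :: "real^'n \<Rightarrow> real" where "vol x = sqrt \<bar>det (G x)\<bar>"

lemma vol_pos: "x \<in> S \<Longrightarrow> 0 < vol x"
  by (simp add: vol_def det_G)

lemma smooth_det: "smooth_on (\<lambda>y. det (G y)) S"
  by (intro smooth_on_det open_S smooth_G_nth)

lemma smooth_vol: "smooth_on vol S"
  unfolding vol_def[abs_def]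
  by (rule smooth_on_sqrt_abs[OF open_S smooth_det det_G])

text \<open>Multiplying by the constant matrix \<open>H x\<close> moves the question to a matrix
  function with value \<open>mat 1\<close> at \<open>x\<close>. Metric compatibility then evaluates
  the trace of \<open>H x ** mpartial i G x\<close>.\<close>

lemma partial_det_G:
  assumes "x \<in> S"
  shows "partial i (\<lambda>y. det (G y)) x = det (G x) * (2 * trace (Gam i x))"
proof -
  have sm: "smooth_on (\<lambda>y. H x ** G y) S"
    by (intro smooth_on_matrix_mult smooth_on_const open_S smooth_G)
  have "det (G x) * det (H x) = 1" using arg_cong[OF GH[OF assms], of det] by (simp add: det_mul)
  then have "(\<lambda>y. det (G y)) = (\<lambda>y. det (G x) * det (H x ** G y))"
    by (simp add: det_mul flip: mult.assoc)
  then have "partial i (\<lambda>y. det (G y)) x = partial i (\<lambda>y. det (G x) * det (H x ** G y)) x"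
    by (rule arg_cong)
  also have "\<dots> = det (G x) * partial i (\<lambda>y. det (H x ** G y)) x"
    using smooth_onD(1)[OF smooth_on_det[OF open_S smooth_on_matrixD[OF sm open_S]] assms]
    by (subst partial_mult) (simp_all add: partial_const)
  also have "partial i (\<lambda>y. det (H x ** G y)) x = trace (mpartial i (\<lambda>y. H x ** G y) x)"
    by (rule partial_det_at_identity[OF differentiable_matrix_nth[OF sm open_S assms] HG[OF assms]])
  also have "mpartial i (\<lambda>y. H x ** G y) x = H x ** mpartial i G x"
    by (simp add: mpartial_mult[OF smooth_on_const[OF open_S] smooth_G open_S assms] mpartial_const)
  also have "trace \<dots> = trace (G x ** H x ** transpose (Gam i x)) + trace (H x ** G x ** Gam i x)"
    by (simp add: metric_compatible assms matrix_add_ldistrib trace_add matrix_mul_assoc)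
      (metis trace_mul_sym matrix_mul_assoc)
  also have "\<dots> = 2 * trace (Gam i x)"
    by (simp add: GH HG assms trace_def transpose_def)
  finally show ?thesis .
qed

lemma partial_vol:
  assumes "x \<in> S"
  shows "partial i vol x = vol x * trace (Gam i x)"
proof -
  have "partial i vol x = sqrt \<bar>det (G x)\<bar> * inverse (2 * det (G x)) * partial i (\<lambda>y. det (G y)) x"
    unfolding vol_def[abs_def] partial_def[of i "\<lambda>y. det (G y)"]
    by (rule partial_eqI[OF has_derivative_sqrt_abs[OF smooth_onD(2)[OF smooth_det assms]
            det_G[OF assms]]])
  then show ?thesis using det_G[OF assms] by (simp add: partial_det_G assms vol_def field_simps)
qed

text \<open>As \<partial>_i log \<open>vol\<close> is the trace of \<open>Gam i\<close>, the density
  absorbs the connection term of the divergence and leaves a flat divergence, to which the Euclidean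
  integral applies. The factor \<phi> is the cutoff that will make it compactly supported.\<close>

lemma divergence_vol:
  assumes "x \<in> S" "smooth_on V S" "\<phi> differentiable (at x)"
  shows "(\<Sum>i\<in>UNIV. partial i (\<lambda>y. vol y * (\<phi> y * V y $ i)) x)
    = vol x * (\<phi> x * divergence G V x) + vol x * frechet_derivative \<phi> (at x) (V x)"
proof -
  have dV: "(\<lambda>y. V y $ p) differentiable (at x)" for p
    using smooth_onD(1)[OF smooth_on_vec_nth[OF open_S assms(2)] assms(1)] .
  have dm: "vol differentiable (at x)" using smooth_onD(1)[OF smooth_vol assms(1)] .
  have "(\<Sum>i\<in>UNIV. trace (Gam i x) * V x $ i) = (\<Sum>i\<in>UNIV. \<Sum>j\<in>UNIV. Gam i x $ i $ j * V x $ j)"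
    unfolding trace_def sum_distrib_right
    by (rule trans[OF sum.swap]) (simp add: Gam_torsion[OF assms(1)])
  then have "divergence G V x = (\<Sum>i\<in>UNIV. partial i (\<lambda>y. V y $ i) x + trace (Gam i x) * V x $ i)"
    by (simp add: divergence_eq sum.distrib)
  then show ?thesis
    by (simp add: partial_mult dm dV assms(3) differentiable_mult partial_vol[OF assms(1)]
        frechet_derivative_eq_partial[OF assms(3)] sum_distrib_left sum.distrib[symmetric] algebra_simps)
qed

end

section \<open>The quasi-Einstein equation\<close>

lemma partial_affine:
  "f differentiable (at x) \<Longrightarrow> partial i (\<lambda>y. c + d * f y) x = d * partial i f x"
  by (simp add: partial_add partial_mult partial_const differentiable_mult)

lemma tensor_product_mult_vector: "tensor_product a b *v v = (b \<bullet> v) *\<^sub>R a"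
  by (simp add: tensor_product_def matrix_vector_mult_def vec_eq_iff inner_vec_def
      sum_distrib_right sum_distrib_left mult_ac)

lemma matrix_mult_tensor_product: "B ** tensor_product a b = tensor_product (B *v a) b"
  by (simp add: tensor_product_def matrix_vector_mult_def matrix_matrix_mult_def vec_eq_iff
      sum_distrib_right sum_distrib_left mult_ac)

lemma tensor_product_matrix_mult: "tensor_product a b ** B = tensor_product a (transpose B *v b)"
  by (simp add: tensor_product_def matrix_vector_mult_def vector_matrix_mult_def
      matrix_matrix_mult_def vec_eq_iff sum_distrib_left transpose_def mult_ac)

lemma trace_tensor_product: "trace (tensor_product a b) = a \<bullet> b"
  by (simp add: trace_def tensor_product_def inner_vec_def)

lemma transpose_tensor_product: "transpose (tensor_product a b) = tensor_product b a"
  by (simp add: transpose_def tensor_product_def mult.commute)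

lemma trace_transpose: "trace (transpose B) = trace B"
  by (simp add: trace_def transpose_def)

lemma trace_scaleR: "trace (c *\<^sub>R B) = c * trace B" for B :: "real^'n::finite^'n"
  by (simp add: trace_def sum_distrib_left)

lemma dual_form_eq: "dual_form G X x = G x *v X x"
  by (simp add: dual_form_def matrix_vector_mult_def)

context local_metric
begin

text \<open>The vector field \<open>(\<L>\<^sub>X g)(X, \<cdot>)\<^sup>\<sharp>\<close>.\<close>

definition lie_up :: "(real^'n \<Rightarrow> real^'n) \<Rightarrow> real^'n \<Rightarrow> real^'n" where
  "lie_up X x = H x *v (lie_metric X G x *v X x)"

lemma smooth_lie_metric:
  assumes "smooth_on X S" shows "smooth_on (lie_metric X G) S"
  unfolding lie_metric_def[abs_def]
  by (intro smooth_on_vec_lambda smooth_on_sum smooth_on_add smooth_on_mult open_S smooth_on_partial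
      smooth_G_nth smooth_on_vec_nth[OF open_S assms])

lemma smooth_lie_up:
  assumes "smooth_on X S" shows "smooth_on (lie_up X) S"
  unfolding lie_up_def[abs_def]
  by (intro smooth_on_matrix_vector_mult open_S smooth_H smooth_lie_metric assms)

lemma transpose_lie_metric: "x \<in> S \<Longrightarrow> transpose (lie_metric X G x) = lie_metric X G x"
  by (simp add: lie_metric_eq transpose_add add.commute)

text \<open>The derivative of \<open>G\<close>, expressed through \<open>Gam k\<close>, completes
  the partial derivatives of \<open>X\<close> to covariant ones.\<close>

lemma partial_norm_sq:
  assumes "x \<in> S" "smooth_on X S"
  shows "partial k (\<lambda>y. X y \<bullet> (G y *v X y)) x
    = 2 * (transpose (covariant_derivative G X x) *v (G x *v X x)) $ k"
proof -
  have dX: "(\<lambda>y. X y $ p) differentiable (at x)" for p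
    using smooth_onD(1)[OF smooth_on_vec_nth[OF open_S assms(2)] assms(1)] .
  have dG: "(\<lambda>y. G y $ a $ b) differentiable (at x)" for a b
    by (rule differentiable_matrix_nth[OF smooth_G open_S assms(1)])
  define dXk where "dXk = (\<chi> i. partial k (\<lambda>y. X y $ i) x)"
  have "partial k (\<lambda>y. X y \<bullet> (G y *v X y)) x
      = dXk \<bullet> (G x *v X x) + X x \<bullet> (mpartial k G x *v X x) + X x \<bullet> (G x *v dXk)"
    by (simp add: inner_vec_def matrix_vector_mult_def partial_sum partial_mult dX dG
        differentiable_mult dXk_def mpartial_nth sum.distrib distrib_left)
  also have "X x \<bullet> (mpartial k G x *v X x) = 2 * ((Gam k x *v X x) \<bullet> (G x *v X x))"
  proof -
    have "X x \<bullet> (transpose (Gam k x) *v (G x *v X x)) = (Gam k x *v X x) \<bullet> (G x *v X x)"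
      by (metis dot_lmul_matrix inner_commute transpose_matrix_vector)
    moreover have "X x \<bullet> (G x *v (Gam k x *v X x)) = (Gam k x *v X x) \<bullet> (G x *v X x)"
      by (rule symmetric_inner_swap[OF sym_G[OF assms(1)]])
    ultimately show ?thesis
      by (simp add: metric_compatible assms(1) matrix_vector_mult_add_rdistrib inner_add_right
          matrix_vector_mul_assoc)
  qed
  also have "X x \<bullet> (G x *v dXk) = dXk \<bullet> (G x *v X x)"
    by (rule symmetric_inner_swap[OF sym_G[OF assms(1)]])
  also have "dXk \<bullet> (G x *v X x) + 2 * ((Gam k x *v X x) \<bullet> (G x *v X x)) + dXk \<bullet> (G x *v X x)
      = 2 * ((dXk + Gam k x *v X x) \<bullet> (G x *v X x))"
    by (simp add: inner_add_left)
  also have "dXk + Gam k x *v X x = (\<chi> i. covariant_derivative G X x $ i $ k)"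
    by (simp add: vec_eq_iff dXk_def covariant_derivative_nth)
  also have "(\<chi> i. covariant_derivative G X x $ i $ k) \<bullet> (G x *v X x)
      = (transpose (covariant_derivative G X x) *v (G x *v X x)) $ k"
    by (simp only: inner_vec_def matrix_vector_mult_def transpose_def vec_lambda_beta inner_real_def)
  finally show ?thesis .
qed

lemma divergence_cong:
  assumes "x \<in> S" "smooth_on V S" "\<And>y. y \<in> S \<Longrightarrow> V y = W y"
  shows "divergence G V x = divergence G W x"
proof -
  have "partial i (\<lambda>y. V y $ j) x = partial i (\<lambda>y. W y $ j) x" for i j
    using assms smooth_onD(1)[OF smooth_on_vec_nth[OF open_S assms(2)] assms(1)]
    by (intro partial_cong[OF _ open_S]) auto
  then show ?thesis by (simp add: divergence_eq assms(1,3))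
qed

lemma divergence_combination:
  assumes "x \<in> S" "smooth_on f S" "smooth_on X S" "smooth_on W S"
  shows "divergence G (\<lambda>y. f y *\<^sub>R X y + c *\<^sub>R W y) x
    = f x * divergence G X x + (\<Sum>i\<in>UNIV. X x $ i * partial i f x) + c * divergence G W x"
proof -
  have d: "(\<lambda>y. Y y $ p) differentiable (at x)" if "smooth_on Y S" for p Y
    using smooth_onD(1)[OF smooth_on_vec_nth[OF open_S that] assms(1)] .
  have "f differentiable (at x)" using smooth_onD(1)[OF assms(2,1)] .
  then have "divergence G (\<lambda>y. f y *\<^sub>R X y + c *\<^sub>R W y) x
      = (\<Sum>i\<in>UNIV. (partial i f x * X x $ i + f x * partial i (\<lambda>y. X y $ i) x
          + c * partial i (\<lambda>y. W y $ i) x)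
        + (\<Sum>j\<in>UNIV. f x * (Gam i x $ i $ j * X x $ j) + c * (Gam i x $ i $ j * W x $ j)))"
    by (simp add: divergence_eq partial_add partial_mult partial_const d assms(3,4)
        differentiable_mult algebra_simps)
  then show ?thesis
    by (simp add: divergence_eq sum.distrib sum_distrib_left algebra_simps)
qed

text \<open>With s = g(X, \<nabla>_X X), the field f X contributes 4 s / m, the derivative of the
  scalar curvature along \<open>X\<close> contributes -2 s / m, and the pairing of Ric with
  \<nabla>X contributes -2 s / m + (a + b). What remains is a + b, half of the squared norm of the
  Lie derivative.\<close>

theorem divergence_lie_up:
  assumes X: "smooth_on X S"
    and eq: "\<And>x. x \<in> S \<Longrightarrow> ricci G x + (1/2) *\<^sub>R lie_metric X G x
        - (1/m) *\<^sub>R tensor_product (dual_form G X x) (dual_form G X x) = lam *\<^sub>R G x"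
    and div: "\<And>x. x \<in> S \<Longrightarrow> divergence G X x = 0"
    and "x \<in> S"
  shows "divergence G (lie_up X) x
    = (1/2) * trace (H x ** lie_metric X G x ** H x ** lie_metric X G x)"
proof -
  define N where "N = covariant_derivative G X"
  define q where "q = (\<lambda>y. X y \<bullet> (G y *v X y))"
  have trN: "trace (N y) = 0" if "y \<in> S" for y
    using div[OF that] by (simp add: N_def divergence_def)
  have L: "lie_metric X G y = G y ** N y + transpose (G y ** N y)" if "y \<in> S" for y
    using lie_metric_eq[OF that] by (simp add: N_def)
  have ric: "ricci G y = lam *\<^sub>R G y + (1/m) *\<^sub>R tensor_product (G y *v X y) (G y *v X y)
      - (1/2) *\<^sub>R lie_metric X G y" if "y \<in> S" for y
    using eq[OF that] by (simp add: dual_form_eq algebra_simps)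
  have HGX: "H y *v (G y *v X y) = X y" if "y \<in> S" for y
    by (simp add: matrix_vector_mul_assoc HG that)
  \<comment> \<open>The transpose of \<open>Ric_up\<close> is the Ricci endomorphism
    \<open>H y ** ricci G y\<close>, once the symmetry of \<open>ricci\<close> has been read off
    from the equation; multiplying the equation by \<open>H y\<close> then computes it.\<close>
  have At: "transpose (Ric_up y) = lam *\<^sub>R mat 1 + (1/m) *\<^sub>R tensor_product (X y) (G y *v X y)
      - (1/2) *\<^sub>R (H y ** lie_metric X G y)" if "y \<in> S" for y
  proof -
    have "transpose (ricci G y) = ricci G y"
      by (simp add: ric that transpose_add transpose_diff transpose_scalar sym_G
          transpose_tensor_product transpose_lie_metric)
    then have "transpose (Ric_up y) = H y ** ricci G y"
      by (simp add: Ric_up_def matrix_transpose_mul sym_H that)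
    then show ?thesis
      by (simp add: ric that matrix_ring_simps HG matrix_mult_tensor_product HGX)
  qed
  have HL: "H y ** lie_metric X G y = N y + H y ** transpose (N y) ** G y" if "y \<in> S" for y
    by (simp add: L that matrix_add_ldistrib matrix_mul_assoc HG matrix_transpose_mul sym_G)
  have tr2: "trace (H y ** transpose (N y) ** G y ** B) = trace (transpose (N y) ** (G y ** B ** H y))"
    for y B by (metis trace_mul_sym matrix_mul_assoc)
  have trA: "trace (Ric_up y) = lam * real CARD('n) + (1/m) * q y" if "y \<in> S" for y
  proof -
    have "trace (H y ** transpose (N y) ** G y) = 0"
      using tr2[of y "mat 1"] by (simp add: GH that trace_transpose trN)
    then show ?thesis
      using arg_cong[OF At[OF that], of trace]
      by (simp add: trace_transpose trace_add trace_sub trace_scaleR trace_I trace_tensor_product HL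
          that trN q_def)
  qed
  have smq: "smooth_on q S"
    unfolding q_def inner_vec_def
    by (simp, intro smooth_on_sum smooth_on_mult open_S smooth_on_vec_nth[OF open_S]
        smooth_on_matrix_vector_mult smooth_G X)
  have smW: "smooth_on (\<lambda>y. transpose (Ric_up y) *v X y) S"
    by (intro smooth_on_matrix_vector_mult smooth_on_transpose open_S smooth_Ric_up X)
  \<comment> \<open>The coefficient of \<open>X\<close> when the equation, applied to
    \<open>X\<close>, is solved for \<open>lie_up X\<close>.\<close>
  define f where "f = (\<lambda>y. 2 * lam + (2/m) * q y)"
  have smf: "smooth_on f S"
    unfolding f_def by (intro smooth_on_add smooth_on_mult smooth_on_const open_S smq)
  have V: "lie_up X y = f y *\<^sub>R X y + (-2) *\<^sub>R (transpose (Ric_up y) *v X y)" if "y \<in> S" for y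
  proof -
    have "transpose (Ric_up y) *v X y = lam *\<^sub>R X y + (1/m) *\<^sub>R (q y *\<^sub>R X y) - (1/2) *\<^sub>R lie_up X y"
      unfolding At[OF that] lie_up_def
      by (simp add: matrix_vector_mult_add_rdistrib matrix_vector_mult_diff_rdistrib
          scaleR_matrix_vector_assoc[symmetric] tensor_product_mult_vector q_def inner_commute
          matrix_vector_mul_assoc)
    then show ?thesis unfolding f_def by (simp only:) (simp add: algebra_simps)
  qed
  define s where "s = (G x *v X x) \<bullet> (N x *v X x)"
  have Xq: "(\<Sum>p\<in>UNIV. X x $ p * partial p q x) = 2 * s"
  proof -
    have "(\<Sum>p\<in>UNIV. X x $ p * partial p q x) = 2 * (X x \<bullet> (transpose (N x) *v (G x *v X x)))"
      unfolding q_def partial_norm_sq[OF \<open>x \<in> S\<close> X]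
      by (simp add: N_def inner_vec_def sum_distrib_left mult_ac)
    also have "X x \<bullet> (transpose (N x) *v (G x *v X x)) = s"
      unfolding s_def by (metis dot_lmul_matrix inner_commute transpose_matrix_vector)
    finally show ?thesis .
  qed
  have dq: "q differentiable (at x)" using smooth_onD(1)[OF smq \<open>x \<in> S\<close>] .
  have Xf: "(\<Sum>p\<in>UNIV. X x $ p * partial p f x) = (2/m) * (2 * s)"
    unfolding Xq[symmetric] f_def partial_affine[OF dq] by (simp add: sum_distrib_left mult_ac)
  have XA: "(\<Sum>p\<in>UNIV. X x $ p * partial p (\<lambda>y. trace (Ric_up y)) x) = (1/m) * (2 * s)"
  proof -
    have "partial p (\<lambda>y. lam * real CARD('n) + (1/m) * q y) x = partial p (\<lambda>y. trace (Ric_up y)) x" for p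
      by (rule partial_cong[OF _ open_S \<open>x \<in> S\<close>])
        (intro differentiable_add differentiable_mult differentiable_const dq, simp only: trA)
    then have "partial p (\<lambda>y. trace (Ric_up y)) x = (1/m) * partial p q x" for p
      by (simp only: partial_affine[OF dq])
    then show ?thesis unfolding Xq[symmetric] by (simp add: sum_distrib_left mult_ac)
  qed
  \<comment> \<open>Let N' denote the adjoint \<open>H x ** transpose (N x) ** G x\<close> of N. By
    \<open>HL\<close> the Lie derivative with one index raised is N + N', so its squared norm is
    tr((N + N')^2) = 2 (a + b) with a = tr(N N) = tr(N' N') and b = tr(N' N).\<close>
  define a where "a = trace (N x ** N x)"
  define b where "b = trace (H x ** transpose (N x) ** G x ** N x)"
  have trAN: "trace (transpose (Ric_up x) ** N x) = (1/m) * s - (1/2) * (a + b)"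
    unfolding At[OF \<open>x \<in> S\<close>]
    by (simp add: matrix_ring_simps trace_add trace_sub trace_scaleR trN \<open>x \<in> S\<close> HL a_def b_def
        tensor_product_matrix_mult trace_tensor_product)
      (metis s_def dot_lmul_matrix inner_commute transpose_matrix_vector)
  have LL: "trace (H x ** lie_metric X G x ** H x ** lie_metric X G x) = 2 * (a + b)"
  proof -
    have "trace (H x ** lie_metric X G x ** H x ** lie_metric X G x)
        = trace ((N x + H x ** transpose (N x) ** G x) ** (N x + H x ** transpose (N x) ** G x))"
      by (simp add: HL[OF \<open>x \<in> S\<close>, symmetric] matrix_mul_assoc)
    also have "\<dots> = a + trace (N x ** (H x ** transpose (N x) ** G x)) + b
        + trace (H x ** transpose (N x) ** G x ** (H x ** transpose (N x) ** G x))"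
      by (simp add: matrix_add_ldistrib matrix_add_rdistrib trace_add a_def b_def matrix_mul_assoc)
    also have "trace (N x ** (H x ** transpose (N x) ** G x)) = b"
      unfolding b_def by (rule trace_mul_sym)
    also have "trace (H x ** transpose (N x) ** G x ** (H x ** transpose (N x) ** G x))
        = trace (transpose (N x) ** ((G x ** H x) ** transpose (N x) ** (G x ** H x)))"
      unfolding tr2 by (simp add: matrix_mul_assoc)
    also have "\<dots> = trace (transpose (N x ** N x))"
      by (simp add: GH \<open>x \<in> S\<close> matrix_transpose_mul)
    also have "\<dots> = a" by (simp only: trace_transpose a_def)
    finally show ?thesis by simp
  qed
  have "divergence G (lie_up X) x
      = divergence G (\<lambda>y. f y *\<^sub>R X y + (-2) *\<^sub>R (transpose (Ric_up y) *v X y)) x"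
    by (rule divergence_cong[OF \<open>x \<in> S\<close> smooth_lie_up[OF X] V])
  also have "\<dots> = (2/m) * (2 * s) - 2 * ((1/2) * ((1/m) * (2 * s)) + ((1/m) * s - (1/2) * (a + b)))"
    unfolding divergence_combination[OF \<open>x \<in> S\<close> smf X smW] divergence_Ric_up[OF \<open>x \<in> S\<close> X] Xf XA
      trAN[unfolded N_def] div[OF \<open>x \<in> S\<close>] by simp
  also have "\<dots> = (1/2) * trace (H x ** lie_metric X G x ** H x ** lie_metric X G x)"
    unfolding LL by (simp add: algebra_simps)
  finally show ?thesis .
qed

end

section \<open>Integration by parts and change of variables\<close>

lemma integrable_continuous_compact_support:
  fixes f :: "'v::euclidean_space \<Rightarrow> real"
  assumes "continuous_on S f" "compact K" "K \<subseteq> S" "\<And>x. x \<in> S - K \<Longrightarrow> f x = 0"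
  shows "set_integrable lborel S f"
proof -
  have "indicator K x *\<^sub>R f x = indicator S x *\<^sub>R f x" for x
    using assms(3,4) by (auto simp: indicator_def)
  then show ?thesis
    using borel_integrable_compact[OF assms(2) continuous_on_subset[OF assms(1,3)]]
    by (simp only: set_integrable_def)
qed

text \<open>By translation invariance of Lebesgue measure every difference quotient of
  \<open>F\<close> in direction \<open>e\<close> has integral 0; dominated convergence passes this
  on to the derivative.\<close>

lemma integral_derivative_compact_support:
  fixes F :: "'v::euclidean_space \<Rightarrow> real"
  assumes F: "Ck_on 1 F UNIV" and "compact K" and 0: "\<And>x. x \<notin> K \<Longrightarrow> F x = 0"
  shows "(\<integral>x. frechet_derivative F (at x) e \<partial>lborel) = 0"
proof -
  define D where "D = (\<lambda>x. frechet_derivative F (at x) e)"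
  have diff: "F differentiable (at x)" for x using F by simp
  have contD: "continuous_on UNIV D" using F by (simp add: D_def)
  have contF: "continuous_on UNIV F" using Ck_on_mono[OF F, of 0] by simp
  obtain R where R: "\<And>x. x \<in> K \<Longrightarrow> norm x \<le> R"
    using compact_imp_bounded[OF \<open>compact K\<close>] by (auto simp: bounded_iff)
  have D0: "D x = 0" if "x \<notin> K" for x
  proof -
    have "open (- K)" using \<open>compact K\<close> by (simp add: compact_imp_closed open_Compl)
    from frechet_derivative_transform_within_open[OF diff this, of x "\<lambda>_. 0"] that 0
    show ?thesis by (simp add: D_def)
  qed
  have "bounded (D ` K)"
    by (intro compact_imp_bounded compact_continuous_image continuous_on_subset[OF contD]
        \<open>compact K\<close>) auto
  then obtain B where "\<And>x. x \<in> K \<Longrightarrow> \<bar>D x\<bar> \<le> B" by (auto simp: bounded_iff)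
  then have B: "\<bar>D x\<bar> \<le> max B 0" for x using D0[of x] by (cases "x \<in> K") force+
  define q where "q n x = real (Suc n) * (F (x + (1 / real (Suc n)) *\<^sub>R e) - F x)" for n x
  \<comment> \<open>The dominating function. By the mean value theorem \<open>q n x\<close> is a
    value of \<open>D\<close> at a point less than \<open>norm e\<close> away from \<open>x\<close>
    (or at \<open>x\<close> itself if \<open>e\<close> is 0), so it vanishes outside this ball. The
    bound \<open>B\<close> may be negative if \<open>K\<close> is empty, hence the
    \<open>max\<close>.\<close>
  define w where "w = (\<lambda>x::'v. indicator (cball 0 (R + norm e)) x *\<^sub>R max B 0)"
  have mv: "\<exists>s. 0 < s \<and> s < 1 / real (Suc n) \<and> q n x = D (x + s *\<^sub>R e)" for n x
  proof -
    have "\<exists>s>0. s < 1 / real (Suc n) \<and> F (x + (1 / real (Suc n)) *\<^sub>R e) - F (x + 0 *\<^sub>R e)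
        = (1 / real (Suc n) - 0) * D (x + s *\<^sub>R e)"
      unfolding D_def by (rule MVT2) (auto intro: has_real_derivative_along_line diff)
    then show ?thesis by (auto simp: q_def field_simps)
  qed
  have bound: "norm (q n x) \<le> w x" for n x
  proof (cases "x \<in> cball 0 (R + norm e)")
    case True
    then show ?thesis using mv[of n x] B by (auto simp: w_def)
  next
    case False
    obtain s where s: "0 < s" "s < 1 / real (Suc n)" "q n x = D (x + s *\<^sub>R e)" using mv by blast
    have "1 / real (Suc n) \<le> 1" by simp
    then have "s < 1" using s(2) by linarith
    have "x + s *\<^sub>R e \<notin> K"
    proof
      assume "x + s *\<^sub>R e \<in> K"
      have "norm x \<le> norm (x + s *\<^sub>R e) + norm (s *\<^sub>R e)"
        using norm_triangle_ineq4[of "x + s *\<^sub>R e" "s *\<^sub>R e"] by simp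
      also have "\<dots> \<le> R + norm e"
        using R[OF \<open>x + s *\<^sub>R e \<in> K\<close>] s(1) \<open>s < 1\<close> mult_right_mono[of s 1 "norm e"] by simp
      finally show False using False by simp
    qed
    then show ?thesis using D0 s(3) False by (simp add: w_def)
  qed
  have "integrable lborel F"
    using integrable_continuous_compact_support[OF contF \<open>compact K\<close>] 0
    by (simp add: set_integrable_def)
  have shift: "integrable lborel (\<lambda>x. F (x + c)) \<and> (\<integral>x. F (x + c) \<partial>lborel) = (\<integral>x. F x \<partial>lborel)" for c
  proof -
    have m: "(+) c \<in> measurable lborel borel" and "F \<in> borel_measurable borel"
      using contF by (auto intro: borel_measurable_continuous_onI)
    then show ?thesis
      using integrable_distr_eq[OF m, of F] integral_distr[OF m, of F] \<open>integrable lborel F\<close>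
      by (simp add: lborel_distr_plus add.commute)
  qed
  have "(\<integral>x. q n x \<partial>lborel) = 0" for n
    using shift \<open>integrable lborel F\<close> by (simp add: q_def)
  moreover have "(\<lambda>n. \<integral>x. q n x \<partial>lborel) \<longlonglongrightarrow> (\<integral>x. D x \<partial>lborel)"
  proof (rule integral_dominated_convergence[where w = w])
    show "D \<in> borel_measurable lborel" using contD by (auto intro: borel_measurable_continuous_onI)
    show "q n \<in> borel_measurable lborel" for n
      unfolding q_def[abs_def] measurable_lborel2
      by (intro borel_measurable_continuous_onI continuous_intros
          continuous_on_compose2[OF contF]) auto
    show "integrable lborel w"
      unfolding w_def by (rule borel_integrable_compact) auto
    show "AE x in lborel. norm (q n x) \<le> w x" for n using bound by simp
    show "AE x in lborel. (\<lambda>n. q n x) \<longlonglongrightarrow> D x"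
    proof (rule AE_I2)
      fix x
      obtain s where s: "\<And>n. 0 < s n" "\<And>n. s n < 1 / real (Suc n)" "\<And>n. q n x = D (x + s n *\<^sub>R e)"
        using mv[of _ x] by metis
      have "s \<longlonglongrightarrow> 0"
        using LIMSEQ_inverse_real_of_nat s(1,2)
        by (intro tendsto_sandwich[of "\<lambda>_. 0" s sequentially "\<lambda>n. 1 / real (Suc n)"])
          (auto simp: inverse_eq_divide less_imp_le)
      then have "(\<lambda>n. x + s n *\<^sub>R e) \<longlonglongrightarrow> x + 0 *\<^sub>R e" by (intro tendsto_intros)
      then have "(\<lambda>n. D (x + s n *\<^sub>R e)) \<longlonglongrightarrow> D (x + 0 *\<^sub>R e)"
        using contD by (intro isCont_tendsto_compose[of _ D]) (auto simp: continuous_on_eq_continuous_at)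
      then show "(\<lambda>n. q n x) \<longlonglongrightarrow> D x" by (simp add: s(3))
    qed
  qed
  ultimately show ?thesis by (simp add: D_def LIMSEQ_const_iff)
qed

text \<open>Extended by zero, \<open>F\<close> is of class C^1 on each of the open sets
  \<open>S\<close> and \<open>- K\<close>, which together cover the whole space.\<close>

lemma set_integral_partial_compact_support:
  fixes F :: "real^'n::finite \<Rightarrow> real"
  assumes F: "Ck_on 1 F S" and "open S" "compact K" "K \<subseteq> S" and 0: "\<And>x. x \<in> S - K \<Longrightarrow> F x = 0"
  shows "set_integrable lborel S (partial i F)" "(LINT x:S|lborel. partial i F x) = 0"
proof -
  define F0 where "F0 = (\<lambda>x. if x \<in> S then F x else 0)"
  have "closed K" using \<open>compact K\<close> by (rule compact_imp_closed)
  have F0: "F0 x = 0" if "x \<notin> K" for x using 0 that by (simp add: F0_def)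
  have S1: "Ck_on 1 F0 S" by (rule Ck_on_cong[OF \<open>open S\<close> _ F]) (simp add: F0_def)
  have "Ck_on 1 F0 (- K)"
    using \<open>closed K\<close> by (intro Ck_on_cong[OF _ _ Ck_on_const[of _ _ 0]]) (auto simp: F0)
  then have 1: "Ck_on 1 F0 UNIV"
    using S1 \<open>open S\<close> \<open>closed K\<close> \<open>K \<subseteq> S\<close> by (intro Ck_on_local) blast
  have eq: "partial i F x = partial i F0 x" if "x \<in> S" for x
    using F that by (intro partial_cong[OF _ \<open>open S\<close>]) (auto simp: F0_def)
  have out: "partial i F0 x = 0" if "x \<notin> K" for x
  proof -
    have "partial i (\<lambda>_. 0) x = partial i F0 x"
      by (rule partial_cong[of _ _ "- K"]) (use that F0 \<open>closed K\<close> in auto)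
    then show ?thesis by (simp add: partial_const)
  qed
  have ind: "(\<lambda>x. indicator S x *\<^sub>R partial i F x) = partial i F0"
    using eq out \<open>K \<subseteq> S\<close> by (force simp: indicator_def fun_eq_iff)
  have "continuous_on UNIV (partial i F0)" using 1 by (simp add: partial_def[abs_def])
  then have "set_integrable lborel UNIV (partial i F0)"
    by (rule integrable_continuous_compact_support[OF _ \<open>compact K\<close>]) (auto simp: out)
  then have "integrable lborel (partial i F0)" by (simp add: set_integrable_def)
  then show "set_integrable lborel S (partial i F)"
    by (simp only: set_integrable_def ind)
  have "(\<integral>x. partial i F0 x \<partial>lborel) = 0"
    unfolding partial_def
    by (rule integral_derivative_compact_support[OF 1 \<open>compact K\<close> F0])
  then show "(LINT x:S|lborel. partial i F x) = 0"
    by (simp only: set_lebesgue_integral_def ind)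
qed

text \<open>The points of \<open>S\<close> where \<open>f\<close> is nonzero form an open null set,
  and such a set is empty.\<close>

lemma nonneg_integral_zero_imp_zero:
  fixes f :: "'v::euclidean_space \<Rightarrow> real"
  assumes "open S" "continuous_on S f" "\<And>x. x \<in> S \<Longrightarrow> 0 \<le> f x"
    "set_integrable lborel S f" "(LINT x:S|lborel. f x) = 0" "x \<in> S"
  shows "f x = 0"
proof -
  define N where "N = {x \<in> S. f x \<noteq> 0}"
  have "N = S \<inter> f -` (- {0})" by (auto simp: N_def)
  then have "open N" using continuous_open_preimage[OF assms(2,1) open_Compl[OF closed_singleton]] by simp
  have "AE x in lborel. indicator S x *\<^sub>R f x = 0"
    using assms(3,4,5) integral_nonneg_eq_0_iff_AE[of lborel "\<lambda>x. indicator S x *\<^sub>R f x"]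
    by (simp add: set_integrable_def set_lebesgue_integral_def indicator_def)
  then have "AE x in lborel. x \<notin> N"
    by eventually_elim (auto simp: N_def)
  then have "N \<in> null_sets lborel"
    using \<open>open N\<close> AE_iff_null_sets[of N lborel] by simp
  then have "negligible N" by (simp add: negligible_iff_null_sets null_sets_completionI)
  then have "N = {}" using \<open>open N\<close> open_not_negligible by blast
  then show ?thesis using \<open>x \<in> S\<close> by (auto simp: N_def)
qed

lemma set_integral_sum:
  fixes f :: "'i \<Rightarrow> 'b \<Rightarrow> real"
  assumes "\<And>i. i \<in> I \<Longrightarrow> set_integrable M S (f i)"
  shows "set_integrable M S (\<lambda>x. \<Sum>i\<in>I. f i x)"
    and "(LINT x:S|M. \<Sum>i\<in>I. f i x) = (\<Sum>i\<in>I. LINT x:S|M. f i x)"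
  using assms unfolding set_integrable_def set_lebesgue_integral_def scaleR_sum_right
  by (simp_all add: Bochner_Integration.integrable_sum Bochner_Integration.integral_sum)

lemma set_integral_restrict:
  fixes f :: "'b \<Rightarrow> real"
  assumes "T \<subseteq> S" "\<And>x. x \<in> S - T \<Longrightarrow> f x = 0"
  shows "set_integrable M S f \<longleftrightarrow> set_integrable M T f" "(LINT x:S|M. f x) = (LINT x:T|M. f x)"
proof -
  have "(\<lambda>x. indicator S x *\<^sub>R f x) = (\<lambda>x. indicator T x *\<^sub>R f x)"
    using assms by (auto simp: indicator_def fun_eq_iff)
  then show "set_integrable M S f \<longleftrightarrow> set_integrable M T f" "(LINT x:S|M. f x) = (LINT x:T|M. f x)"
    by (simp_all only: set_integrable_def set_lebesgue_integral_def)
qed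

text \<open>Carries the change of variables for absolutely integrable maps into real^1 over to real
  functions and \<open>lborel\<close>. Continuity of \<open>f\<close> on an open set gives the Borel
  measurability that leads back from the completed measure.\<close>

lemma change_of_variables_wellorder:
  fixes T :: "real^'m::{finite,wellorder} \<Rightarrow> real^'m::_" and f :: "real^'m::_ \<Rightarrow> real"
  assumes "open S" "open (T ` S)" "inj_on T S"
    and T: "\<And>x. x \<in> S \<Longrightarrow> (T has_derivative T' x) (at x)"
    and f: "continuous_on (T ` S) f"
    and int: "set_integrable lborel S (\<lambda>x. \<bar>det (matrix (T' x))\<bar> * f (T x))"
  shows "set_integrable lborel (T ` S) f \<and>
    (LINT y:T ` S|lborel. f y) = (LINT x:S|lborel. \<bar>det (matrix (T' x))\<bar> * f (T x))"
proof -
  let ?h = "\<lambda>x. \<bar>det (matrix (T' x))\<bar> * f (T x)"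
  have "S \<in> sets lebesgue" using \<open>open S\<close> by (simp add: borel_open)
  note cov = has_absolute_integral_change_of_variables[OF \<open>S \<in> sets lebesgue\<close>
      has_derivative_at_withinI[OF T] \<open>inj_on T S\<close>, of "\<lambda>y. vec (f y) :: real^1",
      unfolded absolutely_integrable_on_1_iff integral_on_1_eq]
  have "?h absolutely_integrable_on S"
    using int borel_measurable_integrable[of lborel] integrable_completion[of _ lborel]
    unfolding set_integrable_def by blast
  then have f_int: "f absolutely_integrable_on T ` S" and eq: "integral (T ` S) f = integral S ?h"
    using cov[of "vec (integral S ?h)"] by (simp_all add: vec_eq_iff)
  have "(\<lambda>y. indicator (T ` S) y *\<^sub>R f y) \<in> borel_measurable borel"
    using f \<open>open (T ` S)\<close> by (intro borel_measurable_continuous_on_indicator) (auto simp: borel_open)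
  then have *: "set_integrable lborel (T ` S) f"
    using f_int integrable_completion[of "\<lambda>y. indicator (T ` S) y *\<^sub>R f y" lborel]
    by (simp add: set_integrable_def)
  then show ?thesis
    using eq by (simp add: set_borel_integral_eq_integral(2)[OF *] set_borel_integral_eq_integral(2)[OF int])
qed

text \<open>The library's change of variables theorem is only available for index types of class
  \<open>wellorder\<close>. A well-ordered copy of an arbitrary finite index type removes this restriction.\<close>

typedef ('n::finite) idx = "{..<CARD('n)}" by (rule exI[of _ 0]) simp

instantiation idx :: (finite) wellorder
begin

definition less_eq_idx :: "'a idx \<Rightarrow> 'a idx \<Rightarrow> bool" where
  "less_eq_idx a b \<longleftrightarrow> Rep_idx a \<le> Rep_idx b"

definition less_idx :: "'a idx \<Rightarrow> 'a idx \<Rightarrow> bool" where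
  "less_idx a b \<longleftrightarrow> Rep_idx a < Rep_idx b"

instance
proof
  fix x y z :: "'a idx" and P :: "'a idx \<Rightarrow> bool"
  show "x < y \<longleftrightarrow> x \<le> y \<and> \<not> y \<le> x" "x \<le> x" "x \<le> y \<or> y \<le> x"
    by (auto simp: less_eq_idx_def less_idx_def)
  show "x \<le> y \<Longrightarrow> y \<le> z \<Longrightarrow> x \<le> z" by (simp add: less_eq_idx_def)
  show "x \<le> y \<Longrightarrow> y \<le> x \<Longrightarrow> x = y" by (simp add: less_eq_idx_def flip: Rep_idx_inject)
  assume step: "\<And>x. (\<And>y. y < x \<Longrightarrow> P y) \<Longrightarrow> P x"
  show "P x"
    by (rule measure_induct_rule[of Rep_idx P]) (rule step, simp add: less_idx_def)
qed

end

lemma bij_betw_Rep_idx: "bij_betw Rep_idx (UNIV :: 'n::finite idx set) {..<CARD('n)}"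
  using type_definition.Rep_range[OF type_definition_idx] Rep_idx_inject
  by (auto simp: bij_betw_def inj_on_def)

instance idx :: (finite) finite
  by standard (metis bij_betw_Rep_idx bij_betw_finite finite_lessThan)

lemma idx_bij_exists: "\<exists>\<pi> :: 'n::finite idx \<Rightarrow> 'n. bij \<pi>"
  using bij_betw_same_card[OF bij_betw_Rep_idx[where 'n = 'n]]
    finite_same_card_bij[of "UNIV :: 'n idx set" "UNIV :: 'n set"]
  by simp

definition reindex :: "('m \<Rightarrow> 'n) \<Rightarrow> real^'n \<Rightarrow> real^'m" where
  "reindex \<pi> x = (\<chi> i. x $ \<pi> i)"

lemma linear_reindex: "linear (reindex \<pi>)"
  by (auto intro!: linearI simp: reindex_def vec_eq_iff)

lemma reindex_inverse:
  assumes "bij \<pi>"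
  shows "reindex \<pi> (reindex (inv \<pi>) u) = u" "reindex (inv \<pi>) (reindex \<pi> x) = x"
  using assms by (auto simp: reindex_def bij_is_inj bij_is_surj surj_f_inv_f inv_f_f)

lemma continuous_reindex: "continuous_on S (reindex (\<pi> :: 'm::finite \<Rightarrow> 'n::finite))"
  by (rule linear_continuous_on[OF linear_conv_bounded_linear[THEN iffD1, OF linear_reindex]])

lemma open_reindex:
  fixes \<pi> :: "'m::finite \<Rightarrow> 'n::finite"
  assumes "bij \<pi>" "open S"
  shows "open (reindex \<pi> ` S)"
proof -
  have "reindex \<pi> ` S = reindex (inv \<pi>) -` S"
    using reindex_inverse[OF assms(1)] by (auto simp: image_iff) metis
  then show ?thesis
    using open_vimage[OF assms(2) continuous_reindex] by simp
qed

lemma prod_Basis_cart: "(\<Prod>b\<in>Basis. (x :: real^'n::finite) \<bullet> b) = (\<Prod>i\<in>UNIV. x $ i)"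
  by (simp add: Basis_vec_def cart_eq_inner_axis axis_eq_axis prod.UNION_disjoint)

text \<open>Boxes determine Lebesgue measure, and renaming coordinates permutes the side lengths of
  a box.\<close>

lemma distr_reindex:
  fixes \<pi> :: "'m::finite \<Rightarrow> 'n::finite"
  assumes "bij \<pi>"
  shows "distr lborel borel (reindex \<pi>) = lborel"
proof (rule lborel_eqI[symmetric])
  fix l u :: "real^'m"
  assume le: "\<And>b. b \<in> Basis \<Longrightarrow> l \<bullet> b \<le> u \<bullet> b"
  have "l $ i \<le> u $ i" for i
    using le[of "axis i 1"] by (simp add: axis_in_Basis_iff cart_eq_inner_axis)
  then have le': "reindex (inv \<pi>) l \<bullet> b \<le> reindex (inv \<pi>) u \<bullet> b" if "b \<in> Basis" for b
    using that by (auto simp: Basis_vec_def inner_axis reindex_def)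
  have "reindex \<pi> -` box l u = box (reindex (inv \<pi>) l) (reindex (inv \<pi>) u)"
    using assms by (auto simp: mem_box_cart reindex_def)
      (metis bij_inv_eq_iff, metis bij_inv_eq_iff, metis bij_is_inj inv_f_f, metis bij_is_inj inv_f_f)
  moreover have "reindex \<pi> \<in> measurable lborel borel"
    using continuous_reindex by (auto intro: borel_measurable_continuous_onI)
  ultimately have "emeasure (distr lborel borel (reindex \<pi>)) (box l u)
      = (\<Prod>b\<in>Basis. (reindex (inv \<pi>) u - reindex (inv \<pi>) l) \<bullet> b)"
    using le' by (simp add: emeasure_distr)
  also have "\<dots> = (\<Prod>b\<in>Basis. (u - l) \<bullet> b)"
    unfolding prod_Basis_cart
    using assms by (subst prod.reindex_bij_betw[OF assms, symmetric])
      (simp add: reindex_def bij_is_inj inv_f_f)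
  finally show "emeasure (distr lborel borel (reindex \<pi>)) (box l u) = (\<Prod>b\<in>Basis. (u - l) \<bullet> b)" .
qed simp

lemma set_integral_reindex:
  fixes \<pi> :: "'m::finite \<Rightarrow> 'n::finite" and h :: "real^'n \<Rightarrow> real"
  assumes "bij \<pi>" and h: "(\<lambda>x. indicator S x *\<^sub>R h x) \<in> borel_measurable borel"
  shows "set_integrable lborel (reindex \<pi> ` S) (\<lambda>u. h (reindex (inv \<pi>) u)) \<longleftrightarrow> set_integrable lborel S h"
    and "(LINT u:reindex \<pi> ` S|lborel. h (reindex (inv \<pi>) u)) = (LINT x:S|lborel. h x)"
proof -
  let ?f = "\<lambda>x. indicator S x *\<^sub>R h x"
  have ind: "indicator (reindex \<pi> ` S) u = (indicator S (reindex (inv \<pi>) u) :: real)" for u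
    using reindex_inverse[OF assms(1)] by (auto simp: indicator_def image_iff) metis
  have "(\<lambda>u. ?f (reindex (inv \<pi>) u)) \<in> borel_measurable borel"
    using h continuous_reindex by (intro measurable_compose[OF _ h]) (auto intro: borel_measurable_continuous_onI)
  moreover have "reindex \<pi> \<in> measurable lborel borel"
    using continuous_reindex by (auto intro: borel_measurable_continuous_onI)
  ultimately have "integrable lborel (\<lambda>u. ?f (reindex (inv \<pi>) u)) \<longleftrightarrow> integrable lborel ?f"
    "(\<integral>u. ?f (reindex (inv \<pi>) u) \<partial>lborel) = (\<integral>x. ?f x \<partial>lborel)"
    using integrable_distr_eq[of "reindex \<pi>" lborel borel "\<lambda>u. ?f (reindex (inv \<pi>) u)"]
      integral_distr[of "reindex \<pi>" lborel borel "\<lambda>u. ?f (reindex (inv \<pi>) u)"]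
    by (simp_all add: distr_reindex assms(1) reindex_inverse)
  then show "set_integrable lborel (reindex \<pi> ` S) (\<lambda>u. h (reindex (inv \<pi>) u)) \<longleftrightarrow> set_integrable lborel S h"
    "(LINT u:reindex \<pi> ` S|lborel. h (reindex (inv \<pi>) u)) = (LINT x:S|lborel. h x)"
    by (simp_all add: set_integrable_def set_lebesgue_integral_def ind)
qed

text \<open>Conjugation by \<pi> matches the permutations of the two index types and preserves
  signs, so it matches the two Leibniz sums term by term.\<close>

lemma det_reindex:
  fixes \<pi> :: "'m::finite \<Rightarrow> 'n::finite" and B :: "real^'n^'n"
  assumes "bij \<pi>"
  shows "det (\<chi> i j. B $ \<pi> i $ \<pi> j) = det B"
proof -
  let ?c = "\<lambda>p. \<pi> \<circ> p \<circ> inv \<pi>"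
  have c: "map_permutation UNIV \<pi> p = ?c p" for p
    using assms by (simp add: map_permutation_def restrict_id_def bij_is_surj fun_eq_iff)
  have perm: "?c p permutes UNIV" if "p permutes UNIV" for p
    using map_permutation_permutes[OF assms that] by (simp add: c)
  have inv: "inv \<pi> (\<pi> a) = a" "\<pi> (inv \<pi> b) = b" for a b
    using assms by (simp_all add: bij_is_inj inv_f_f bij_is_surj surj_f_inv_f)
  have perm': "inv \<pi> \<circ> q \<circ> \<pi> permutes UNIV" if "q permutes UNIV" for q
    using bij_comp[OF assms bij_comp[OF permutes_bij[OF that] bij_imp_bij_inv[OF assms]]]
    by (intro bij_imp_permutes) (simp_all add: comp_assoc)
  have "det (\<chi> i j. B $ \<pi> i $ \<pi> j)
      = (\<Sum>p | p permutes UNIV. of_int (sign p) * (\<Prod>i\<in>UNIV. B $ \<pi> i $ \<pi> (p i)))"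
    by (simp add: det_def)
  also have "\<dots> = (\<Sum>p | p permutes UNIV. of_int (sign (?c p)) * (\<Prod>k\<in>UNIV. B $ k $ (?c p) k))"
  proof (rule sum.cong[OF refl])
    fix p :: "'m \<Rightarrow> 'm" assume "p \<in> {p. p permutes UNIV}"
    then have "sign (?c p) = sign p"
      using sign_map_permutation[of \<pi> UNIV p] assms by (simp add: c bij_is_inj)
    moreover have "(\<Prod>i\<in>UNIV. B $ \<pi> i $ \<pi> (p i)) = (\<Prod>k\<in>UNIV. B $ k $ (?c p) k)"
      by (subst prod.reindex_bij_betw[OF assms, symmetric]) (simp add: inv)
    ultimately show "of_int (sign p) * (\<Prod>i\<in>UNIV. B $ \<pi> i $ \<pi> (p i))
      = of_int (sign (?c p)) * (\<Prod>k\<in>UNIV. B $ k $ (?c p) k)" by simp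
  qed
  also have "\<dots> = (\<Sum>q | q permutes UNIV. of_int (sign q) * (\<Prod>k\<in>UNIV. B $ k $ q k))"
    by (rule sum.reindex_bij_witness[of _ "\<lambda>q. inv \<pi> \<circ> q \<circ> \<pi>" ?c])
      (use perm perm' in \<open>auto simp: fun_eq_iff inv\<close>)
  finally show ?thesis by (simp add: det_def)
qed

text \<open>Conjugating \<open>T\<close> by a renaming of coordinates leaves integrals and Jacobian
  determinants unchanged and brings the map to the index type \<open>idx\<close>.\<close>

lemma change_of_variables:
  fixes T :: "real^'n::finite \<Rightarrow> real^'n" and f :: "real^'n \<Rightarrow> real"
  assumes "open S" "open (T ` S)" "inj_on T S"
    and T: "\<And>x. x \<in> S \<Longrightarrow> (T has_derivative T' x) (at x)"
    and f: "continuous_on (T ` S) f"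
    and int: "set_integrable lborel S (\<lambda>x. \<bar>det (matrix (T' x))\<bar> * f (T x))"
  shows "set_integrable lborel (T ` S) f"
    and "(LINT y:T ` S|lborel. f y) = (LINT x:S|lborel. \<bar>det (matrix (T' x))\<bar> * f (T x))"
proof -
  obtain \<pi> :: "'n idx \<Rightarrow> 'n" where \<pi>: "bij \<pi>" using idx_bij_exists by blast
  define R where "R = reindex \<pi>"
  define R' where "R' = reindex (inv \<pi>)"
  have RR: "R (R' u) = u" "R' (R x) = x" for u x
    using reindex_inverse[OF \<pi>] by (auto simp: R_def R'_def)
  let ?T = "\<lambda>u. R (T (R' u))" and ?T' = "\<lambda>u. R \<circ> T' (R' u) \<circ> R'"
  have blR: "bounded_linear R" "bounded_linear R'"
    using linear_reindex linear_conv_bounded_linear unfolding R_def R'_def by blast+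
  have img: "?T ` (R ` S) = R ` (T ` S)" by (simp add: image_image RR)
  have det: "det (matrix (?T' u)) = det (matrix (T' (R' u)))" for u
  proof -
    have ax: "R' (axis j 1) = axis (\<pi> j) 1" for j
    proof -
      have "inv \<pi> k = j \<longleftrightarrow> k = \<pi> j" for k using bij_inv_eq_iff[OF \<pi>, of j k] by auto
      then show ?thesis by (simp add: R'_def reindex_def axis_def vec_eq_iff)
    qed
    have "matrix (?T' u) $ i $ j = matrix (T' (R' u)) $ \<pi> i $ \<pi> j" for i j
      by (simp add: matrix_def ax) (simp add: R_def reindex_def)
    then have "matrix (?T' u) = (\<chi> i j. matrix (T' (R' u)) $ \<pi> i $ \<pi> j)"
      by (simp add: vec_eq_iff)
    then show ?thesis by (simp add: det_reindex[OF \<pi>])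
  qed
  have mint: "(\<lambda>x. indicator S x *\<^sub>R (\<bar>det (matrix (T' x))\<bar> * f (T x))) \<in> borel_measurable borel"
    using borel_measurable_integrable[OF int[unfolded set_integrable_def]] by simp
  have mf: "(\<lambda>y. indicator (T ` S) y *\<^sub>R f y) \<in> borel_measurable borel"
    using f \<open>open (T ` S)\<close> by (intro borel_measurable_continuous_on_indicator) (auto simp: borel_open)
  have "set_integrable lborel (?T ` (R ` S)) (\<lambda>u. f (R' u)) \<and>
    (LINT u:?T ` (R ` S)|lborel. f (R' u))
      = (LINT u:R ` S|lborel. \<bar>det (matrix (?T' u))\<bar> * f (R' (?T u)))"
  proof (rule change_of_variables_wellorder)
    show "open (R ` S)" "open (?T ` (R ` S))"
      unfolding img using open_reindex[OF \<pi>] assms(1,2) by (auto simp: R_def)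
    show "inj_on ?T (R ` S)"
      using assms(3) by (auto simp: inj_on_def RR) (metis RR)
    show "(?T has_derivative ?T' u) (at u)" if "u \<in> R ` S" for u
    proof -
      have "R' u \<in> S" using that by (auto simp: RR)
      from bounded_linear.has_derivative[OF blR(1) has_derivative_compose[OF
          bounded_linear_imp_has_derivative[OF blR(2)] T[OF this]]]
      show ?thesis by (simp add: o_def)
    qed
    show "continuous_on (?T ` (R ` S)) (\<lambda>u. f (R' u))"
      unfolding img
      by (rule continuous_on_compose2[OF f linear_continuous_on[OF blR(2)]]) (auto simp: RR)
    show "set_integrable lborel (R ` S) (\<lambda>u. \<bar>det (matrix (?T' u))\<bar> * f (R' (?T u)))"
      using int set_integral_reindex(1)[OF \<pi> mint] unfolding det RR by (simp add: R_def R'_def)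
  qed
  then show "set_integrable lborel (T ` S) f"
    "(LINT y:T ` S|lborel. f y) = (LINT x:S|lborel. \<bar>det (matrix (T' x))\<bar> * f (T x))"
    using set_integral_reindex[OF \<pi> mint] set_integral_reindex[OF \<pi> mf]
    unfolding det RR img by (simp_all add: R_def R'_def)
qed

section \<open>Change of coordinates\<close>

lemma jacobian_nth:
  fixes T :: "real^'n::finite \<Rightarrow> real^'n"
  assumes "T differentiable (at x)"
  shows "jacobian T (at x) $ k $ l = partial l (\<lambda>y. T y $ k) x"
proof -
  have "((\<lambda>y. T y $ k) has_derivative (\<lambda>h. frechet_derivative T (at x) h $ k)) (at x)"
    using assms frechet_derivative_works bounded_linear.has_derivative[OF bounded_linear_vec_nth] by blast
  then show ?thesis
    by (simp add: partial_eqI jacobian_def matrix_def)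
qed

lemma frechet_derivative_jacobian:
  fixes T :: "real^'n::finite \<Rightarrow> real^'n"
  assumes "T differentiable (at x)"
  shows "frechet_derivative T (at x) v = jacobian T (at x) *v v"
  using assms jacobian_works frechet_derivative_at by metis

lemma smooth_on_jacobian:
  fixes T :: "real^'n::finite \<Rightarrow> real^'n"
  assumes "open S" "smooth_on T S"
  shows "smooth_on (\<lambda>x. jacobian T (at x)) S"
  by (rule smooth_on_matrixI[OF assms(1)], rule smooth_on_cong[OF assms(1) jacobian_nth[symmetric]])
    (use assms in \<open>auto intro: smooth_onD(1) smooth_on_partial smooth_on_vec_nth\<close>)

lemma frechet_derivative_compose':
  assumes "T differentiable (at x)" "f differentiable (at (T x))"
  shows "frechet_derivative (\<lambda>y. f (T y)) (at x) v
    = frechet_derivative f (at (T x)) (frechet_derivative T (at x) v)"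
  using frechet_derivative_compose[OF assms] by (simp add: o_def fun_eq_iff)

lemma partial_compose:
  fixes T :: "real^'n::finite \<Rightarrow> real^'n" and f :: "real^'n \<Rightarrow> real"
  assumes "T differentiable (at x)" "f differentiable (at (T x))"
  shows "partial k (\<lambda>y. f (T y)) x = (\<Sum>l\<in>UNIV. jacobian T (at x) $ l $ k * partial l f (T x))"
  unfolding partial_def[of k] frechet_derivative_compose'[OF assms]
  by (simp add: frechet_derivative_jacobian[OF assms(1)] frechet_derivative_eq_partial[OF assms(2)]
      matrix_vector_mul_component inner_axis)

lemma transpose_sum: "transpose (\<Sum>i\<in>I. f i) = (\<Sum>i\<in>I. transpose (f i))"
  for f :: "'i \<Rightarrow> real^'m::finite^'n::finite"
  by (simp add: transpose_def vec_eq_iff)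

lemma matrix_mult_sum_left: "(\<Sum>i\<in>I. f i) ** B = (\<Sum>i\<in>I. f i ** B)"
  for f :: "'i \<Rightarrow> real^'m::finite^'n::finite" and B :: "real^'p::finite^'m"
  by (induction I rule: infinite_finite_induct) (simp_all add: matrix_add_rdistrib)

lemma matrix_mult_sum_right: "B ** (\<Sum>i\<in>I. f i) = (\<Sum>i\<in>I. B ** f i)"
  for f :: "'i \<Rightarrow> real^'m::finite^'n::finite" and B :: "real^'n^'p::finite"
  by (induction I rule: infinite_finite_induct) (simp_all add: matrix_add_ldistrib)

section \<open>Naturality of the Lie derivative of the metric\<close>

lemma lie_metric_matrix:
  "lie_metric X G x = (\<Sum>k\<in>UNIV. X x $ k *\<^sub>R mpartial k G x)
    + transpose (\<chi> k i. partial i (\<lambda>y. X y $ k) x) ** G x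
    + G x ** (\<chi> k i. partial i (\<lambda>y. X y $ k) x)"
  by (simp add: vec_eq_iff lie_metric_def mpartial_nth matrix_matrix_mult_def transpose_def
      sum.distrib mult.commute)

text \<open>Differentiating G = J^T (G' o T) J along \<open>X\<close> produces two terms with the
  derivative \<open>D J\<close> of the Jacobian. Transforming the derivative matrix of the field
  produces the same two terms, because second derivatives of \<open>T\<close> commute.\<close>

lemma lie_metric_pullback:
  fixes T :: "real^'n::finite \<Rightarrow> real^'n"
  assumes O: "open U" "open U'" "x \<in> U" and TU: "T ` U \<subseteq> U'"
    and T: "smooth_on T U" and G: "smooth_on G U" and G': "smooth_on G' U'"
    and X: "smooth_on X U" and X': "smooth_on X' U'"
    and eqG: "\<And>y. y \<in> U \<Longrightarrow>
      G y = transpose (jacobian T (at y)) ** G' (T y) ** jacobian T (at y)"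
    and eqX: "\<And>y. y \<in> U \<Longrightarrow> X' (T y) = jacobian T (at y) *v X y"
  shows "lie_metric X G x
    = transpose (jacobian T (at x)) ** lie_metric X' G' (T x) ** jacobian T (at x)"
proof -
  define J where "J = (\<lambda>y. jacobian T (at y))"
  have smJ: "smooth_on J U" unfolding J_def by (rule smooth_on_jacobian[OF O(1) T])
  have Tx: "T x \<in> U'" using TU O(3) by auto
  have dT: "T differentiable (at y)" if "y \<in> U" for y using smooth_onD(1)[OF T that] .
  have dJ: "(\<lambda>y. J y $ a $ b) differentiable (at x)" for a b
    by (rule differentiable_matrix_nth[OF smJ O(1,3)])
  have dX: "(\<lambda>y. X y $ a) differentiable (at x)" for a
    using smooth_onD(1)[OF smooth_on_vec_nth[OF O(1) X] O(3)] .
  have dX': "(\<lambda>y. X' y $ a) differentiable (at (T x))" for a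
    using smooth_onD(1)[OF smooth_on_vec_nth[OF O(2) X'] Tx] .
  have dG': "(\<lambda>y. G' y $ a $ b) differentiable (at (T x))" for a b
    by (rule differentiable_matrix_nth[OF G' O(2) Tx])
  have dG'T: "(\<lambda>y. G' (T y) $ a $ b) differentiable (at x)" for a b
    using differentiable_chain_at[OF dT[OF O(3)] dG'[of a b]] by (simp add: o_def)
  define D where "D F = (\<Sum>k\<in>UNIV. X x $ k *\<^sub>R mpartial k F x)" for F :: "real^'n \<Rightarrow> real^'n^'n"
  define P where "P = (\<chi> k i. partial i (\<lambda>y. X y $ k) x)"
  define P' where "P' = (\<chi> k i. partial i (\<lambda>y. X' y $ k) (T x))"
  have mp: "mpartial k (\<lambda>y. F y ** K y) x = mpartial k F x ** K x + F x ** mpartial k K x"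
    if "\<And>a b. (\<lambda>y. F y $ a $ b) differentiable (at x)" "\<And>a b. (\<lambda>y. K y $ a $ b) differentiable (at x)"
    for F K :: "real^'n \<Rightarrow> real^'n^'n" and k
    using that unfolding mpartial_def matrix_matrix_mult_def
    by (simp add: vec_eq_iff partial_sum partial_mult differentiable_mult sum.distrib)
  have prod_diff: "(\<lambda>y. (F y ** K y) $ a $ b) differentiable (at x)"
    if "\<And>a b. (\<lambda>y. F y $ a $ b) differentiable (at x)" "\<And>a b. (\<lambda>y. K y $ a $ b) differentiable (at x)"
    for F K :: "real^'n \<Rightarrow> real^'n^'n" and a b
    using that by (simp add: matrix_matrix_mult_def differentiable_mult)
  have dJt: "(\<lambda>y. transpose (J y) $ a $ b) differentiable (at x)" for a b
    using dJ by (simp add: transpose_def)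
  have "D G = D (\<lambda>y. transpose (J y) ** G' (T y) ** J y)"
    unfolding D_def using eqG by (intro sum.cong refl arg_cong[of _ _ "scaleR _"]
        mpartial_cong[OF G O(1,3)]) (simp add: J_def)
  also have "\<dots> = transpose (D J) ** G' (T x) ** J x
      + transpose (J x) ** D (\<lambda>y. G' (T y)) ** J x + transpose (J x) ** G' (T x) ** D J"
    unfolding D_def
    by (simp add: mp[OF prod_diff[OF dJt dG'T] dJ] mp[OF dJt dG'T] mpartial_transpose
        scaleR_add_right sum.distrib matrix_add_rdistrib transpose_sum transpose_scalar
        matrix_mult_sum_left matrix_mult_sum_right matrix_scaleR_left matrix_scaleR_right)
  also have "D (\<lambda>y. G' (T y)) = (\<Sum>l\<in>UNIV. X' (T x) $ l *\<^sub>R mpartial l G' (T x))"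
  proof -
    have "D (\<lambda>y. G' (T y)) $ a $ b = (\<Sum>l\<in>UNIV. X' (T x) $ l *\<^sub>R mpartial l G' (T x)) $ a $ b" for a b
    proof -
      have "D (\<lambda>y. G' (T y)) $ a $ b = (\<Sum>k\<in>UNIV. \<Sum>l\<in>UNIV.
          J x $ l $ k * X x $ k * partial l (\<lambda>y. G' y $ a $ b) (T x))"
        by (simp add: D_def mpartial_nth partial_compose[OF dT[OF O(3)] dG'] J_def sum_distrib_left
            mult_ac)
      also have "\<dots> = (\<Sum>l\<in>UNIV. X' (T x) $ l *\<^sub>R mpartial l G' (T x)) $ a $ b"
        by (rule trans[OF sum.swap])
          (simp add: eqX O(3) mpartial_nth matrix_vector_mult_def J_def sum_distrib_right)
      finally show ?thesis .
    qed
    then show ?thesis by (simp add: vec_eq_iff)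
  qed
  finally have DG: "D G = transpose (D J) ** G' (T x) ** J x
      + transpose (J x) ** (\<Sum>l\<in>UNIV. X' (T x) $ l *\<^sub>R mpartial l G' (T x)) ** J x
      + transpose (J x) ** G' (T x) ** D J" .
  have sym: "partial i (\<lambda>y. J y $ k $ l) x = partial l (\<lambda>y. J y $ k $ i) x" for i k l
  proof -
    have *: "partial i (\<lambda>y. J y $ k $ l) x = partial i (partial l (\<lambda>y. T y $ k)) x" for i l
      by (rule partial_cong[OF dJ O(1,3)]) (simp add: J_def jacobian_nth dT)
    show ?thesis
      unfolding * by (rule partial_commute[OF smooth_on_vec_nth[OF O(1) T] O(1,3)])
  qed
  \<comment> \<open>Differentiate X' o T = J X. By \<open>sym\<close>, the term that differentiates
    J in direction i and applies it to X is the i-th column of the derivative of J along X.\<close>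
  have P'J: "P' ** J x = D J + J x ** P"
  proof -
    have "(P' ** J x) $ k $ i = (D J + J x ** P) $ k $ i" for k i
    proof -
      have "(P' ** J x) $ k $ i = partial i (\<lambda>y. X' (T y) $ k) x"
        by (simp add: P'_def matrix_matrix_mult_def partial_compose[OF dT[OF O(3)] dX'] J_def
            mult.commute)
      also have "\<dots> = partial i (\<lambda>y. \<Sum>l\<in>UNIV. J y $ k $ l * X y $ l) x"
        using differentiable_chain_at[OF dT[OF O(3)] dX'[of k]] O
        by (intro partial_cong[of _ _ U]) (simp_all add: o_def eqX matrix_vector_mult_def J_def)
      also have "\<dots> = (\<Sum>l\<in>UNIV. partial i (\<lambda>y. J y $ k $ l) x * X x $ l
          + J x $ k $ l * partial i (\<lambda>y. X y $ l) x)"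
        by (simp add: partial_sum partial_mult dJ dX differentiable_mult)
      finally show ?thesis
        by (simp add: sym[of i] D_def mpartial_nth P_def matrix_matrix_mult_def sum.distrib mult.commute)
    qed
    then show ?thesis by (simp add: vec_eq_iff)
  qed
  have "transpose (J x) ** transpose P' = transpose (P' ** J x)" by (simp add: matrix_transpose_mul)
  then have P'Jt: "transpose (J x) ** transpose P' = transpose (D J) + transpose P ** transpose (J x)"
    unfolding P'J by (simp add: transpose_add matrix_transpose_mul)
  have Gx: "G x = transpose (J x) ** G' (T x) ** J x" by (simp add: eqG O(3) J_def)
  have "transpose (J x) ** lie_metric X' G' (T x) ** J x
      = transpose (J x) ** (\<Sum>l\<in>UNIV. X' (T x) $ l *\<^sub>R mpartial l G' (T x)) ** J x
        + transpose (J x) ** transpose P' ** G' (T x) ** J x + transpose (J x) ** G' (T x) ** (P' ** J x)"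
    unfolding lie_metric_matrix[of X' G'] P'_def[symmetric]
    by (simp add: matrix_add_ldistrib matrix_add_rdistrib matrix_mul_assoc)
  also have "\<dots> = D G + transpose P ** G x + G x ** P"
    unfolding P'J P'Jt DG Gx
    by (simp add: matrix_add_ldistrib matrix_add_rdistrib matrix_mul_assoc)
  also have "\<dots> = lie_metric X G x"
    by (simp add: lie_metric_matrix D_def P_def)
  finally show ?thesis by (simp add: J_def)
qed

section \<open>Charts\<close>

context smooth_manifold
begin

definition cinv :: "('a, 'n) chart \<Rightarrow> real^'n \<Rightarrow> 'a" where
  "cinv c = inv_into (fst c) (snd c)"

definition overlap :: "('a, 'n) chart \<Rightarrow> ('a, 'n) chart \<Rightarrow> (real^'n) set" where
  "overlap c d = snd c ` (fst c \<inter> fst d)"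

lemma chart_subset: "c \<in> A \<Longrightarrow> fst c \<subseteq> topspace M"
  using chart_open openin_subset by blast

lemma topspace_chart: "c \<in> A \<Longrightarrow> topspace (subtopology M (fst c)) = fst c"
  by (simp add: inf.absorb2 chart_subset)

lemma chart_inj: "c \<in> A \<Longrightarrow> inj_on (snd c) (fst c)"
  using homeomorphic_imp_injective_map[OF chart_homeo, of c] by (simp only: topspace_chart)

lemma cinv_chart: "c \<in> A \<Longrightarrow> p \<in> fst c \<Longrightarrow> cinv c (snd c p) = p"
  by (simp add: cinv_def chart_inj)

lemma chart_cinv: "y \<in> chart_image c \<Longrightarrow> snd c (cinv c y) = y"
  and cinv_mem: "y \<in> chart_image c \<Longrightarrow> cinv c y \<in> fst c"
  by (auto simp: cinv_def chart_image_def f_inv_into_f inv_into_into)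

lemma chart_mem: "p \<in> fst c \<Longrightarrow> snd c p \<in> chart_image c"
  by (simp add: chart_image_def)

lemma open_chart_image:
  assumes "c \<in> A" "openin M W" "W \<subseteq> fst c"
  shows "open (snd c ` W)"
proof -
  have "openin (subtopology M (fst c)) W"
    using assms chart_open by (simp add: openin_open_subtopology)
  then have "openin (top_of_set (chart_image c)) (snd c ` W)"
    using homeomorphic_imp_open_map[OF chart_homeo[OF assms(1)]] by (auto simp: open_map_def)
  then show ?thesis
    using chart_image_open[OF assms(1)] openin_open_trans by blast
qed

lemma openin_chart_preimage:
  assumes "c \<in> A" "open W"
  shows "openin M {p \<in> fst c. snd c p \<in> W}"
proof -
  have "openin (top_of_set (chart_image c)) (chart_image c \<inter> W)"
    using assms(2) by blast
  then have "openin (subtopology M (fst c)) {p \<in> fst c. snd c p \<in> chart_image c \<inter> W}"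
    using openin_continuous_map_preimage[OF homeomorphic_imp_continuous_map[OF chart_homeo]] assms(1)
    by (simp only: topspace_chart)
  then have "openin M {p \<in> fst c. snd c p \<in> chart_image c \<inter> W}"
    using chart_open[OF assms(1)] by (simp add: openin_open_subtopology)
  moreover have "{p \<in> fst c. snd c p \<in> chart_image c \<inter> W} = {p \<in> fst c. snd c p \<in> W}"
    by (auto simp: chart_mem)
  ultimately show ?thesis by simp
qed

text \<open>The inverse chart maps \<open>K\<close> onto a compact set, and compact sets are closed
  in a Hausdorff space. Closedness in all of \<open>M\<close>, rather than in the chart domain
  alone, is what makes the extension of a bump by zero regular.\<close>

lemma closedin_chart_preimage:
  assumes "c \<in> A" "compact K" "K \<subseteq> chart_image c"
  shows "closedin M {p \<in> fst c. snd c p \<in> K}"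
proof -
  obtain h where h: "homeomorphic_maps (subtopology M (fst c)) (top_of_set (chart_image c)) (snd c) h"
    using chart_homeo[OF assms(1)] homeomorphic_map_maps by blast
  have hc: "h (snd c p) = p" if "p \<in> fst c" for p
    using h[unfolded homeomorphic_maps_def topspace_chart[OF assms(1)]] that by blast
  have "compactin (top_of_set (chart_image c)) K"
    using assms(2,3) by (simp add: compactin_subtopology)
  then have "compactin (subtopology M (fst c)) (h ` K)"
    using h image_compactin unfolding homeomorphic_maps_def by blast
  moreover have "h ` K = {p \<in> fst c. snd c p \<in> K}"
  proof -
    have "K = snd c ` {p \<in> fst c. snd c p \<in> K}" using assms(3) by (auto simp: chart_image_def)
    then have "h ` K = h ` snd c ` {p \<in> fst c. snd c p \<in> K}" by simp
    also have "\<dots> = {p \<in> fst c. snd c p \<in> K}" by (auto simp: image_image hc image_iff)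
    finally show ?thesis .
  qed
  ultimately show ?thesis
    using compactin_imp_closedin[OF Hausdorff] by (simp add: compactin_subtopology)
qed

lemma transition_chart: "c \<in> A \<Longrightarrow> p \<in> fst c \<Longrightarrow> transition c d (snd c p) = snd d p"
  by (simp add: transition_def chart_inj)

lemma transition_eq: "transition c d y = snd d (cinv c y)"
  by (simp add: transition_def cinv_def)

lemma open_overlap: "c \<in> A \<Longrightarrow> d \<in> A \<Longrightarrow> open (overlap c d)"
  unfolding overlap_def by (intro open_chart_image) (auto intro: chart_open)

lemma overlap_subset: "overlap c d \<subseteq> chart_image c"
  by (auto simp: overlap_def chart_image_def)

lemma transition_image:
  assumes "c \<in> A" "d \<in> A" shows "transition c d ` overlap c d = overlap d c"
proof -
  have "transition c d ` overlap c d = (\<lambda>p. transition c d (snd c p)) ` (fst c \<inter> fst d)"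
    by (simp add: overlap_def image_image)
  also have "\<dots> = snd d ` (fst c \<inter> fst d)"
    using assms by (intro image_cong) (auto simp: transition_chart)
  finally show ?thesis by (simp add: overlap_def Int_commute)
qed

lemma transition_inj: "c \<in> A \<Longrightarrow> d \<in> A \<Longrightarrow> inj_on (transition c d) (overlap c d)"
  by (rule inj_on_inverseI[of _ "transition d c"]) (auto simp: overlap_def transition_chart)

lemma smooth_transition: "c \<in> A \<Longrightarrow> d \<in> A \<Longrightarrow> smooth_on (transition c d) (overlap c d)"
  unfolding overlap_def by (rule transition_smooth)

lemma overlap_iff: "c \<in> A \<Longrightarrow> y \<in> chart_image c \<Longrightarrow> y \<in> overlap c d \<longleftrightarrow> cinv c y \<in> fst d"
  by (auto simp: overlap_def cinv_chart image_iff intro!: bexI[of _ "cinv c y"] simp: chart_cinv cinv_mem)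

lemma cinv_transition:
  "c \<in> A \<Longrightarrow> d \<in> A \<Longrightarrow> y \<in> overlap c d \<Longrightarrow> cinv d (transition c d y) = cinv c y"
  by (auto simp: overlap_def transition_chart cinv_chart)

lemma cinv_topspace: "c \<in> A \<Longrightarrow> y \<in> chart_image c \<Longrightarrow> cinv c y \<in> topspace M"
  using cinv_mem chart_subset by blast

end

section \<open>Bump functions and partitions of unity\<close>

lemma has_derivative_pos_part_square:
  "((\<lambda>t. (max 0 t)\<^sup>2) has_real_derivative 2 * max 0 t) (at t)"
proof -
  consider "0 < t" | "t < 0" | "t = 0" by linarith
  then show ?thesis
  proof cases
    case 1
    have "((\<lambda>t. t\<^sup>2) has_real_derivative 2 * max 0 t) (at t)"
      using 1 by (auto intro!: derivative_eq_intros)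
    then show ?thesis
      by (rule has_field_derivative_transform_within_open[of _ _ _ "{0<..}"]) (use 1 in auto)
  next
    case 2
    have "((\<lambda>t. 0) has_real_derivative 2 * max 0 t) (at t)"
      using 2 by (auto intro!: derivative_eq_intros)
    then show ?thesis
      by (rule has_field_derivative_transform_within_open[of _ _ _ "{..<0}"]) (use 2 in auto)
  next
    case 3
    have "((\<lambda>h::real. (max 0 h)\<^sup>2 / h) \<longlongrightarrow> 0) (at 0)"
    proof (rule Lim_null_comparison[of _ "\<lambda>h. \<bar>h\<bar>"])
      show "\<forall>\<^sub>F h::real in at 0. norm ((max 0 h)\<^sup>2 / h) \<le> \<bar>h\<bar>"
        by (rule always_eventually) (auto simp: max_def power2_eq_square)
      show "((\<lambda>h::real. \<bar>h\<bar>) \<longlongrightarrow> 0) (at 0)" by (rule tendsto_rabs_zero) simp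
    qed
    then show ?thesis using 3 by (simp add: has_field_derivative_iff)
  qed
qed

lemma Ck_on_pos_part_square:
  fixes f :: "'v::real_normed_vector \<Rightarrow> real"
  assumes "open S" "Ck_on 1 f S"
  shows "Ck_on 1 (\<lambda>y. (max 0 (f y))\<^sup>2) S"
  unfolding One_nat_def
proof (rule Ck_on_SucI[OF assms(1)])
  note f = assms(2)[unfolded One_nat_def]
  show "((\<lambda>y. (max 0 (f y))\<^sup>2) has_derivative (\<lambda>v. 2 * max 0 (f y) * frechet_derivative f (at y) v)) (at y)"
    if "y \<in> S" for y
    using has_derivative_compose[OF Ck_on_SucD(1)[OF f that]
        has_derivative_pos_part_square[of "f y", unfolded has_field_derivative_def]] by simp
  have "continuous_on S f" using Ck_on_Suc_imp[OF f] by simp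
  then show "Ck_on 0 (\<lambda>y. 2 * max 0 (f y) * frechet_derivative f (at y) v) S" for v
    using Ck_on_SucD(2)[OF f, of v] by (auto intro!: continuous_intros)
qed

context smooth_manifold
begin

lemma power2_dist_eq_inner: "(dist z w)\<^sup>2 = (w - z) \<bullet> (w - z)"
  for z w :: "'v::real_inner"
  by (metis dist_commute dist_norm power2_norm_eq_inner)

text \<open>A truncated paraboloid over the ball of radius \<open>r\<close> around \<open>z\<close>,
  squared so that its first derivatives are continuous across the boundary sphere.\<close>

definition bump :: "('a, 'n) chart \<times> (real^'n) \<times> real \<Rightarrow> 'a \<Rightarrow> real" where
  "bump = (\<lambda>(c, z, r) p. if p \<in> fst c then (max 0 (r\<^sup>2 - (snd c p - z) \<bullet> (snd c p - z)))\<^sup>2 else 0)"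

text \<open>The closed ball lies inside the chart image, so that the support is compact and never
  touches the edge of the chart.\<close>

definition bump_indices :: "(('a, 'n) chart \<times> (real^'n) \<times> real) set" where
  "bump_indices = {(c, z, r). c \<in> A \<and> 0 < r \<and> cball z r \<subseteq> chart_image c}"

lemma bump_nonneg: "0 \<le> bump a p"
  by (cases a) (simp add: bump_def)

lemma bump_nz:
  assumes "a \<in> bump_indices" "a = (c, z, r)" "bump a p \<noteq> 0"
  shows "p \<in> fst c" "snd c p \<in> cball z r"
proof -
  show "p \<in> fst c" using assms(2,3) by (simp add: bump_def split: if_splits)
  have "0 < r\<^sup>2 - (snd c p - z) \<bullet> (snd c p - z)"
  proof (rule ccontr)
    assume "\<not> ?thesis"
    then have "max 0 (r\<^sup>2 - (snd c p - z) \<bullet> (snd c p - z)) = 0" by simp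
    then have "bump a p = 0"
      by (simp only: bump_def assms(2) split_conv zero_power2 if_cancel)
    then show False using assms(3) by simp
  qed
  then have "(dist z (snd c p))\<^sup>2 < r\<^sup>2"
    by (simp add: power2_dist_eq_inner)
  moreover have "0 \<le> r" using assms(1) by (simp add: assms(2) bump_indices_def)
  ultimately have "dist z (snd c p) < r" by (rule power2_less_imp_less)
  then show "snd c p \<in> cball z r" by simp
qed

lemma bump_pos:
  assumes "p \<in> fst c" "snd c p \<in> ball z r"
  shows "0 < bump (c, z, r) p"
proof -
  have "(dist z (snd c p))\<^sup>2 < r\<^sup>2"
    using assms(2) by (intro power_strict_mono) auto
  then have "0 < r\<^sup>2 - (snd c p - z) \<bullet> (snd c p - z)"
    by (simp add: power2_dist_eq_inner)
  then show ?thesis using assms(1) by (simp add: bump_def)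
qed

lemma bump_support_closed:
  assumes "(c, z, r) \<in> bump_indices"
  shows "closedin M {p \<in> fst c. snd c p \<in> cball z r}"
  using assms by (intro closedin_chart_preimage) (auto simp: bump_indices_def)

text \<open>Together with the overlap of \<open>d\<close> and \<open>c\<close>, this open set covers
  the image of \<open>d\<close>. It is the region where functions supported in the ball vanish
  identically, along with their derivatives.\<close>

lemma open_off_support:
  assumes "(c, z, r) \<in> bump_indices" "d \<in> A"
  shows "open {y \<in> chart_image d. cinv d y \<notin> {p \<in> fst c. snd c p \<in> cball z r}}"
proof -
  let ?K = "{p \<in> fst c. snd c p \<in> cball z r}"
  have "openin M (fst d - ?K)"
    using chart_open[OF assms(2)] bump_support_closed[OF assms(1)] by (rule openin_diff)
  then have "open (snd d ` (fst d - ?K))"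
    using assms(2) by (intro open_chart_image) auto
  moreover have "snd d ` (fst d - ?K) = {y \<in> chart_image d. cinv d y \<notin> ?K}"
  proof (intro set_eqI iffI)
    fix y assume "y \<in> snd d ` (fst d - ?K)"
    then obtain p where "p \<in> fst d" "p \<notin> ?K" "y = snd d p" by blast
    then show "y \<in> {y \<in> chart_image d. cinv d y \<notin> ?K}"
      using assms(2) by (simp add: chart_mem cinv_chart)
  next
    fix y assume y: "y \<in> {y \<in> chart_image d. cinv d y \<notin> ?K}"
    then have "cinv d y \<in> fst d - ?K" using cinv_mem[of y d] by blast
    then have "snd d (cinv d y) \<in> snd d ` (fst d - ?K)" by (rule imageI)
    then show "y \<in> snd d ` (fst d - ?K)" using y by (simp only: chart_cinv mem_Collect_eq)
  qed
  ultimately show ?thesis by simp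
qed

text \<open>Near a point of the overlap the bump is an explicit function of the smooth transition
  map; near any other point it is zero, as its support is closed.\<close>

lemma Ck_on_bump:
  assumes a: "a \<in> bump_indices" and "d \<in> A"
  shows "Ck_on 1 (\<lambda>y. bump a (cinv d y)) (chart_image d)"
proof (rule Ck_on_local)
  fix y assume y: "y \<in> chart_image d"
  obtain c z r where [simp]: "a = (c, z, r)" by (cases a)
  have "c \<in> A" using a by (simp add: bump_indices_def)
  show "\<exists>W. open W \<and> y \<in> W \<and> Ck_on 1 (\<lambda>y. bump a (cinv d y)) W"
  proof (cases "cinv d y \<in> fst c")
    case True
    have op: "open (overlap d c)" by (rule open_overlap[OF \<open>d \<in> A\<close> \<open>c \<in> A\<close>])
    let ?f = "\<lambda>y. r\<^sup>2 - (transition d c y - z) \<bullet> (transition d c y - z)"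
    have "smooth_on ?f (overlap d c)"
      unfolding inner_vec_def
      by (simp, intro smooth_on_diff smooth_on_sum smooth_on_mult smooth_on_const op
          smooth_on_vec_nth[OF op] smooth_transition \<open>d \<in> A\<close> \<open>c \<in> A\<close>)
    then have "Ck_on 1 (\<lambda>y. (max 0 (?f y))\<^sup>2) (overlap d c)"
      using op by (intro Ck_on_pos_part_square) (auto simp: smooth_on_def)
    then have "Ck_on 1 (\<lambda>y. bump a (cinv d y)) (overlap d c)"
      by (rule Ck_on_cong[OF op, rotated])
        (auto simp: bump_def transition_eq overlap_def cinv_chart \<open>d \<in> A\<close>)
    moreover have "y \<in> overlap d c" using True y \<open>d \<in> A\<close> by (simp add: overlap_iff)
    ultimately show ?thesis using op by blast
  next
    case False
    let ?W = "{y \<in> chart_image d. cinv d y \<notin> {p \<in> fst c. snd c p \<in> cball z r}}"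
    have op: "open ?W" using a \<open>d \<in> A\<close> open_off_support by simp
    have "Ck_on 1 (\<lambda>y. bump a (cinv d y)) ?W"
    proof (rule Ck_on_cong[OF op _ Ck_on_const[OF op, of _ 0]])
      fix y assume "y \<in> ?W"
      then show "0 = bump a (cinv d y)" using bump_nz[OF a, of c z r "cinv d y"] by auto
    qed
    then show ?thesis using op False y by blast
  qed
qed

end

context smooth_manifold
begin

text \<open>Compactness selects finitely many balls, and the bumps are divided by their sum. A ball
  of the chart \<open>c0\<close> centred at \<open>x0\<close> is added to the subcover, so that some
  member living in \<open>c0\<close> is positive at the point under examination.\<close>

lemma partition_of_unity:
  assumes "compact_space M" "c0 \<in> A" "x0 \<in> chart_image c0"
  obtains I \<phi> where "finite I" "I \<subseteq> bump_indices"
    "\<And>a p. 0 \<le> (\<phi> a p :: real)" "\<And>p. p \<in> topspace M \<Longrightarrow> (\<Sum>a\<in>I. \<phi> a p) = 1"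
    "\<And>a d. a \<in> I \<Longrightarrow> d \<in> A \<Longrightarrow> Ck_on 1 (\<lambda>y. \<phi> a (cinv d y)) (chart_image d)"
    "\<And>c z r p. (c, z, r) \<in> I \<Longrightarrow> \<phi> (c, z, r) p \<noteq> 0 \<Longrightarrow> p \<in> fst c \<and> snd c p \<in> cball z r"
    "\<exists>z r. (c0, z, r) \<in> I \<and> 0 < \<phi> (c0, z, r) (cinv c0 x0)"
proof -
  define U where "U = (\<lambda>(c :: ('a, 'n) chart, z, r). {p \<in> fst c. snd c p \<in> ball z r})"
  have idx: "\<exists>r. (c, y, r) \<in> bump_indices" if cy: "c \<in> A" "y \<in> chart_image c" for c y
    using open_contains_cball[THEN iffD1, OF chart_image_open[OF cy(1)]] cy
    by (auto simp: bump_indices_def)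
  have "openin M (U a)" if "a \<in> bump_indices" for a
    using that by (cases a) (auto simp: U_def bump_indices_def simp del: mem_ball intro!: openin_chart_preimage)
  moreover have "topspace M \<subseteq> \<Union> (U ` bump_indices)"
  proof
    fix p assume "p \<in> topspace M"
    then obtain c where c: "c \<in> A" "p \<in> fst c" using cover by blast
    obtain r where r: "(c, snd c p, r) \<in> bump_indices" using idx[OF c(1) chart_mem[OF c(2)]] ..
    moreover have "p \<in> U (c, snd c p, r)" using c(2) r by (simp add: U_def bump_indices_def)
    ultimately show "p \<in> \<Union> (U ` bump_indices)" by (rule UN_I)
  qed
  ultimately obtain \<F> where "finite \<F>" "\<F> \<subseteq> U ` bump_indices" "topspace M \<subseteq> \<Union>\<F>"
    using assms(1)[unfolded compact_space_alt, rule_format, of "U ` bump_indices"] by blast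
  then obtain I0 where I0: "finite I0" "I0 \<subseteq> bump_indices" "topspace M \<subseteq> \<Union>(U ` I0)"
    using finite_subset_image[of \<F> U bump_indices] by blast
  obtain r0 where r0: "(c0, x0, r0) \<in> bump_indices" using idx[OF assms(2,3)] by blast
  define I where "I = insert (c0, x0, r0) I0"
  have I: "finite I" "I \<subseteq> bump_indices" using I0 r0 by (auto simp: I_def)
  define s where "s p = (\<Sum>a\<in>I. bump a p)" for p
  have s: "0 < s p" if p: "p \<in> topspace M" for p
  proof -
    obtain a where a: "a \<in> I" "p \<in> U a" using I0(3) p unfolding I_def by blast
    obtain c z r where [simp]: "a = (c, z, r)" by (cases a)
    have "0 < bump a p" using a(2) bump_pos[of p c z r] by (simp add: U_def)
    then show ?thesis unfolding s_def using I(1) a(1) by (intro sum_pos2) (auto simp: bump_nonneg)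
  qed
  show thesis
  proof (rule that[of I "\<lambda>a p. bump a p * inverse (s p)"])
    show "finite I" "I \<subseteq> bump_indices" by (rule I)+
    show "0 \<le> bump a p * inverse (s p)" for a p
      by (simp add: bump_nonneg s_def sum_nonneg)
    show "(\<Sum>a\<in>I. bump a p * inverse (s p)) = 1" if "p \<in> topspace M" for p
      using s[OF that] by (simp add: s_def flip: sum_distrib_right)
    show "Ck_on 1 (\<lambda>y. bump a (cinv d y) * inverse (s (cinv d y))) (chart_image d)"
      if "a \<in> I" "d \<in> A" for a d
    proof (intro Ck_on_mult Ck_on_inverse chart_image_open that)
      show "Ck_on 1 (\<lambda>y. bump a (cinv d y)) (chart_image d)"
        using Ck_on_bump that I(2) by blast
      show "Ck_on 1 (\<lambda>y. s (cinv d y)) (chart_image d)"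
        unfolding s_def using I(2) that
        by (intro Ck_on_sum chart_image_open Ck_on_bump) auto
      show "s (cinv d y) \<noteq> 0" if "y \<in> chart_image d" for y
        using s[OF cinv_topspace[OF \<open>d \<in> A\<close> that]] by simp
    qed
    show "p \<in> fst c \<and> snd c p \<in> cball z r"
      if "(c, z, r) \<in> I" "bump (c, z, r) p * inverse (s p) \<noteq> 0" for c z r p
      using bump_nz[of "(c, z, r)" c z r p] that I(2) by auto
    have "0 < r0" using r0 by (simp add: bump_indices_def)
    then have "0 < bump (c0, x0, r0) (cinv c0 x0)"
      using assms(3) by (intro bump_pos) (simp_all add: cinv_mem chart_cinv)
    then show "\<exists>z r. (c0, z, r) \<in> I \<and> 0 < bump (c0, z, r) (cinv c0 x0) * inverse (s (cinv c0 x0))"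
      using s[OF cinv_topspace[OF assms(2,3)]] by (intro exI[of _ x0] exI[of _ r0]) (simp add: I_def)
  qed
qed

end

section \<open>The divergence theorem\<close>

lemma (in local_metric) smooth_divergence:
  assumes "smooth_on V S" shows "smooth_on (divergence G V) S"
proof -
  have "smooth_on (\<lambda>x. \<Sum>i\<in>UNIV. partial i (\<lambda>y. V y $ i) x + (\<Sum>j\<in>UNIV. Gam i x $ i $ j * V x $ j)) S"
    by (intro smooth_on_sum smooth_on_add smooth_on_mult open_S smooth_on_partial
        smooth_on_vec_nth[OF open_S assms] smooth_on_matrixD[OF smooth_Gam])
  then show ?thesis by (simp add: divergence_eq[abs_def])
qed

context riemannian_manifold
begin

lemma local_metric: "c \<in> A \<Longrightarrow> local_metric (chart_image c) (g c)"
  using chart_image_open metric_tensor metric_sym metric_pos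
  by unfold_locales (auto simp: smooth_tensor2_field_def)

definition mu :: "('a, 'n) chart \<Rightarrow> real^'n \<Rightarrow> real" where
  "mu c = local_metric.vol (g c)"

lemma mu_eq: "c \<in> A \<Longrightarrow> mu c y = sqrt \<bar>det (g c y)\<bar>"
  by (simp add: mu_def local_metric.vol_def[OF local_metric])

lemma mu_pos: "c \<in> A \<Longrightarrow> y \<in> chart_image c \<Longrightarrow> 0 < mu c y"
  unfolding mu_def by (rule local_metric.vol_pos[OF local_metric])

lemma smooth_mu: "c \<in> A \<Longrightarrow> smooth_on (mu c) (chart_image c)"
  unfolding mu_def by (rule local_metric.smooth_vol[OF local_metric])

lemma metric_transform:
  assumes "c \<in> A" "d \<in> A" "y \<in> overlap c d"
  defines "J \<equiv> jacobian (transition c d) (at y)"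
  shows "g c y = transpose J ** g d (transition c d y) ** J"
proof -
  obtain p where p: "p \<in> fst c \<inter> fst d" "y = snd c p" using assms(3) by (auto simp: overlap_def)
  have "transition c d y = snd d p" using p transition_chart[OF assms(1)] by blast
  then show ?thesis
    using metric_tensor[unfolded smooth_tensor2_field_def Let_def, THEN conjunct2, rule_format,
        OF assms(1,2) p(1)]
    by (simp only: J_def p(2))
qed

lemma mu_transform:
  assumes "c \<in> A" "d \<in> A" "y \<in> overlap c d"
  shows "mu c y = \<bar>det (jacobian (transition c d) (at y))\<bar> * mu d (transition c d y)"
  using assms by (simp add: mu_eq metric_transform det_mul abs_mult real_sqrt_mult)

lemma vector_transform:
  assumes "smooth_vector_field A V" "c \<in> A" "d \<in> A" "y \<in> overlap c d"
  shows "V d (transition c d y) = jacobian (transition c d) (at y) *v V c y"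
proof -
  obtain p where p: "p \<in> fst c \<inter> fst d" "y = snd c p" using assms(4) by (auto simp: overlap_def)
  have "transition c d y = snd d p" using p transition_chart[OF assms(2)] by blast
  then show ?thesis
    using assms(1)[unfolded smooth_vector_field_def, THEN conjunct2, rule_format, OF assms(2,3) p(1)]
    by (simp only: p(2))
qed

end

context closed_riemannian_manifold
begin

text \<open>Integrating \<open>div V\<close> against a partition of unity leaves the integrals of \<open>V(\<phi>\<^sub>a)\<close>, each over
  one chart. A second copy of the partition moves all of them to common charts, where they add up
  to the integral of \<open>V(1) = 0\<close>.\<close>

theorem nonneg_divergence_eq_zero:
  assumes V: "smooth_vector_field A V"
    and nonneg: "\<And>c x. c \<in> A \<Longrightarrow> x \<in> chart_image c \<Longrightarrow> 0 \<le> divergence (g c) (V c) x"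
    and c0: "c0 \<in> A" "x0 \<in> chart_image c0"
  shows "divergence (g c0) (V c0) x0 = 0"
proof (rule partition_of_unity[OF compact c0])
  fix I and \<phi> :: "('a, 'n) chart \<times> (real^'n) \<times> real \<Rightarrow> 'a \<Rightarrow> real"
  assume I: "finite I" "I \<subseteq> bump_indices"
    and \<phi>_nonneg: "\<And>a p. 0 \<le> \<phi> a p"
    and \<phi>_sum: "\<And>p. p \<in> topspace M \<Longrightarrow> (\<Sum>a\<in>I. \<phi> a p) = 1"
    and \<phi>_C1: "\<And>a d. a \<in> I \<Longrightarrow> d \<in> A \<Longrightarrow> Ck_on 1 (\<lambda>y. \<phi> a (cinv d y)) (chart_image d)"
    and \<phi>_supp: "\<And>c z r p. (c, z, r) \<in> I \<Longrightarrow> \<phi> (c, z, r) p \<noteq> 0 \<Longrightarrow> p \<in> fst c \<and> snd c p \<in> cball z r"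
    and \<phi>_pos: "\<exists>z r. (c0, z, r) \<in> I \<and> 0 < \<phi> (c0, z, r) (cinv c0 x0)"
  define K where "K a = cball (fst (snd a)) (snd (snd a))" for a :: "('a, 'n) chart \<times> (real^'n) \<times> real"
  have idx: "fst a \<in> A" "compact (K a)" "K a \<subseteq> chart_image (fst a)" if "a \<in> I" for a
    using subsetD[OF I(2) that] by (auto simp: bump_indices_def K_def split_beta)
  have op: "open (chart_image c)" if "c \<in> A" for c using that by (rule chart_image_open)
  have smV: "smooth_on (V c) (chart_image c)" if "c \<in> A" for c
    using V that by (simp add: smooth_vector_field_def)
  have \<phi>_diff: "(\<lambda>y. \<phi> a (cinv d y)) differentiable (at y)" if "a \<in> I" "d \<in> A" "y \<in> chart_image d" for a d y
    using \<phi>_C1[OF that(1,2)] that(3) by simp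
  have \<phi>_cont: "continuous_on (chart_image d) (\<lambda>y. \<phi> a (cinv d y))" if "a \<in> I" "d \<in> A" for a d
    using Ck_on_mono[OF \<phi>_C1[OF that], of 0] by simp
  have \<phi>_chart: "y \<in> K a" if "a \<in> I" "y \<in> chart_image (fst a)" "\<phi> a (cinv (fst a) y) \<noteq> 0" for a y
  proof -
    obtain c z r where [simp]: "a = (c, z, r)" by (cases a)
    show ?thesis using \<phi>_supp[of c z r "cinv c y"] that by (simp add: K_def chart_cinv)
  qed
  have \<phi>_out: "\<phi> a (cinv (fst a) y) = 0" if "a \<in> I" "y \<in> chart_image (fst a)" "y \<notin> K a" for a y
    using \<phi>_chart[OF that(1,2)] that(3) by blast
  have \<phi>_fst: "p \<in> fst (fst a)" if "a \<in> I" "\<phi> a p \<noteq> 0" for a p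
    using \<phi>_supp[of "fst a" "fst (snd a)" "snd (snd a)" p] that by simp
  \<comment> \<open>The derivative V(\<phi>_a), computed in the coordinates of \<open>d\<close>,
    which need not be the chart of \<open>a\<close>.\<close>
  define D where "D a d y = frechet_derivative (\<lambda>y. \<phi> a (cinv d y)) (at y) (V d y)" for a d y
  have D_eq: "D a d y = (\<Sum>i\<in>UNIV. V d y $ i * partial i (\<lambda>y. \<phi> a (cinv d y)) y)"
    if "a \<in> I" "d \<in> A" "y \<in> chart_image d" for a d y
    unfolding D_def by (rule frechet_derivative_eq_partial[OF \<phi>_diff[OF that]])
  have D_cont: "continuous_on (chart_image d) (D a d)" if ad: "a \<in> I" "d \<in> A" for a d
  proof -
    have "continuous_on (chart_image d) (partial i (\<lambda>y. \<phi> a (cinv d y)))" for i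
      using \<phi>_C1[OF ad] by (simp add: partial_def[abs_def])
    moreover have "continuous_on (chart_image d) (\<lambda>y. V d y $ i)" for i
      using smooth_onD(3)[OF smooth_on_vec_nth[OF op smV]] ad by blast
    ultimately have "continuous_on (chart_image d)
        (\<lambda>y. \<Sum>i\<in>UNIV. V d y $ i * partial i (\<lambda>y. \<phi> a (cinv d y)) y)"
      by (intro continuous_on_sum continuous_on_mult)
    then show ?thesis using D_eq[OF ad] by (simp cong: continuous_on_cong)
  qed
  \<comment> \<open>The support is closed, so \<phi>_a vanishes on a whole neighbourhood of the
    point and its derivative vanishes there too.\<close>
  have D_zero: "D a d y = 0"
    if ad: "a \<in> I" "d \<in> A" and y: "y \<in> chart_image d" "cinv d y \<notin> {p \<in> fst (fst a). snd (fst a) p \<in> K a}" for a d y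
  proof -
    obtain c z r where a [simp]: "a = (c, z, r)" by (cases a)
    let ?W = "{y \<in> chart_image d. cinv d y \<notin> {p \<in> fst c. snd c p \<in> cball z r}}"
    have "open ?W" using open_off_support[of c z r d] ad I(2) by auto
    moreover have "y \<in> ?W" using y by (simp add: K_def)
    moreover have "\<phi> a (cinv d w) = 0" if "w \<in> ?W" for w
      using \<phi>_supp[of c z r "cinv d w"] that ad by auto
    ultimately have "frechet_derivative (\<lambda>y. \<phi> a (cinv d y)) (at y) = frechet_derivative (\<lambda>y. 0) (at y)"
      by (rule frechet_derivative_transform_within_open[OF \<phi>_diff[OF ad y(1)]])
    then show ?thesis by (simp add: D_def)
  qed
  have D_sum: "(\<Sum>a\<in>I. D a d y) = 0" if d: "d \<in> A" "y \<in> chart_image d" for d y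
  proof -
    have "partial i (\<lambda>y. 1) y = partial i (\<lambda>y. \<Sum>a\<in>I. \<phi> a (cinv d y)) y" for i
      by (rule partial_cong[OF _ op[OF d(1)] d(2)]) (simp_all add: \<phi>_sum cinv_topspace d(1))
    then have 0: "(\<Sum>a\<in>I. partial i (\<lambda>y. \<phi> a (cinv d y)) y) = 0" for i
      using partial_sum[of I "\<lambda>a y. \<phi> a (cinv d y)" y i] \<phi>_diff d by (simp add: partial_const)
    have "(\<Sum>a\<in>I. D a d y) = (\<Sum>a\<in>I. \<Sum>i\<in>UNIV. V d y $ i * partial i (\<lambda>y. \<phi> a (cinv d y)) y)"
      using d by (simp add: D_eq)
    also have "\<dots> = (\<Sum>i\<in>UNIV. V d y $ i * (\<Sum>a\<in>I. partial i (\<lambda>y. \<phi> a (cinv d y)) y))"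
      unfolding sum_distrib_left by (rule sum.swap)
    finally show ?thesis by (simp add: 0)
  qed
  have D_transform: "D a c y = D a d (transition c d y)"
    if "a \<in> I" "c \<in> A" "d \<in> A" "y \<in> overlap c d" for a c d y
  proof -
    let ?T = "transition c d"
    have yc: "y \<in> chart_image c" using that overlap_subset by blast
    have Ty: "?T y \<in> chart_image d"
      using transition_image[OF that(2,3)] that(4) overlap_subset by blast
    have dT: "?T differentiable (at y)" using smooth_onD(1)[OF smooth_transition that(4)] that by blast
    have "frechet_derivative (\<lambda>y. \<phi> a (cinv c y)) (at y)
        = frechet_derivative (\<lambda>y. \<phi> a (cinv d (?T y))) (at y)"
      by (rule frechet_derivative_transform_within_open[OF \<phi>_diff[OF that(1,2) yc]
            open_overlap[OF that(2,3)] that(4)]) (simp add: cinv_transition that)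
    then have "D a c y = frechet_derivative (\<lambda>y. \<phi> a (cinv d y)) (at (?T y))
        (frechet_derivative ?T (at y) (V c y))"
      unfolding D_def by (simp add: frechet_derivative_compose'[OF dT \<phi>_diff[OF that(1,3) Ty]])
    then show ?thesis
      by (simp add: D_def frechet_derivative_jacobian[OF dT] vector_transform[OF V that(2-4)])
  qed
  have mu_cont: "continuous_on (chart_image c) (mu c)" if "c \<in> A" for c
    using smooth_onD(3)[OF smooth_mu[OF that]] .
  \<comment> \<open>The integral of \<phi>_b V(\<phi>_a), taken in the chart of \<open>a\<close> for
    \<open>J\<close> and in the chart of \<open>b\<close> for \<open>J'\<close>.\<close>
  define J where "J a b = (LINT y:chart_image (fst a)|lborel.
      mu (fst a) y * (\<phi> b (cinv (fst a) y) * D a (fst a) y))" for a b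
  define J' where "J' a b = (LINT y:chart_image (fst b)|lborel.
      mu (fst b) y * (\<phi> b (cinv (fst b) y) * D a (fst b) y))" for a b
  have D_out: "D a (fst a) y = 0" if "a \<in> I" "y \<in> chart_image (fst a)" "y \<notin> K a" for a y
    using D_zero[OF that(1) idx(1)[OF that(1)] that(2)] that(3) by (simp add: chart_cinv that(2))
  have int_mu: "set_integrable lborel (chart_image (fst a)) (\<lambda>y. mu (fst a) y * f y)"
    if a: "a \<in> I" and f: "continuous_on (chart_image (fst a)) f"
      "\<And>y. y \<in> chart_image (fst a) \<Longrightarrow> y \<notin> K a \<Longrightarrow> f y = 0" for a f
  proof (rule integrable_continuous_compact_support[OF _ idx(2,3)[OF a]])
    show "continuous_on (chart_image (fst a)) (\<lambda>y. mu (fst a) y * f y)"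
      by (intro continuous_on_mult mu_cont idx(1) a f)
  qed (use f(2) in auto)
  \<comment> \<open>The compact support comes from a different factor in each chart: from
    V(\<phi>_a) in the chart of \<open>a\<close>, from \<phi>_b in the chart of
    \<open>b\<close>.\<close>
  have int_J: "set_integrable lborel (chart_image (fst a))
      (\<lambda>y. mu (fst a) y * (\<phi> b (cinv (fst a) y) * D a (fst a) y))" if "a \<in> I" "b \<in> I" for a b
    by (intro int_mu continuous_on_mult \<phi>_cont D_cont idx(1) that) (simp add: D_out that)
  have int_J': "set_integrable lborel (chart_image (fst b))
      (\<lambda>y. mu (fst b) y * (\<phi> b (cinv (fst b) y) * D a (fst b) y))" if "a \<in> I" "b \<in> I" for a b
    by (intro int_mu continuous_on_mult \<phi>_cont D_cont idx(1) that) (simp add: \<phi>_out that)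
  have JJ': "J a b = J' a b" if ab: "a \<in> I" "b \<in> I" for a b
  proof -
    let ?c = "fst a" and ?d = "fst b"
    have c: "?c \<in> A" and d: "?d \<in> A" using idx ab by blast+
    let ?T = "transition ?c ?d"
    let ?h = "\<lambda>y. mu ?c y * (\<phi> b (cinv ?c y) * D a ?c y)"
    let ?h' = "\<lambda>y. mu ?d y * (\<phi> b (cinv ?d y) * D a ?d y)"
    let ?J = "\<lambda>y. frechet_derivative ?T (at y)"
    have img: "?T ` overlap ?c ?d = overlap ?d ?c" by (rule transition_image[OF c d])
    have h: "?h y = \<bar>det (matrix (?J y))\<bar> * ?h' (?T y)" if y: "y \<in> overlap ?c ?d" for y
      using mu_transform[OF c d y] D_transform[OF ab(1) c d y] cinv_transition[OF c d y]
      by (simp add: jacobian_def)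
    \<comment> \<open>A change of variables relates only the overlaps. In the chart of
      \<open>a\<close> the rest contributes nothing because \<phi>_b vanishes there; in the chart of
      \<open>b\<close> because V(\<phi>_a) does.\<close>
    have out: "?h y = 0" if "y \<in> chart_image ?c - overlap ?c ?d" for y
    proof -
      have "cinv ?c y \<notin> fst ?d" using that overlap_iff[OF c, of y ?d] by blast
      then have "\<phi> b (cinv ?c y) = 0" using \<phi>_fst[OF ab(2)] by blast
      then show ?thesis by simp
    qed
    have "set_integrable lborel (overlap ?c ?d) ?h"
      by (rule set_integral_restrict(1)[where f = ?h, THEN iffD1, OF overlap_subset _ int_J[OF ab]])
        (rule out)
    moreover have "indicator (overlap ?c ?d) y *\<^sub>R ?h y
        = indicator (overlap ?c ?d) y *\<^sub>R (\<bar>det (matrix (?J y))\<bar> * ?h' (?T y))" for y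
      using h[of y] by (cases "y \<in> overlap ?c ?d") simp_all
    ultimately have int: "set_integrable lborel (overlap ?c ?d) (\<lambda>y. \<bar>det (matrix (?J y))\<bar> * ?h' (?T y))"
      by (simp only: set_integrable_def)
    have "J a b = (LINT y:overlap ?c ?d|lborel. ?h y)"
      unfolding J_def by (rule set_integral_restrict(2)[OF overlap_subset]) (rule out)
    also have "\<dots> = (LINT y:overlap ?c ?d|lborel. \<bar>det (matrix (?J y))\<bar> * ?h' (?T y))"
      by (rule set_lebesgue_integral_cong) (use h open_overlap[OF c d] in auto)
    also have "\<dots> = (LINT y:?T ` overlap ?c ?d|lborel. ?h' y)"
    proof (rule change_of_variables(2)[symmetric, OF open_overlap[OF c d] _ transition_inj[OF c d] _ _ int])
      show "open (?T ` overlap ?c ?d)" unfolding img by (rule open_overlap[OF d c])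
      show "(?T has_derivative ?J y) (at y)" if "y \<in> overlap ?c ?d" for y
        using smooth_onD(2)[OF smooth_transition[OF c d] that] .
      have "continuous_on (chart_image ?d) ?h'"
        using ab d by (intro continuous_on_mult mu_cont \<phi>_cont D_cont)
      then show "continuous_on (?T ` overlap ?c ?d) ?h'"
        unfolding img by (rule continuous_on_subset[OF _ overlap_subset])
    qed
    also have "\<dots> = J' a b"
      unfolding img J'_def
    proof (rule set_integral_restrict(2)[symmetric, OF overlap_subset])
      fix y assume y: "y \<in> chart_image ?d - overlap ?d ?c"
      then have "cinv ?d y \<notin> fst ?c" using overlap_iff[OF d, of y ?c] by blast
      then have "D a ?d y = 0" using y by (intro D_zero ab d) auto
      then show "?h' y = 0" by simp
    qed
    finally show ?thesis .
  qed
  \<comment> \<open>The integral of V(\<phi>_a) in the chart of \<open>a\<close>. Inserting the sum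
    of all \<phi>_b, which is 1, splits it into the \<open>J a b\<close>; after the move to
    \<open>J'\<close> the sum over \<open>a\<close> can be taken under one integral, where
    \<open>D_sum\<close> applies.\<close>
  define Q where "Q a = (LINT y:chart_image (fst a)|lborel. mu (fst a) y * D a (fst a) y)" for a
  have Q: "Q a = (\<Sum>b\<in>I. J a b)" if a: "a \<in> I" for a
  proof -
    have "Q a = (LINT y:chart_image (fst a)|lborel.
        \<Sum>b\<in>I. mu (fst a) y * (\<phi> b (cinv (fst a) y) * D a (fst a) y))"
      unfolding Q_def
    proof (rule set_lebesgue_integral_cong, simp add: op idx(1)[OF a], intro allI impI)
      fix y assume "y \<in> chart_image (fst a)"
      then have "(\<Sum>b\<in>I. \<phi> b (cinv (fst a) y)) = 1" by (intro \<phi>_sum cinv_topspace idx(1)[OF a])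
      then show "mu (fst a) y * D a (fst a) y
          = (\<Sum>b\<in>I. mu (fst a) y * (\<phi> b (cinv (fst a) y) * D a (fst a) y))"
        by (simp flip: sum_distrib_left sum_distrib_right)
    qed
    also have "\<dots> = (\<Sum>b\<in>I. J a b)"
      unfolding J_def by (rule set_integral_sum(2)) (rule int_J[OF a])
    finally show ?thesis .
  qed
  have "(\<Sum>a\<in>I. J' a b) = 0" if b: "b \<in> I" for b
  proof -
    have "(\<Sum>a\<in>I. J' a b) = (LINT y:chart_image (fst b)|lborel.
        \<Sum>a\<in>I. mu (fst b) y * (\<phi> b (cinv (fst b) y) * D a (fst b) y))"
      unfolding J'_def by (rule set_integral_sum(2)[symmetric]) (rule int_J'[OF _ b])
    also have "\<dots> = (LINT y:chart_image (fst b)|lborel. 0)"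
      by (rule set_lebesgue_integral_cong)
        (use idx(1)[OF b] in \<open>auto simp: op D_sum simp flip: sum_distrib_left\<close>)
    finally show ?thesis by (simp add: set_lebesgue_integral_def)
  qed
  then have Q_sum: "(\<Sum>a\<in>I. Q a) = 0"
    by (simp add: Q JJ') (subst sum.swap, simp)
  define P where "P a = (LINT y:chart_image (fst a)|lborel.
      mu (fst a) y * (\<phi> a (cinv (fst a) y) * divergence (g (fst a)) (V (fst a)) y))" for a
  have cont_div: "continuous_on (chart_image c) (divergence (g c) (V c))" if "c \<in> A" for c
    using smooth_onD(3)[OF local_metric.smooth_divergence[OF local_metric smV]] that by blast
  have int_P: "set_integrable lborel (chart_image (fst a))
      (\<lambda>y. mu (fst a) y * (\<phi> a (cinv (fst a) y) * divergence (g (fst a)) (V (fst a)) y))"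
    if "a \<in> I" for a
    by (intro int_mu continuous_on_mult \<phi>_cont cont_div idx(1) that) (simp add: \<phi>_out that)
  \<comment> \<open>Integration by parts in a single chart: div(\<phi>_a V) = \<phi>_a div V +
    V(\<phi>_a), and the left-hand side has compact support in that chart.\<close>
  have PQ: "P a + Q a = 0" if a: "a \<in> I" for a
  proof -
    let ?c = "fst a"
    have c: "?c \<in> A" using idx a by blast
    let ?F = "\<lambda>i y. mu ?c y * (\<phi> a (cinv ?c y) * V ?c y $ i)"
    have F: "Ck_on 1 (?F i) (chart_image ?c)" for i
      using smooth_mu[OF c] smooth_on_vec_nth[OF op[OF c] smV[OF c]]
      by (intro Ck_on_mult op c \<phi>_C1 a) (auto simp: smooth_on_def)
    have F0: "?F i y = 0" if "y \<in> chart_image ?c - K a" for i y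
      using that \<phi>_out[OF a] by simp
    have int: "set_integrable lborel (chart_image ?c) (partial i (?F i))" for i
      by (rule set_integral_partial_compact_support(1)[OF F op[OF c] idx(2,3)[OF a]]) (rule F0)
    have int0: "(LINT y:chart_image ?c|lborel. partial i (?F i) y) = 0" for i
      by (rule set_integral_partial_compact_support(2)[OF F op[OF c] idx(2,3)[OF a]]) (rule F0)
    have "P a + Q a = (LINT y:chart_image ?c|lborel.
        mu ?c y * (\<phi> a (cinv ?c y) * divergence (g ?c) (V ?c) y) + mu ?c y * D a ?c y)"
      unfolding P_def Q_def
      by (rule set_integral_add(2)[symmetric, OF int_P[OF a]])
        (intro int_mu a D_cont c, simp add: D_out a)
    also have "\<dots> = (LINT y:chart_image ?c|lborel. \<Sum>i\<in>UNIV. partial i (?F i) y)"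
    proof (rule set_lebesgue_integral_cong, simp add: op c, intro allI impI)
      fix y assume "y \<in> chart_image ?c"
      then show "mu ?c y * (\<phi> a (cinv ?c y) * divergence (g ?c) (V ?c) y) + mu ?c y * D a ?c y
          = (\<Sum>i\<in>UNIV. partial i (?F i) y)"
        using local_metric.divergence_vol[OF local_metric[OF c] _ smV[OF c] \<phi>_diff[OF a c]]
        by (simp add: mu_def D_def)
    qed
    also have "\<dots> = 0"
      by (subst set_integral_sum(2)[OF int]) (simp only: int0 sum.neutral_const)
    finally show ?thesis .
  qed
  \<comment> \<open>The \<open>P a\<close> are integrals of nonnegative functions with total 0, so
    each vanishes; the one whose cutoff is positive at \<open>x0\<close> decides the claim.\<close>
  have "(\<Sum>a\<in>I. P a) = 0"
    using PQ Q_sum by (simp add: eq_neg_iff_add_eq_0[symmetric] sum_negf)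
  moreover have "0 \<le> P a" if "a \<in> I" for a
    unfolding P_def set_lebesgue_integral_def
    using that idx(1) by (intro integral_nonneg_AE AE_I2)
      (auto simp: indicator_def \<phi>_nonneg nonneg mu_pos less_imp_le)
  ultimately have P0: "P a = 0" if "a \<in> I" for a
    using sum_nonneg_eq_0_iff[OF I(1), of P] that by blast
  obtain z r where a: "(c0, z, r) \<in> I" "0 < \<phi> (c0, z, r) (cinv c0 x0)" using \<phi>_pos by blast
  have "mu c0 x0 * (\<phi> (c0, z, r) (cinv c0 x0) * divergence (g c0) (V c0) x0) = 0"
  proof (rule nonneg_integral_zero_imp_zero[OF op[OF c0(1)]])
    show "continuous_on (chart_image c0)
        (\<lambda>y. mu c0 y * (\<phi> (c0, z, r) (cinv c0 y) * divergence (g c0) (V c0) y))"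
      by (intro continuous_on_mult mu_cont \<phi>_cont cont_div c0 a)
    show "0 \<le> mu c0 y * (\<phi> (c0, z, r) (cinv c0 y) * divergence (g c0) (V c0) y)"
      if "y \<in> chart_image c0" for y
      using that c0(1) by (simp add: \<phi>_nonneg nonneg mu_pos less_imp_le)
    show "set_integrable lborel (chart_image c0)
        (\<lambda>y. mu c0 y * (\<phi> (c0, z, r) (cinv c0 y) * divergence (g c0) (V c0) y))"
      using int_P[OF a(1)] by simp
    show "(LINT y:chart_image c0|lborel.
        mu c0 y * (\<phi> (c0, z, r) (cinv c0 y) * divergence (g c0) (V c0) y)) = 0"
      using P0[OF a(1)] by (simp add: P_def)
  qed (rule c0)
  then show "divergence (g c0) (V c0) x0 = 0" using a(2) mu_pos[OF c0] by simp
qed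

end

section \<open>The dual of the Lie derivative applied to X as a global vector field\<close>

context riemannian_manifold
begin

lemma smooth_vector_field_lie_up:
  assumes X: "smooth_vector_field A X"
  shows "smooth_vector_field A (\<lambda>c. local_metric.lie_up (g c) (X c))"
  unfolding smooth_vector_field_def
proof (intro conjI ballI)
  have smX: "smooth_on (X c) (chart_image c)" if "c \<in> A" for c
    using X that by (simp add: smooth_vector_field_def)
  show "smooth_on (local_metric.lie_up (g c) (X c)) (chart_image c)" if "c \<in> A" for c
    by (rule local_metric.smooth_lie_up[OF local_metric smX]) (rule that)+
  fix c d p assume c: "c \<in> A" and d: "d \<in> A" and p: "p \<in> fst c \<inter> fst d"
  interpret C: local_metric "chart_image c" "g c" by (rule local_metric[OF c])
  interpret D: local_metric "chart_image d" "g d" by (rule local_metric[OF d])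
  define x where "x = snd c p"
  define y where "y = snd d p"
  have x: "x \<in> chart_image c" and y: "y \<in> chart_image d" and ov: "x \<in> overlap c d"
    and T: "transition c d x = y"
    using p c by (auto simp: x_def y_def chart_mem overlap_def transition_chart)
  define J where "J = jacobian (transition c d) (at x)"
  let ?L = "lie_metric (X c) (g c) x" and ?L' = "lie_metric (X d) (g d) y"
  have L: "?L = transpose J ** ?L' ** J"
    unfolding J_def T[symmetric]
  proof (rule lie_metric_pullback[OF open_overlap[OF c d] chart_image_open[OF d] ov])
    show "transition c d ` overlap c d \<subseteq> chart_image d"
      using transition_image[OF c d] overlap_subset by blast
    show "smooth_on (transition c d) (overlap c d)" by (rule smooth_transition[OF c d])
    show "smooth_on (g c) (overlap c d)" "smooth_on (X c) (overlap c d)"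
      using C.smooth_G smX[OF c] by (auto intro: smooth_on_subset[OF _ overlap_subset])
    show "smooth_on (g d) (chart_image d)" "smooth_on (X d) (chart_image d)"
      using D.smooth_G smX[OF d] by auto
    show "g c w = transpose (jacobian (transition c d) (at w)) ** g d (transition c d w)
        ** jacobian (transition c d) (at w)" if "w \<in> overlap c d" for w
      by (rule metric_transform[OF c d that])
    show "X d (transition c d w) = jacobian (transition c d) (at w) *v X c w" if "w \<in> overlap c d" for w
      by (rule vector_transform[OF X c d that])
  qed
  have Xy: "X d y = J *v X c x" using vector_transform[OF X c d ov] by (simp add: J_def T)
  have "g c x = transpose J ** g d y ** J" using metric_transform[OF c d ov] by (simp add: J_def T)
  then have "transpose J ** (g d y ** J ** C.H x) = mat 1"
    using C.GH[OF x] by (simp add: matrix_mul_assoc)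
  \<comment> \<open>A right inverse of the square matrix \<open>transpose J\<close> is also a left
    inverse. Cancelling \<open>g d y\<close> then gives the contravariant transformation law of the
    inverse metric.\<close>
  then have "g d y ** J ** C.H x ** transpose J = mat 1"
    by (simp add: matrix_left_right_inverse)
  then have "D.H y ** (g d y ** J ** C.H x ** transpose J) = D.H y" by simp
  then have H: "J ** C.H x ** transpose J = D.H y"
    by (simp add: matrix_mul_assoc D.HG y)
  have "D.lie_up (X d) y = (J ** C.H x ** transpose J) *v (?L' *v (J *v X c x))"
    by (simp only: D.lie_up_def H Xy)
  also have "\<dots> = J *v (C.H x *v (?L *v X c x))"
    by (simp only: L matrix_vector_mul_assoc matrix_mul_assoc)
  finally show "D.lie_up (X d) (snd d p)
      = jacobian (transition c d) (at (snd c p)) *v C.lie_up (X c) (snd c p)"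
    by (simp add: C.lie_up_def J_def x_def y_def)
qed

end

section \<open>From vanishing divergence to the Killing equation\<close>

theorem corollary1p4:
  fixes M :: "'a topology"
    and A :: "('a, 'n::finite) chart set"
    and g :: "('a, 'n) tensor2_field"
    and X :: "('a, 'n) vector_field"
    and m lam :: real
  assumes "m \<noteq> 0"
    and "closed_riemannian_manifold M A g"
    and "smooth_vector_field A X"
    and "\<forall>c\<in>A. \<forall>x\<in>chart_image c.
           ricci (g c) x + (1/2) *\<^sub>R lie_metric (X c) (g c) x
             - (1/m) *\<^sub>R tensor_product (dual_form (g c) (X c) x) (dual_form (g c) (X c) x)
           = lam *\<^sub>R g c x"
    and "\<forall>c\<in>A. \<forall>x\<in>chart_image c. divergence (g c) (X c) x = 0"
  shows "killing_field A g X"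
proof -
  interpret closed_riemannian_manifold M A g by fact
  let ?V = "\<lambda>c. local_metric.lie_up (g c) (X c)"
  have smX: "smooth_on (X c) (chart_image c)" if "c \<in> A" for c
    using assms(3) that by (simp add: smooth_vector_field_def)
  have div: "divergence (g c) (?V c) x = (1/2) * trace (local_metric.H (g c) x
      ** lie_metric (X c) (g c) x ** local_metric.H (g c) x ** lie_metric (X c) (g c) x)"
    if "c \<in> A" "x \<in> chart_image c" for c x
    using assms(4,5) that
    by (intro local_metric.divergence_lie_up[OF local_metric smX, where m = m and lam = lam]) auto
  have nonneg: "0 \<le> divergence (g c) (?V c) x" if "c \<in> A" "x \<in> chart_image c" for c x
    using local_metric.norm_tensor(1)[OF local_metric[OF that(1)] that(2)
        local_metric.transpose_lie_metric[OF local_metric[OF that(1)] that(2)]]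
    by (simp add: div that)
  have "lie_metric (X c) (g c) x = 0" if "c \<in> A" "x \<in> chart_image c" for c x
    using nonneg_divergence_eq_zero[OF smooth_vector_field_lie_up[OF assms(3)] nonneg that]
      local_metric.norm_tensor(2)[OF local_metric[OF that(1)] that(2)
        local_metric.transpose_lie_metric[OF local_metric[OF that(1)] that(2)]]
    by (simp add: div that)
  then show ?thesis using assms(3) by (simp add: killing_field_def)
qed

end
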